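(* Let $\mathbb{T}E'$ and $\mathbb{T}E$ be tropical elliptic curves, let $d$ be a positive integer, and let $G\subset \mathbb{T}E'\oplus\mathbb{T}E$ be the graph of a group isomorphism $\alpha:\mathbb{T}E'[d]\to\mathbb{T}E[d]$ between the $d$-torsion subgroups (i.e. $(\mathbb{T}E',\mathbb{T}E,G)$ is splitting data). Then there exist (i) either a tropical curve $\Gamma$ of genus $2$, or a family of tropical curves $\Gamma_t$, $t\geq 0$, each of genus $2$; and correspondingly (ii) either a pair of optimal covers $(\varphi':\Gamma\to\mathbb{T}E',\ \varphi:\Gamma\to\mathbb{T}E)$, or a family of pairs of optimal covers $(\varphi'_t:\Gamma_t\to\mathbb{T}E',\ \varphi_t:\Gamma_t\to\mathbb{T}E)$, $t\geq 0$, all of degree $d$, that induce a splitting, that is, an isogeny $$\phi:\mathbb{T}E'\oplus\mathbb{T}E\to \mathrm{Jac}(\Gamma),\qquad \phi(x',x)=\varphi'^{*}(x')+\varphi^{*}(x),$$ with $\mathrm{Jac}_d(\mathbb{T}E')\cong\ker(\phi)\cong \mathrm{Jac}_d(\mathbb{T}E)$ (in the family case, this holds for every $t\ge 0$ with $\Gamma,\varphi',\varphi$ replaced by $\Gamma_t,\varphi'_t,\varphi_t$).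
   Context: Tropical curves and covers. A metric graph $(G,l)$ is a finite graph with a length function $l:E(G)\to\mathbb{R}_{>0}$; its geometric realization $\Gamma$ is a tropical curve, with model $(G,l)$ and genus $b_1(G)$. A tropical elliptic curve is a tropical curve of genus $1$, i.e. a circle of some length $l_{\mathbb{T}E}>0$. A tropical cover $\varphi:\Gamma\to\tilde\Gamma$ is a continuous surjective map such that, for suitable models, vertices map to vertices, preimages of edges are unions of edges, $\varphi$ is affine with integer slope $d_e(\varphi)$ (possibly $0$) on each edge $e$, and $\varphi$ is harmonic: for every $P\in\Gamma$ the local degree $d_P(\varphi)=\sum_{v\mapsto\tilde v}d_v(\varphi)$ (sum over tangent directions $v$ at $P$ mapping to $\tilde v$, where $d_v(\varphi)$ is the directional derivative in direction $v$) is independent of the tangent direction $\tilde v$ at $\varphi(P)$. The degree is $\deg\varphi=\sum_{P\mapsto\tilde P}d_P(\varphi)$ for any $\tilde P\in\tilde\Gamma$. A cover $\varphi:\Gamma\to\mathbb{T}E$ from a genus $2$ curve to a genus $1$ curve is optimal if whenever $\varphi=\psi\circ\tilde\varphi$ with tropical covers $\tilde\varphi:\Gamma\to\mathbb{T}\tilde E$ and $\psi:\mathbb{T}\tilde E\to\mathbb{T}E$, with $\mathbb{T}\tilde E$ a tropical elliptic curve, $\psi$ is an isomorphism (degree $1$). Integral tori. A real torus with integral structure is a triple $\Sigma=(\Lambda,\Lambda',[\cdot,\cdot])$ of finitely generated free abelian groups of the same rank with a non-degenerate pairing $\Lambda\times\Lambda'\to\mathbb{R}$; its group of points is $\mathrm{Hom}(\Lambda,\mathbb{R})/\Lambda'$.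 A morphism $f:\Sigma_1\to\Sigma_2$ is a pair of homomorphisms $f^\#:\Lambda_2\to\Lambda_1$, $f_\#:\Lambda'_1\to\Lambda'_2$ with $[f^\#(\lambda_2),\lambda_1']_1=[\lambda_2,f_\#(\lambda_1')]_2$; it is an isogeny if $f^\#$ and $f_\#$ are injective. A tropical abelian variety (tav) is such a torus carrying a polarization, i.e. a homomorphism $\zeta:\Lambda'\to\Lambda$ with $[\zeta(\cdot),\cdot]$ symmetric and positive definite; it is principally polarized if $\zeta$ is bijective. The kernel $\ker(f)$ of a morphism is the kernel of the induced homomorphism of groups of points. The coproduct $\Sigma_1\oplus\Sigma_2$ is the componentwise product of lattices with the sum of the pairings and componentwise polarization. Jacobians. $\mathrm{Jac}(\Gamma)=(\Omega^1_\Gamma(\mathbb{Z}),H_1(\Gamma,\mathbb{Z}),\int)$, where $\Omega^1_\Gamma(\mathbb{Z})$ is the lattice of harmonic $1$-forms $\sum_e\omega_e\,de$ ($\omega_e\in\mathbb{Z}$, with the sum over incoming edges equal to the sum over outgoing edges at each vertex of an oriented model), and $\int_e de'=l(e)$ if $e=e'$ and $0$ otherwise, extended bilinearly; its principal polarization is $\sum a_ee\mapsto\sum a_e\,de$. As a group, $\mathrm{Jac}(\Gamma)\cong\mathrm{Pic}^0(\Gamma)$ (degree $0$ divisors modulo principal divisors). For a cover $\varphi:\Gamma\to\mathbb{T}E$, $\varphi^*:\mathrm{Jac}(\mathbb{T}E)\to\mathrm{Jac}(\Gamma)$ is the morphism induced by the pull-back of divisors $Q\mapsto\sum_{P\mapsto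 Q}d_P(\varphi)P$. A tropical elliptic curve is identified with its Jacobian by choosing a base point, so $\mathbb{T}E\cong\mathbb{R}/l_{\mathbb{T}E}\mathbb{Z}$ as a group; $\mathbb{T}E[d]\cong\mathrm{Jac}_d(\mathbb{T}E)$ denotes its $d$-torsion subgroup. *)

theory Defs
  imports
    "HOL-Analysis.Analysis"
    "HOL-Algebra.Free_Abelian_Groups"
    "Graph_Theory.Graph_Theory"
begin

section \<open>Tropical curves\<close>

text \<open>
  Vertices and edges are labelled by natural numbers. Every finite graph is isomorphic to one of
  this kind, and the fixed labels make it possible to quantify over all tropical curves inside a
  formula. The direction of the arcs is an auxiliary orientation of the model.
\<close>

record metric_graph =
  graph :: "(nat, nat) pre_digraph"
  len :: "nat \<Rightarrow> real"

text \<open>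
  \<open>Inner e x\<close> is the point at distance \<open>x\<close> from the tail of the edge \<open>e\<close>; it is a point of the
  geometric realization only for \<open>0 < x < len \<Gamma> e\<close>.
\<close>

datatype point = Vertex nat | Inner nat real

definition pt :: "metric_graph \<Rightarrow> nat \<Rightarrow> real \<Rightarrow> point" where
  "pt \<Gamma> e x =
     (if x = 0 then Vertex (tail (graph \<Gamma>) e)
      else if x = len \<Gamma> e then Vertex (head (graph \<Gamma>) e)
      else Inner e x)"

definition points :: "metric_graph \<Rightarrow> point set" where
  "points \<Gamma> = Vertex ` verts (graph \<Gamma>) \<union>
     {Inner e x | e x. e \<in> arcs (graph \<Gamma>) \<and> 0 < x \<and> x < len \<Gamma> e}"

text \<open>The quotient topology of the disjoint union of the closed edges.\<close>

definition realization :: "metric_graph \<Rightarrow> point topology" where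
  "realization \<Gamma> = topology (\<lambda>U. U \<subseteq> points \<Gamma> \<and>
     (\<forall>e\<in>arcs (graph \<Gamma>).
        openin (top_of_set {0..len \<Gamma> e}) {x \<in> {0..len \<Gamma> e}. pt \<Gamma> e x \<in> U}))"

lemma openin_realization:
  "openin (realization \<Gamma>) U \<longleftrightarrow> U \<subseteq> points \<Gamma> \<and>
     (\<forall>e\<in>arcs (graph \<Gamma>).
        openin (top_of_set {0..len \<Gamma> e}) {x \<in> {0..len \<Gamma> e}. pt \<Gamma> e x \<in> U})"
proof -
  let ?P = "\<lambda>e U. {x \<in> {0..len \<Gamma> e}. pt \<Gamma> e x \<in> U}"
  let ?L = "\<lambda>U. U \<subseteq> points \<Gamma> \<and>
     (\<forall>e\<in>arcs (graph \<Gamma>). openin (top_of_set {0..len \<Gamma> e}) (?P e U))"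
  have "istopology ?L"
    unfolding istopology_def
  proof (intro conjI allI impI ballI)
    fix S T assume S: "?L S" and T: "?L T"
    then show "S \<inter> T \<subseteq> points \<Gamma>" by auto
    fix e assume "e \<in> arcs (graph \<Gamma>)"
    then have "openin (top_of_set {0..len \<Gamma> e}) (?P e S \<inter> ?P e T)"
      using S T by (intro openin_Int) auto
    moreover have "?P e (S \<inter> T) = ?P e S \<inter> ?P e T" by auto
    ultimately show "openin (top_of_set {0..len \<Gamma> e}) (?P e (S \<inter> T))" by simp
  next
    fix \<K> assume K: "\<forall>K\<in>\<K>. ?L K"
    then show "\<Union>\<K> \<subseteq> points \<Gamma>" by auto
    fix e assume "e \<in> arcs (graph \<Gamma>)"
    then have "openin (top_of_set {0..len \<Gamma> e}) (\<Union>(?P e ` \<K>))"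
      using K by (intro openin_Union) auto
    moreover have "?P e (\<Union>\<K>) = \<Union>(?P e ` \<K>)" by auto
    ultimately show "openin (top_of_set {0..len \<Gamma> e}) (?P e (\<Union>\<K>))" by simp
  qed
  then show ?thesis
    unfolding realization_def by (subst topology_inverse') simp_all
qed

definition tropical_curve :: "metric_graph \<Rightarrow> bool" where
  "tropical_curve \<Gamma> \<longleftrightarrow> fin_digraph (graph \<Gamma>) \<and> Digraph_Component.connected (graph \<Gamma>) \<and>
     (\<forall>e\<in>arcs (graph \<Gamma>). 0 < len \<Gamma> e)"

text \<open>
  Harmonic 1-forms \<open>\<Sum> \<omega>\<^sub>e de\<close> and 1-cycles \<open>\<Sum> c\<^sub>e e\<close> with integral coefficients. On an oriented
  model both are cut out by the same balancing condition, so that the principal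
  polarization of the Jacobian is the identity on coefficients.
\<close>

definition balanced :: "metric_graph \<Rightarrow> (nat \<Rightarrow> int) set" where
  "balanced \<Gamma> = {c. (\<forall>e. e \<notin> arcs (graph \<Gamma>) \<longrightarrow> c e = 0) \<and>
     (\<forall>v\<in>verts (graph \<Gamma>).
        (\<Sum>e | e \<in> arcs (graph \<Gamma>) \<and> head (graph \<Gamma>) e = v. c e) =
        (\<Sum>e | e \<in> arcs (graph \<Gamma>) \<and> tail (graph \<Gamma>) e = v. c e))}"

definition harmonic_forms :: "metric_graph \<Rightarrow> (nat \<Rightarrow> int) monoid" where
  "harmonic_forms \<Gamma> =
     \<lparr>carrier = balanced \<Gamma>, mult = (\<lambda>\<omega> \<eta> e. \<omega> e + \<eta> e), one = (\<lambda>e. 0)\<rparr>"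

definition H1 :: "metric_graph \<Rightarrow> (nat \<Rightarrow> int) monoid" where
  "H1 \<Gamma> = \<lparr>carrier = balanced \<Gamma>, mult = (\<lambda>b c e. b e + c e), one = (\<lambda>e. 0)\<rparr>"

definition has_genus :: "metric_graph \<Rightarrow> nat \<Rightarrow> bool" where
  "has_genus \<Gamma> g \<longleftrightarrow> H1 \<Gamma> \<cong> free_Abelian_group {..<g}"


section \<open>Tropical covers\<close>

text \<open>
  A tangent direction at a point is a triple \<open>(e, x, s)\<close>: leave the point \<open>pt \<Gamma> e x\<close> along the edge
  \<open>e\<close>, with \<open>s = 1\<close> for increasing and \<open>s = -1\<close> for decreasing coordinate.
\<close>

type_synonym direction = "nat \<times> real \<times> real"

definition directions :: "metric_graph \<Rightarrow> point \<Rightarrow> direction set" where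
  "directions \<Gamma> P = {(e, x, s). e \<in> arcs (graph \<Gamma>) \<and> 0 \<le> x \<and> x \<le> len \<Gamma> e \<and> pt \<Gamma> e x = P \<and>
     (s = 1 \<and> x < len \<Gamma> e \<or> s = -1 \<and> 0 < x)}"

fun along :: "metric_graph \<Rightarrow> direction \<Rightarrow> real \<Rightarrow> point" where
  "along \<Gamma> (e, x, s) \<epsilon> = pt \<Gamma> e (x + s * \<epsilon>)"

text \<open>
  The directional derivative of \<open>f\<close> in direction \<open>v\<close> if \<open>v\<close> is mapped to \<open>w\<close>, and \<open>0\<close> if \<open>f\<close> is
  constant along \<open>v\<close> or maps \<open>v\<close> to another direction.
\<close>

definition dir_slope ::
    "metric_graph \<Rightarrow> metric_graph \<Rightarrow> (point \<Rightarrow> point) \<Rightarrow> direction \<Rightarrow> direction \<Rightarrow> nat" where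
  "dir_slope \<Gamma> \<Delta> f v w =
     (if \<exists>m::nat. \<forall>\<^sub>F \<epsilon> in at_right 0. f (along \<Gamma> v \<epsilon>) = along \<Delta> w (real m * \<epsilon>)
      then (THE m::nat. \<forall>\<^sub>F \<epsilon> in at_right 0. f (along \<Gamma> v \<epsilon>) = along \<Delta> w (real m * \<epsilon>))
      else 0)"

definition dir_deg ::
    "metric_graph \<Rightarrow> metric_graph \<Rightarrow> (point \<Rightarrow> point) \<Rightarrow> point \<Rightarrow> direction \<Rightarrow> nat" where
  "dir_deg \<Gamma> \<Delta> f P w = (\<Sum>v\<in>directions \<Gamma> P. dir_slope \<Gamma> \<Delta> f v w)"

definition harmonic :: "metric_graph \<Rightarrow> metric_graph \<Rightarrow> (point \<Rightarrow> point) \<Rightarrow> bool" where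
  "harmonic \<Gamma> \<Delta> f \<longleftrightarrow> (\<forall>P\<in>points \<Gamma>. \<forall>w\<in>directions \<Delta> (f P). \<forall>w'\<in>directions \<Delta> (f P).
     dir_deg \<Gamma> \<Delta> f P w = dir_deg \<Gamma> \<Delta> f P w')"

definition local_deg :: "metric_graph \<Rightarrow> metric_graph \<Rightarrow> (point \<Rightarrow> point) \<Rightarrow> point \<Rightarrow> nat" where
  "local_deg \<Gamma> \<Delta> f P = dir_deg \<Gamma> \<Delta> f P (SOME w. w \<in> directions \<Delta> (f P))"

text \<open>
  A model of a tropical curve is given by its vertex set, a finite set of points of the geometric
  realization. Models may always be refined, so it suffices to consider those that contain the
  vertices of the given model. The edge \<open>(e, a, b)\<close> is the part of \<open>e\<close> between two consecutive
  points of the vertex set.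
\<close>

definition vertex_set :: "metric_graph \<Rightarrow> point set \<Rightarrow> bool" where
  "vertex_set \<Gamma> A \<longleftrightarrow> finite A \<and> A \<subseteq> points \<Gamma> \<and> Vertex ` verts (graph \<Gamma>) \<subseteq> A"

definition model_edges :: "metric_graph \<Rightarrow> point set \<Rightarrow> (nat \<times> real \<times> real) set" where
  "model_edges \<Gamma> A = {(e, a, b). e \<in> arcs (graph \<Gamma>) \<and> 0 \<le> a \<and> a < b \<and> b \<le> len \<Gamma> e \<and>
     pt \<Gamma> e a \<in> A \<and> pt \<Gamma> e b \<in> A \<and> (\<forall>x\<in>{a<..<b}. pt \<Gamma> e x \<notin> A)}"

definition open_edges :: "metric_graph \<Rightarrow> point set \<Rightarrow> point set set" where
  "open_edges \<Gamma> A = {pt \<Gamma> e ` {a<..<b} | e a b. (e, a, b) \<in> model_edges \<Gamma> A}"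

definition affine_on_edge ::
    "metric_graph \<Rightarrow> metric_graph \<Rightarrow> (point \<Rightarrow> point) \<Rightarrow> nat \<times> real \<times> real \<Rightarrow> bool" where
  "affine_on_edge \<Gamma> \<Delta> f = (\<lambda>(e, a, b). \<exists>e'\<in>arcs (graph \<Delta>). \<exists>(k::int) (c::real). \<forall>x\<in>{a..b}.
     0 \<le> c + of_int k * x \<and> c + of_int k * x \<le> len \<Delta> e' \<and>
     f (pt \<Gamma> e x) = pt \<Delta> e' (c + of_int k * x))"

definition tropical_cover :: "metric_graph \<Rightarrow> metric_graph \<Rightarrow> (point \<Rightarrow> point) \<Rightarrow> bool" where
  "tropical_cover \<Gamma> \<Delta> f \<longleftrightarrow>
     continuous_map (realization \<Gamma>) (realization \<Delta>) f \<and>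
     f ` points \<Gamma> = points \<Delta> \<and>
     (\<exists>A B. vertex_set \<Gamma> A \<and> vertex_set \<Delta> B \<and> f ` A \<subseteq> B \<and>
        (\<forall>J\<in>open_edges \<Delta> B. \<exists>\<I>\<subseteq>open_edges \<Gamma> A. {P \<in> points \<Gamma>. f P \<in> J} = \<Union>\<I>) \<and>
        (\<forall>j\<in>model_edges \<Gamma> A. affine_on_edge \<Gamma> \<Delta> f j)) \<and>
     harmonic \<Gamma> \<Delta> f"

text \<open>
  Fibres are restricted to points of nonzero local degree: a contracted edge makes a fibre
  infinite, but its inner points have local degree \<open>0\<close>.
\<close>

definition fibre ::
    "metric_graph \<Rightarrow> metric_graph \<Rightarrow> (point \<Rightarrow> point) \<Rightarrow> point \<Rightarrow> point set" where
  "fibre \<Gamma> \<Delta> f Q = {P \<in> points \<Gamma>. f P = Q \<and> local_deg \<Gamma> \<Delta> f P \<noteq> 0}"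

definition has_degree :: "metric_graph \<Rightarrow> metric_graph \<Rightarrow> (point \<Rightarrow> point) \<Rightarrow> nat \<Rightarrow> bool" where
  "has_degree \<Gamma> \<Delta> f d \<longleftrightarrow> (\<forall>Q\<in>points \<Delta>. (\<Sum>P\<in>fibre \<Gamma> \<Delta> f Q. local_deg \<Gamma> \<Delta> f P) = d)"

definition tropical_iso :: "metric_graph \<Rightarrow> metric_graph \<Rightarrow> (point \<Rightarrow> point) \<Rightarrow> bool" where
  "tropical_iso \<Gamma> \<Delta> f \<longleftrightarrow> tropical_cover \<Gamma> \<Delta> f \<and> inj_on f (points \<Gamma>) \<and>
     tropical_cover \<Delta> \<Gamma> (inv_into (points \<Gamma>) f)"

definition circle :: "real \<Rightarrow> metric_graph" where
  "circle l = \<lparr>graph = \<lparr>verts = {0}, arcs = {0}, tail = (\<lambda>_. 0), head = (\<lambda>_. 0)\<rparr>, len = (\<lambda>_. l)\<rparr>"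

definition elliptic_curve :: "metric_graph \<Rightarrow> bool" where
  "elliptic_curve E \<longleftrightarrow> tropical_curve E \<and> has_genus E 1 \<and>
     (\<exists>l>0. \<exists>h. tropical_iso (circle l) E h)"

definition optimal_cover :: "metric_graph \<Rightarrow> metric_graph \<Rightarrow> (point \<Rightarrow> point) \<Rightarrow> bool" where
  "optimal_cover \<Gamma> E \<phi> \<longleftrightarrow> tropical_cover \<Gamma> E \<phi> \<and>
     (\<forall>E2 \<phi>2 \<psi>. elliptic_curve E2 \<and> tropical_cover \<Gamma> E2 \<phi>2 \<and> tropical_cover E2 E \<psi> \<and>
        (\<forall>P\<in>points \<Gamma>. \<phi> P = \<psi> (\<phi>2 P)) \<longrightarrow> tropical_iso E2 E \<psi>)"


section \<open>Real tori with integral structure\<close>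

record ('a, 'b) torus =
  lattice :: "'a monoid"
  colattice :: "'b monoid"
  pairing :: "'a \<Rightarrow> 'b \<Rightarrow> real"

definition hom_real :: "'a monoid \<Rightarrow> ('a \<Rightarrow> real) monoid" where
  "hom_real L =
     \<lparr>carrier = {h \<in> extensional (carrier L).
        \<forall>x\<in>carrier L. \<forall>y\<in>carrier L. h (x \<otimes>\<^bsub>L\<^esub> y) = h x + h y},
      mult = (\<lambda>g h. restrict (\<lambda>x. g x + h x) (carrier L)),
      one = restrict (\<lambda>x. 0) (carrier L)\<rparr>"

definition periods :: "('a, 'b) torus \<Rightarrow> ('a \<Rightarrow> real) set" where
  "periods \<Sigma> = (\<lambda>y. restrict (\<lambda>x. pairing \<Sigma> x y) (carrier (lattice \<Sigma>))) ` carrier (colattice \<Sigma>)"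

definition torus_points :: "('a, 'b) torus \<Rightarrow> ('a \<Rightarrow> real) set monoid" where
  "torus_points \<Sigma> = hom_real (lattice \<Sigma>) Mod periods \<Sigma>"

definition torus_sum :: "('a, 'b) torus \<Rightarrow> ('c, 'd) torus \<Rightarrow> ('a \<times> 'c, 'b \<times> 'd) torus" where
  "torus_sum \<Sigma>1 \<Sigma>2 =
     \<lparr>lattice = lattice \<Sigma>1 \<times>\<times> lattice \<Sigma>2,
      colattice = colattice \<Sigma>1 \<times>\<times> colattice \<Sigma>2,
      pairing = (\<lambda>(x1, x2) (y1, y2). pairing \<Sigma>1 x1 y1 + pairing \<Sigma>2 x2 y2)\<rparr>"

text \<open>
  The point of the coproduct with given components, under
  \<open>Hom (L1 \<times> L2, \<real>) = Hom (L1, \<real>) \<times> Hom (L2, \<real>)\<close>. Points are cosets, i.e. sets of homomorphisms.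
\<close>

definition point_pair ::
    "('a, 'b) torus \<Rightarrow> ('c, 'd) torus \<Rightarrow> ('a \<Rightarrow> real) set \<Rightarrow> ('c \<Rightarrow> real) set
      \<Rightarrow> ('a \<times> 'c \<Rightarrow> real) set" where
  "point_pair \<Sigma>1 \<Sigma>2 X1 X2 =
     {restrict (\<lambda>(a, b). h1 a + h2 b) (carrier (lattice \<Sigma>1) \<times> carrier (lattice \<Sigma>2)) |
        h1 h2. h1 \<in> X1 \<and> h2 \<in> X2}"

text \<open>
  A morphism \<open>\<Sigma>1 \<rightarrow> \<Sigma>2\<close> is a pair consisting of a contravariant map of the lattices and a
  covariant map of the colattices.
\<close>

definition torus_morphism ::
    "('a, 'b) torus \<Rightarrow> ('c, 'd) torus \<Rightarrow> ('c \<Rightarrow> 'a) \<times> ('b \<Rightarrow> 'd) \<Rightarrow> bool" where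
  "torus_morphism \<Sigma>1 \<Sigma>2 = (\<lambda>(fup, fdown).
     fup \<in> hom (lattice \<Sigma>2) (lattice \<Sigma>1) \<and>
     fdown \<in> hom (colattice \<Sigma>1) (colattice \<Sigma>2) \<and>
     (\<forall>x\<in>carrier (lattice \<Sigma>2). \<forall>y\<in>carrier (colattice \<Sigma>1).
        pairing \<Sigma>1 (fup x) y = pairing \<Sigma>2 x (fdown y)))"

definition isogeny ::
    "('a, 'b) torus \<Rightarrow> ('c, 'd) torus \<Rightarrow> ('c \<Rightarrow> 'a) \<times> ('b \<Rightarrow> 'd) \<Rightarrow> bool" where
  "isogeny \<Sigma>1 \<Sigma>2 f \<longleftrightarrow> torus_morphism \<Sigma>1 \<Sigma>2 f \<and>
     inj_on (fst f) (carrier (lattice \<Sigma>2)) \<and> inj_on (snd f) (carrier (colattice \<Sigma>1))"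

text \<open>
  The induced map on points sends the class of \<open>h\<close> to the class of \<open>h \<circ> fst f\<close>. The product with
  \<open>periods \<Sigma>2\<close> completes the image of a coset to a full coset.
\<close>

definition on_points ::
    "('a, 'b) torus \<Rightarrow> ('c, 'd) torus \<Rightarrow> ('c \<Rightarrow> 'a) \<times> ('b \<Rightarrow> 'd)
      \<Rightarrow> ('a \<Rightarrow> real) set \<Rightarrow> ('c \<Rightarrow> real) set" where
  "on_points \<Sigma>1 \<Sigma>2 f X =
     periods \<Sigma>2 <#>\<^bsub>hom_real (lattice \<Sigma>2)\<^esub>
       ((\<lambda>h. restrict (h \<circ> fst f) (carrier (lattice \<Sigma>2))) ` X)"

definition kernel_group ::
    "('a, 'b) torus \<Rightarrow> ('c, 'd) torus \<Rightarrow> ('c \<Rightarrow> 'a) \<times> ('b \<Rightarrow> 'd) \<Rightarrow> ('a \<Rightarrow> real) set monoid" where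
  "kernel_group \<Sigma>1 \<Sigma>2 f =
     (torus_points \<Sigma>1)
       \<lparr>carrier := kernel (torus_points \<Sigma>1) (torus_points \<Sigma>2) (on_points \<Sigma>1 \<Sigma>2 f)\<rparr>"

definition torsion_group :: "('a, 'b) torus \<Rightarrow> nat \<Rightarrow> ('a \<Rightarrow> real) set monoid" where
  "torsion_group \<Sigma> d =
     (torus_points \<Sigma>)
       \<lparr>carrier := {x \<in> carrier (torus_points \<Sigma>). x [^]\<^bsub>torus_points \<Sigma>\<^esub> d = \<one>\<^bsub>torus_points \<Sigma>\<^esub>}\<rparr>"


section \<open>Jacobians and pull-back\<close>

definition Jac :: "metric_graph \<Rightarrow> (nat \<Rightarrow> int, nat \<Rightarrow> int) torus" where
  "Jac \<Gamma> =
     \<lparr>lattice = harmonic_forms \<Gamma>,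
      colattice = H1 \<Gamma>,
      pairing = (\<lambda>\<omega> c. \<Sum>e\<in>arcs (graph \<Gamma>). of_int (\<omega> e) * of_int (c e) * len \<Gamma> e)\<rparr>"

definition degree_zero_divisors :: "metric_graph \<Rightarrow> (point \<Rightarrow>\<^sub>0 int) set" where
  "degree_zero_divisors \<Gamma> = {D \<in> carrier (free_Abelian_group (points \<Gamma>)).
     (\<Sum>P\<in>Poly_Mapping.keys D. Poly_Mapping.lookup D P) = 0}"

text \<open>
  Piecewise linear 1-chains: integral combinations of segments \<open>(e, a, b)\<close>, each running along the
  edge \<open>e\<close> from coordinate \<open>a\<close> to coordinate \<open>b\<close> (with \<open>a \<le> b\<close> or \<open>b \<le> a\<close>).
\<close>

type_synonym chain = "(nat \<times> real \<times> real) \<Rightarrow>\<^sub>0 int"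

definition chains :: "metric_graph \<Rightarrow> chain set" where
  "chains \<Gamma> = carrier (free_Abelian_group
     {(e, a, b). e \<in> arcs (graph \<Gamma>) \<and> a \<in> {0..len \<Gamma> e} \<and> b \<in> {0..len \<Gamma> e}})"

definition chain_boundary :: "metric_graph \<Rightarrow> chain \<Rightarrow> (point \<Rightarrow>\<^sub>0 int)" where
  "chain_boundary \<Gamma> = frag_extend (\<lambda>(e, a, b). frag_of (pt \<Gamma> e b) - frag_of (pt \<Gamma> e a))"

definition chain_integral :: "chain \<Rightarrow> (nat \<Rightarrow> int) \<Rightarrow> real" where
  "chain_integral \<gamma> \<omega> =
     (\<Sum>(e, a, b)\<in>Poly_Mapping.keys \<gamma>. of_int (Poly_Mapping.lookup \<gamma> (e, a, b)) * of_int (\<omega> e) * (b - a))"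

text \<open>
  The Abel-Jacobi map, which identifies \<open>Pic\<^sup>0 \<Gamma>\<close> with the points of \<open>Jac \<Gamma>\<close>: a divisor \<open>D\<close> goes to
  the class of integration along a chain with boundary \<open>D\<close>. Two such chains differ by a cycle, so
  the integrals along all of them form exactly one coset of the periods.
\<close>

definition abel_jacobi :: "metric_graph \<Rightarrow> (point \<Rightarrow>\<^sub>0 int) \<Rightarrow> ((nat \<Rightarrow> int) \<Rightarrow> real) set" where
  "abel_jacobi \<Gamma> D =
     {restrict (chain_integral \<gamma>) (carrier (harmonic_forms \<Gamma>)) | \<gamma>.
        \<gamma> \<in> chains \<Gamma> \<and> chain_boundary \<Gamma> \<gamma> = D}"

definition pullback_divisor ::
    "metric_graph \<Rightarrow> metric_graph \<Rightarrow> (point \<Rightarrow> point) \<Rightarrow> (point \<Rightarrow>\<^sub>0 int) \<Rightarrow> (point \<Rightarrow>\<^sub>0 int)" where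
  "pullback_divisor \<Gamma> \<Delta> \<phi> =
     frag_extend (\<lambda>Q. \<Sum>P\<in>fibre \<Gamma> \<Delta> \<phi> Q. frag_cmul (int (local_deg \<Gamma> \<Delta> \<phi> P)) (frag_of P))"

text \<open>\<open>f\<close> is the morphism \<open>\<phi>\<^sup>* : Jac \<Delta> \<rightarrow> Jac \<Gamma>\<close>.\<close>

definition pullback_morphism ::
    "metric_graph \<Rightarrow> metric_graph \<Rightarrow> (point \<Rightarrow> point)
      \<Rightarrow> ((nat \<Rightarrow> int) \<Rightarrow> (nat \<Rightarrow> int)) \<times> ((nat \<Rightarrow> int) \<Rightarrow> (nat \<Rightarrow> int)) \<Rightarrow> bool" where
  "pullback_morphism \<Gamma> \<Delta> \<phi> f \<longleftrightarrow> torus_morphism (Jac \<Delta>) (Jac \<Gamma>) f \<and>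
     (\<forall>D\<in>degree_zero_divisors \<Delta>.
        on_points (Jac \<Delta>) (Jac \<Gamma>) f (abel_jacobi \<Delta> D) = abel_jacobi \<Gamma> (pullback_divisor \<Gamma> \<Delta> \<phi> D))"

definition induces_splitting ::
    "nat \<Rightarrow> metric_graph \<Rightarrow> metric_graph \<Rightarrow> metric_graph \<Rightarrow> (point \<Rightarrow> point) \<Rightarrow> (point \<Rightarrow> point) \<Rightarrow> bool"
  where
  "induces_splitting d \<Gamma> E' E \<phi>' \<phi> \<longleftrightarrow>
     (\<exists>f' f \<Phi>. pullback_morphism \<Gamma> E' \<phi>' f' \<and> pullback_morphism \<Gamma> E \<phi> f \<and>
        isogeny (torus_sum (Jac E') (Jac E)) (Jac \<Gamma>) \<Phi> \<and>
        (\<forall>x'\<in>carrier (torus_points (Jac E')). \<forall>x\<in>carrier (torus_points (Jac E)).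
           on_points (torus_sum (Jac E') (Jac E)) (Jac \<Gamma>) \<Phi> (point_pair (Jac E') (Jac E) x' x) =
           on_points (Jac E') (Jac \<Gamma>) f' x' \<otimes>\<^bsub>torus_points (Jac \<Gamma>)\<^esub> on_points (Jac E) (Jac \<Gamma>) f x) \<and>
        torsion_group (Jac E') d \<cong> kernel_group (torus_sum (Jac E') (Jac E)) (Jac \<Gamma>) \<Phi> \<and>
        kernel_group (torus_sum (Jac E') (Jac E)) (Jac \<Gamma>) \<Phi> \<cong> torsion_group (Jac E) d)"

end

theory Submission
  imports Defs
begin

text \<open>
  Only the isomorphism type of the kernel matters, so the subgroup may be replaced by the graph of
  multiplication by \<open>l / l'\<close> on the \<open>d\<close>-torsion. The quotient of the product of the two circles by it
  has the homology lattice \<open>{(x, y). d dvd x - y}\<close> with the form \<open>(l' x\<^sup>2 + l y\<^sup>2) / d\<close>. A reduced basis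
  of this lattice is the homology basis of a theta graph or of a bouquet of two circles, and the two
  coordinate functions are the maps induced by covers of the circles.

  An elliptic curve \<open>E\<close> is handled through a periodic map \<open>\<rho> : \<real> \<rightarrow> E\<close> of slope \<open>\<plusminus>1\<close>. A map to \<open>E\<close> is
  determined by a harmonic form \<open>s\<close> (its slopes) and the integers \<open>w\<close> counting how often the edges wind
  around \<open>E\<close>; its degree is \<open>\<Sum> s\<^sub>e w\<^sub>e\<close>, and on forms the pull-back is \<open>\<omega> \<mapsto> \<Sum> \<omega>\<^sub>e w\<^sub>e\<close>.
\<close>

section \<open>Points of real tori\<close>

text \<open>The definitions describe covers through directions, models and local degrees, and an
  elliptic curve may carry any model of its circle, so little can be computed on the target itself.
  In the uniformizing coordinate the model disappears: covers are piecewise affine, and slopes,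
  degree and pull-back become linear algebra on the source graph. The main obstacle is that the
  pull-back has to agree with the Abel-Jacobi map on every divisor of degree 0, also when fibre
  points run through vertices. This is settled by a chain that consists of the lifts of all nearby
  translates of a path, truncated to each edge; the truncated ends leave a correction at the
  vertices that does not depend on the path. Optimality rests on two integers attached to an
  intermediate circle: its dilation over E, which divides all slopes, and its winding number, which
  divides the value 1 taken by the pull-back on some cycle. The graph of multiplication by l / l' is
  a convenient subgroup because the single point (l' / d, l / d) generates it, so that it and both
  torsion groups are images of the integers with the multiples of d as kernel.\<close>

lemma image_iso_quotient:
  assumes "group G" "group H" and f: "f \<in> hom G H"
  shows "G Mod kernel G H f \<cong> H\<lparr>carrier := f ` carrier G\<rparr>"
proof -
  interpret f: group_hom G H f
    using assms by (simp add: group_hom_def group_hom_axioms_def)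
  \<comment> \<open>With the codomain cut down to the image the homomorphism is surjective and its
    kernel is unchanged, so the first isomorphism theorem applies.\<close>
  let ?H = "H\<lparr>carrier := f ` carrier G\<rparr>"
  have "group ?H"
    using f.G.subgroup_self f.H.subgroup_imp_group by (simp add: f.subgroup_img_is_subgroup)
  then interpret f': group_hom G ?H f
    using assms(1) f by (auto simp: group_hom_def group_hom_axioms_def hom_def)
  have "kernel G ?H f = kernel G H f"
    by (auto simp: kernel_def)
  then show ?thesis
    using f'.FactGroup_iso by simp
qed

text \<open>Both images are the quotient of \<open>G\<close> by the common kernel. It will be used
  with the integers as \<open>G\<close>: each d-torsion group and the kernel of the splitting are
  images of homomorphisms that kill exactly the multiples of d, so no isomorphism has to be written
  down.\<close>

lemma same_kernel_imp_iso:
  assumes "group G" "group H" "group K" and f: "f \<in> hom G H" and g: "g \<in> hom G K"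
    and ker: "\<And>x. x \<in> carrier G \<Longrightarrow> f x = \<one>\<^bsub>H\<^esub> \<longleftrightarrow> g x = \<one>\<^bsub>K\<^esub>"
  shows "H\<lparr>carrier := f ` carrier G\<rparr> \<cong> K\<lparr>carrier := g ` carrier G\<rparr>"
proof -
  have "kernel G H f = kernel G K g"
    using ker by (auto simp: kernel_def)
  then have K: "G Mod kernel G H f \<cong> K\<lparr>carrier := g ` carrier G\<rparr>"
    using image_iso_quotient[OF assms(1,3) g] by simp
  have "kernel G H f \<lhd> G"
    using assms(1,2) f by (intro group_hom.normal_kernel) (simp add: group_hom_def group_hom_axioms_def)
  then have "group (G Mod kernel G H f)"
    by (rule normal.factorgroup_is_group)
  then show ?thesis
    using group.iso_sym[OF _ image_iso_quotient[OF assms(1,2) f]] K iso_trans by blast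
qed

section \<open>Points as classes of real functions modulo the periods\<close>

definition additive_on :: "'a monoid \<Rightarrow> ('a \<Rightarrow> real) \<Rightarrow> bool" where
  "additive_on L h \<longleftrightarrow> (\<forall>x\<in>carrier L. \<forall>y\<in>carrier L. h (x \<otimes>\<^bsub>L\<^esub> y) = h x + h y)"

text \<open>The coset of \<open>h\<close>, for a function \<open>h\<close> that need be neither
  extensional nor additive. This keeps \<open>restrict\<close> out of the calculations;
  \<open>additive_on\<close> only decides whether the class is a point.\<close>

definition point_class :: "('a, 'b) torus \<Rightarrow> ('a \<Rightarrow> real) \<Rightarrow> ('a \<Rightarrow> real) set" where
  "point_class \<Sigma> h =
     {restrict (\<lambda>x. h x + pairing \<Sigma> x y) (carrier (lattice \<Sigma>)) | y. y \<in> carrier (colattice \<Sigma>)}"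

text \<open>Common ground for Jacobians and their sums, whose lattices have different types.\<close>

locale integral_torus =
  fixes \<Sigma> :: "('a, 'b) torus"
  assumes comm_group_lattice: "comm_group (lattice \<Sigma>)"
    and comm_group_colattice: "comm_group (colattice \<Sigma>)"
    and pairing_left: "\<And>x x' y. \<lbrakk>x \<in> carrier (lattice \<Sigma>); x' \<in> carrier (lattice \<Sigma>);
      y \<in> carrier (colattice \<Sigma>)\<rbrakk> \<Longrightarrow>
      pairing \<Sigma> (x \<otimes>\<^bsub>lattice \<Sigma>\<^esub> x') y = pairing \<Sigma> x y + pairing \<Sigma> x' y"
    and pairing_right: "\<And>x y y'. \<lbrakk>x \<in> carrier (lattice \<Sigma>); y \<in> carrier (colattice \<Sigma>);
      y' \<in> carrier (colattice \<Sigma>)\<rbrakk> \<Longrightarrow>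
      pairing \<Sigma> x (y \<otimes>\<^bsub>colattice \<Sigma>\<^esub> y') = pairing \<Sigma> x y + pairing \<Sigma> x y'"
begin

interpretation L: comm_group "lattice \<Sigma>" by (rule comm_group_lattice)
interpretation L': comm_group "colattice \<Sigma>" by (rule comm_group_colattice)

abbreviation "V \<equiv> hom_real (lattice \<Sigma>)"

lemma pairing_one: "x \<in> carrier (lattice \<Sigma>) \<Longrightarrow> pairing \<Sigma> x \<one>\<^bsub>colattice \<Sigma>\<^esub> = 0"
  using pairing_right[of x "\<one>\<^bsub>colattice \<Sigma>\<^esub>" "\<one>\<^bsub>colattice \<Sigma>\<^esub>"] by simp

lemma pairing_inv:
  assumes "x \<in> carrier (lattice \<Sigma>)" "y \<in> carrier (colattice \<Sigma>)"
  shows "pairing \<Sigma> x (inv\<^bsub>colattice \<Sigma>\<^esub> y) = - pairing \<Sigma> x y"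
  using pairing_right[of x y "inv\<^bsub>colattice \<Sigma>\<^esub> y"] pairing_one assms by simp

lemma carrier_V:
  "f \<in> carrier V \<longleftrightarrow> f \<in> extensional (carrier (lattice \<Sigma>)) \<and> additive_on (lattice \<Sigma>) f"
  by (simp add: hom_real_def additive_on_def)

lemma restrict_in_V: "additive_on (lattice \<Sigma>) h \<Longrightarrow> restrict h (carrier (lattice \<Sigma>)) \<in> carrier V"
  by (auto simp: carrier_V additive_on_def)

lemma comm_group_V: "comm_group V"
proof (rule comm_groupI)
  fix x assume x: "x \<in> carrier V"
  let ?y = "restrict (\<lambda>u. - x u) (carrier (lattice \<Sigma>))"
  have "?y \<in> carrier V" "?y \<otimes>\<^bsub>V\<^esub> x = \<one>\<^bsub>V\<^esub>"
    using x by (auto simp: hom_real_def fun_eq_iff)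
  then show "\<exists>y\<in>carrier V. y \<otimes>\<^bsub>V\<^esub> x = \<one>\<^bsub>V\<^esub>" by blast
qed (auto simp: hom_real_def fun_eq_iff extensional_def)

lemma periods_subgroup: "subgroup (periods \<Sigma>) V"
proof -
  interpret V: comm_group V by (rule comm_group_V)
  show ?thesis
  proof (rule V.subgroupI)
    show "periods \<Sigma> \<subseteq> carrier V"
      by (auto simp: periods_def carrier_V additive_on_def pairing_left)
    show "periods \<Sigma> \<noteq> {}"
      using L'.one_closed by (auto simp: periods_def)
  next
    fix a assume "a \<in> periods \<Sigma>"
    then obtain y where y: "y \<in> carrier (colattice \<Sigma>)"
      "a = restrict (\<lambda>x. pairing \<Sigma> x y) (carrier (lattice \<Sigma>))" by (auto simp: periods_def)
    let ?b = "restrict (\<lambda>x. pairing \<Sigma> x (inv\<^bsub>colattice \<Sigma>\<^esub> y)) (carrier (lattice \<Sigma>))"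
    have "?b \<in> periods \<Sigma>" using y by (auto simp: periods_def)
    moreover have "inv\<^bsub>V\<^esub> a = ?b"
    proof (rule V.inv_equality)
      show "?b \<otimes>\<^bsub>V\<^esub> a = \<one>\<^bsub>V\<^esub>"
        using y by (auto simp: hom_real_def fun_eq_iff pairing_inv)
      show "a \<in> carrier V" "?b \<in> carrier V"
        using y by (auto simp: carrier_V additive_on_def pairing_left)
    qed
    ultimately show "inv\<^bsub>V\<^esub> a \<in> periods \<Sigma>" by simp
  next
    fix a b assume "a \<in> periods \<Sigma>" "b \<in> periods \<Sigma>"
    then obtain y y' where y: "y \<in> carrier (colattice \<Sigma>)" "y' \<in> carrier (colattice \<Sigma>)"
      "a = restrict (\<lambda>x. pairing \<Sigma> x y) (carrier (lattice \<Sigma>))"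
      "b = restrict (\<lambda>x. pairing \<Sigma> x y') (carrier (lattice \<Sigma>))" by (auto simp: periods_def)
    then have "a \<otimes>\<^bsub>V\<^esub> b = restrict (\<lambda>x. pairing \<Sigma> x (y \<otimes>\<^bsub>colattice \<Sigma>\<^esub> y')) (carrier (lattice \<Sigma>))"
      by (auto simp: hom_real_def fun_eq_iff pairing_right)
    then show "a \<otimes>\<^bsub>V\<^esub> b \<in> periods \<Sigma>"
      using y by (auto simp: periods_def)
  qed
qed

lemma comm_group_points: "comm_group (torus_points \<Sigma>)"
proof -
  interpret V: comm_group V by (rule comm_group_V)
  show ?thesis
    unfolding torus_points_def by (rule V.abelian_FactGroup[OF periods_subgroup])
qed

lemma point_class_eq_coset:
  "point_class \<Sigma> h = periods \<Sigma> #>\<^bsub>V\<^esub> restrict h (carrier (lattice \<Sigma>))"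
  unfolding point_class_def periods_def r_coset_def
  by (auto simp: hom_real_def add.commute cong: restrict_cong)

lemma carrier_points:
  "carrier (torus_points \<Sigma>) = {point_class \<Sigma> h | h. additive_on (lattice \<Sigma>) h}"
proof -
  have "X \<in> rcosets\<^bsub>V\<^esub> periods \<Sigma> \<longleftrightarrow> (\<exists>h. X = point_class \<Sigma> h \<and> additive_on (lattice \<Sigma>) h)" for X
  proof
    assume "X \<in> rcosets\<^bsub>V\<^esub> periods \<Sigma>"
    then obtain h where h: "h \<in> carrier V" "X = periods \<Sigma> #>\<^bsub>V\<^esub> h" by (auto simp: RCOSETS_def)
    then have "restrict h (carrier (lattice \<Sigma>)) = h"
      by (simp add: carrier_V extensional_restrict)
    then show "\<exists>h. X = point_class \<Sigma> h \<and> additive_on (lattice \<Sigma>) h"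
      using h by (intro exI[of _ h]) (simp add: point_class_eq_coset carrier_V)
  next
    assume "\<exists>h. X = point_class \<Sigma> h \<and> additive_on (lattice \<Sigma>) h"
    then show "X \<in> rcosets\<^bsub>V\<^esub> periods \<Sigma>"
      by (auto simp: RCOSETS_def point_class_eq_coset dest: restrict_in_V)
  qed
  then show ?thesis
    by (auto simp: torus_points_def FactGroup_def)
qed

lemma point_class_mult:
  "point_class \<Sigma> g \<otimes>\<^bsub>torus_points \<Sigma>\<^esub> point_class \<Sigma> h = point_class \<Sigma> (\<lambda>x. g x + h x)"
proof -
  have "point_class \<Sigma> g <#>\<^bsub>V\<^esub> point_class \<Sigma> h = point_class \<Sigma> (\<lambda>x. g x + h x)"
  proof (intro Set.set_eqI iffI)
    fix u assume "u \<in> point_class \<Sigma> g <#>\<^bsub>V\<^esub> point_class \<Sigma> h"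
    then obtain y y' where y: "y \<in> carrier (colattice \<Sigma>)" "y' \<in> carrier (colattice \<Sigma>)"
      and u: "u = restrict (\<lambda>x. g x + pairing \<Sigma> x y) (carrier (lattice \<Sigma>)) \<otimes>\<^bsub>V\<^esub>
        restrict (\<lambda>x. h x + pairing \<Sigma> x y') (carrier (lattice \<Sigma>))"
      by (auto simp: set_mult_def point_class_def)
    have "u = restrict (\<lambda>x. g x + h x + pairing \<Sigma> x (y \<otimes>\<^bsub>colattice \<Sigma>\<^esub> y')) (carrier (lattice \<Sigma>))"
      using y by (auto simp: u hom_real_def fun_eq_iff pairing_right)
    then show "u \<in> point_class \<Sigma> (\<lambda>x. g x + h x)"
      using y by (auto simp: point_class_def)
  next
    fix u assume "u \<in> point_class \<Sigma> (\<lambda>x. g x + h x)"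
    then obtain y where y: "y \<in> carrier (colattice \<Sigma>)"
      and u: "u = restrict (\<lambda>x. g x + h x + pairing \<Sigma> x y) (carrier (lattice \<Sigma>))"
      by (auto simp: point_class_def)
    have "u = restrict (\<lambda>x. g x + pairing \<Sigma> x y) (carrier (lattice \<Sigma>)) \<otimes>\<^bsub>V\<^esub>
        restrict (\<lambda>x. h x + pairing \<Sigma> x \<one>\<^bsub>colattice \<Sigma>\<^esub>) (carrier (lattice \<Sigma>))"
      by (auto simp: u hom_real_def fun_eq_iff pairing_one)
    then show "u \<in> point_class \<Sigma> g <#>\<^bsub>V\<^esub> point_class \<Sigma> h"
      unfolding set_mult_def point_class_def using y L'.one_closed by blast
  qed
  then show ?thesis
    by (simp add: torus_points_def FactGroup_def)
qed

lemma point_class_one: "\<one>\<^bsub>torus_points \<Sigma>\<^esub> = point_class \<Sigma> (\<lambda>x. 0)"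
  by (auto simp: torus_points_def FactGroup_def point_class_def periods_def)

lemma point_class_pow:
  "point_class \<Sigma> h [^]\<^bsub>torus_points \<Sigma>\<^esub> (n::nat) = point_class \<Sigma> (\<lambda>x. real n * h x)"
proof (induction n)
  case (Suc n)
  have "point_class \<Sigma> h [^]\<^bsub>torus_points \<Sigma>\<^esub> Suc n = point_class \<Sigma> (\<lambda>x. real n * h x + h x)"
    using Suc by (simp add: point_class_mult)
  then show ?case by (simp add: algebra_simps)
qed (simp add: point_class_one)

text \<open>Turns every later question about kernels and torsion into an equation between real
  numbers.\<close>

lemma point_class_eq_one_iff:
  "point_class \<Sigma> h = \<one>\<^bsub>torus_points \<Sigma>\<^esub> \<longleftrightarrow>
     (\<exists>y\<in>carrier (colattice \<Sigma>). \<forall>x\<in>carrier (lattice \<Sigma>). h x = pairing \<Sigma> x y)"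
proof
  assume "point_class \<Sigma> h = \<one>\<^bsub>torus_points \<Sigma>\<^esub>"
  moreover have "restrict (\<lambda>x. h x + pairing \<Sigma> x \<one>\<^bsub>colattice \<Sigma>\<^esub>) (carrier (lattice \<Sigma>)) \<in>
    point_class \<Sigma> h"
    by (auto simp: point_class_def)
  ultimately obtain y where "y \<in> carrier (colattice \<Sigma>)"
    "restrict (\<lambda>x. h x + pairing \<Sigma> x \<one>\<^bsub>colattice \<Sigma>\<^esub>) (carrier (lattice \<Sigma>)) =
     restrict (\<lambda>x. pairing \<Sigma> x y) (carrier (lattice \<Sigma>))"
    by (auto simp: point_class_one point_class_def)
  then show "\<exists>y\<in>carrier (colattice \<Sigma>). \<forall>x\<in>carrier (lattice \<Sigma>). h x = pairing \<Sigma> x y"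
    by (metis (no_types, lifting) add.right_neutral pairing_one restrict_apply')
next
  assume "\<exists>y\<in>carrier (colattice \<Sigma>). \<forall>x\<in>carrier (lattice \<Sigma>). h x = pairing \<Sigma> x y"
  then obtain y where y: "y \<in> carrier (colattice \<Sigma>)"
    "\<And>x. x \<in> carrier (lattice \<Sigma>) \<Longrightarrow> h x = pairing \<Sigma> x y" by blast
  show "point_class \<Sigma> h = \<one>\<^bsub>torus_points \<Sigma>\<^esub>"
  proof (intro Set.set_eqI iffI)
    fix u assume "u \<in> point_class \<Sigma> h"
    then obtain z where z: "z \<in> carrier (colattice \<Sigma>)"
      "u = restrict (\<lambda>x. h x + pairing \<Sigma> x z) (carrier (lattice \<Sigma>))" by (auto simp: point_class_def)
    have "u = restrict (\<lambda>x. 0 + pairing \<Sigma> x (y \<otimes>\<^bsub>colattice \<Sigma>\<^esub> z)) (carrier (lattice \<Sigma>))"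
      using y z by (auto simp: pairing_right)
    then show "u \<in> \<one>\<^bsub>torus_points \<Sigma>\<^esub>"
      unfolding point_class_one point_class_def using y z by blast
  next
    fix u assume "u \<in> \<one>\<^bsub>torus_points \<Sigma>\<^esub>"
    then obtain z where z: "z \<in> carrier (colattice \<Sigma>)"
      "u = restrict (\<lambda>x. 0 + pairing \<Sigma> x z) (carrier (lattice \<Sigma>))"
      by (auto simp: point_class_one point_class_def)
    have "u = restrict (\<lambda>x. h x + pairing \<Sigma> x (inv\<^bsub>colattice \<Sigma>\<^esub> y \<otimes>\<^bsub>colattice \<Sigma>\<^esub> z)) (carrier
      (lattice \<Sigma>))"
      using y z by (auto simp: pairing_right pairing_inv)
    then show "u \<in> point_class \<Sigma> h"
      unfolding point_class_def using y z by blast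
  qed
qed

end

text \<open>By adjointness a period of \<open>\<Sigma>1\<close>, composed with the map of lattices,
  is the period of its image under the map of colattices. Hence multiplying by
  \<open>periods \<Sigma>2\<close> adds nothing but a full coset; for the converse inclusion the
  zero period of \<open>\<Sigma>1\<close> suffices.\<close>

lemma on_points_point_class:
  assumes "integral_torus \<Sigma>1" "integral_torus \<Sigma>2" and f: "torus_morphism \<Sigma>1 \<Sigma>2 f"
  shows "on_points \<Sigma>1 \<Sigma>2 f (point_class \<Sigma>1 h) = point_class \<Sigma>2 (h \<circ> fst f)"
proof -
  obtain fup fdown where ff: "f = (fup, fdown)" by force
  interpret S1: integral_torus \<Sigma>1 by fact
  interpret S2: integral_torus \<Sigma>2 by fact
  interpret L1: comm_group "colattice \<Sigma>1" by (rule S1.comm_group_colattice)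
  interpret L2: comm_group "colattice \<Sigma>2" by (rule S2.comm_group_colattice)
  have up: "\<And>x. x \<in> carrier (lattice \<Sigma>2) \<Longrightarrow> fup x \<in> carrier (lattice \<Sigma>1)"
    and down: "\<And>y. y \<in> carrier (colattice \<Sigma>1) \<Longrightarrow> fdown y \<in> carrier (colattice \<Sigma>2)"
    and adj: "\<And>x y. x \<in> carrier (lattice \<Sigma>2) \<Longrightarrow> y \<in> carrier (colattice \<Sigma>1) \<Longrightarrow>
        pairing \<Sigma>1 (fup x) y = pairing \<Sigma>2 x (fdown y)"
    using f by (auto simp: torus_morphism_def ff hom_def)
  show ?thesis
  proof (intro Set.set_eqI iffI)
    fix u assume "u \<in> on_points \<Sigma>1 \<Sigma>2 f (point_class \<Sigma>1 h)"
    then obtain y z where y: "y \<in> carrier (colattice \<Sigma>2)" and z: "z \<in> carrier (colattice \<Sigma>1)"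
      and u: "u = restrict (\<lambda>x. pairing \<Sigma>2 x y) (carrier (lattice \<Sigma>2)) \<otimes>\<^bsub>hom_real (lattice \<Sigma>2)\<^esub>
        restrict (restrict (\<lambda>x. h x + pairing \<Sigma>1 x z) (carrier (lattice \<Sigma>1)) \<circ> fup) (carrier
          (lattice \<Sigma>2))"
      by (auto simp: on_points_def set_mult_def periods_def point_class_def ff)
    have "u = restrict (\<lambda>x. (h \<circ> fup) x + pairing \<Sigma>2 x (y \<otimes>\<^bsub>colattice \<Sigma>2\<^esub> fdown z)) (carrier
      (lattice \<Sigma>2))"
      using y z by (auto simp: u hom_real_def fun_eq_iff S2.pairing_right up down adj)
    then show "u \<in> point_class \<Sigma>2 (h \<circ> fst f)"
      using y z down by (auto simp: point_class_def ff)
  next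
    fix u assume "u \<in> point_class \<Sigma>2 (h \<circ> fst f)"
    then obtain y where y: "y \<in> carrier (colattice \<Sigma>2)"
      and u: "u = restrict (\<lambda>x. h (fup x) + pairing \<Sigma>2 x y) (carrier (lattice \<Sigma>2))"
      by (auto simp: point_class_def ff)
    have "u = restrict (\<lambda>x. pairing \<Sigma>2 x y) (carrier (lattice \<Sigma>2)) \<otimes>\<^bsub>hom_real (lattice \<Sigma>2)\<^esub>
        restrict (restrict (\<lambda>x. h x + pairing \<Sigma>1 x \<one>\<^bsub>colattice \<Sigma>1\<^esub>) (carrier (lattice \<Sigma>1)) \<circ> fup)
          (carrier (lattice \<Sigma>2))"
      by (auto simp: u hom_real_def fun_eq_iff up S1.pairing_one)
    then show "u \<in> on_points \<Sigma>1 \<Sigma>2 f (point_class \<Sigma>1 h)"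
      unfolding on_points_def set_mult_def periods_def point_class_def ff
      using y L1.one_closed by force
  qed
qed

lemma integral_torus_sum:
  assumes "integral_torus \<Sigma>1" "integral_torus \<Sigma>2"
  shows "integral_torus (torus_sum \<Sigma>1 \<Sigma>2)"
proof -
  interpret S1: integral_torus \<Sigma>1 by fact
  interpret S2: integral_torus \<Sigma>2 by fact
  have DP: "comm_group (A \<times>\<times> B)" if "comm_group A" "comm_group B" for A :: "'u monoid" and B ::
    "'v monoid"
  proof -
    interpret A: comm_group A by fact
    interpret B: comm_group B by fact
    have "group (A \<times>\<times> B)" by (intro DirProd_group A.is_group B.is_group)
    then show ?thesis
      by (rule group.group_comm_groupI) (auto simp: A.m_comm B.m_comm)
  qed
  show ?thesis
    by (rule integral_torus.intro)
      (auto simp: torus_sum_def S1.pairing_left S1.pairing_right S2.pairing_left S2.pairing_right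
        intro!: DP S1.comm_group_lattice S1.comm_group_colattice S2.comm_group_lattice
          S2.comm_group_colattice)
qed

text \<open>The periods of the sum are exactly the pairs of periods, so the product of two cosets is
  again one coset.\<close>

lemma point_pair_point_class:
  "point_pair \<Sigma>1 \<Sigma>2 (point_class \<Sigma>1 h1) (point_class \<Sigma>2 h2) =
     point_class (torus_sum \<Sigma>1 \<Sigma>2) (\<lambda>(a, b). h1 a + h2 b)"
proof (intro Set.set_eqI iffI)
  fix u assume "u \<in> point_pair \<Sigma>1 \<Sigma>2 (point_class \<Sigma>1 h1) (point_class \<Sigma>2 h2)"
  then obtain y z where y: "y \<in> carrier (colattice \<Sigma>1)" and z: "z \<in> carrier (colattice \<Sigma>2)"
    and u: "u = restrict (\<lambda>(a, b). restrict (\<lambda>x. h1 x + pairing \<Sigma>1 x y) (carrier (lattice \<Sigma>1)) a +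
      restrict (\<lambda>x. h2 x + pairing \<Sigma>2 x z) (carrier (lattice \<Sigma>2)) b)
      (carrier (lattice \<Sigma>1) \<times> carrier (lattice \<Sigma>2))"
    by (auto simp: point_pair_def point_class_def)
  have "u = restrict (\<lambda>x. (\<lambda>(a, b). h1 a + h2 b) x + pairing (torus_sum \<Sigma>1 \<Sigma>2) x (y, z))
    (carrier (lattice (torus_sum \<Sigma>1 \<Sigma>2)))"
    by (auto simp: u torus_sum_def fun_eq_iff)
  then show "u \<in> point_class (torus_sum \<Sigma>1 \<Sigma>2) (\<lambda>(a, b). h1 a + h2 b)"
    unfolding point_class_def using y z by (force simp: torus_sum_def)
next
  fix u assume "u \<in> point_class (torus_sum \<Sigma>1 \<Sigma>2) (\<lambda>(a, b). h1 a + h2 b)"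
  then obtain y z where y: "y \<in> carrier (colattice \<Sigma>1)" and z: "z \<in> carrier (colattice \<Sigma>2)"
    and u: "u = restrict (\<lambda>x. (\<lambda>(a, b). h1 a + h2 b) x + pairing (torus_sum \<Sigma>1 \<Sigma>2) x (y, z))
    (carrier (lattice (torus_sum \<Sigma>1 \<Sigma>2)))"
    by (auto simp: point_class_def torus_sum_def)
  have "u = restrict (\<lambda>(a, b). restrict (\<lambda>x. h1 x + pairing \<Sigma>1 x y) (carrier (lattice \<Sigma>1)) a +
      restrict (\<lambda>x. h2 x + pairing \<Sigma>2 x z) (carrier (lattice \<Sigma>2)) b)
      (carrier (lattice \<Sigma>1) \<times> carrier (lattice \<Sigma>2))"
    by (auto simp: u torus_sum_def fun_eq_iff)
  then show "u \<in> point_pair \<Sigma>1 \<Sigma>2 (point_class \<Sigma>1 h1) (point_class \<Sigma>2 h2)"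
    unfolding point_pair_def point_class_def using y z by blast
qed

section \<open>Chains and the Abel-Jacobi map\<close>

text \<open>The linear extension of \<open>F\<close> to formal sums. With \<open>F = 1\<close> it is
  the degree of a divisor, with indicator functions it reads off multiplicities, with lengths it
  integrates.\<close>

definition frag_eval :: "('a \<Rightarrow> 'b::comm_ring_1) \<Rightarrow> ('a \<Rightarrow>\<^sub>0 int) \<Rightarrow> 'b" where
  "frag_eval F x = (\<Sum>i\<in>Poly_Mapping.keys x. of_int (Poly_Mapping.lookup x i) * F i)"

lemma frag_eval_superset:
  assumes "finite S" "Poly_Mapping.keys x \<subseteq> S"
  shows "frag_eval F x = (\<Sum>i\<in>S. of_int (Poly_Mapping.lookup x i) * F i)"
  unfolding frag_eval_def using assms by (intro sum.mono_neutral_left) (auto simp: in_keys_iff)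

lemma frag_eval_0 [simp]: "frag_eval F 0 = 0"
  by (simp add: frag_eval_def)

lemma frag_eval_of [simp]: "frag_eval F (frag_of a) = F a"
  by (simp add: frag_eval_def)

lemma frag_eval_diff: "frag_eval F (x - y) = frag_eval F x - frag_eval F y"
proof -
  let ?S = "Poly_Mapping.keys x \<union> Poly_Mapping.keys y"
  have "Poly_Mapping.keys (x - y) \<subseteq> ?S" by (rule keys_diff)
  then show ?thesis
    by (simp add: frag_eval_superset[of ?S] lookup_minus algebra_simps sum_subtractf)
qed

lemma frag_eval_add: "frag_eval F (x + y) = frag_eval F x + frag_eval F y"
  using frag_eval_diff[of F "x + y" y] by simp

lemma frag_eval_cmul: "frag_eval F (frag_cmul c x) = of_int c * frag_eval F x"
  by (subst frag_eval_superset[of "Poly_Mapping.keys x"])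
    (auto simp: keys_cmul frag_eval_def sum_distrib_left mult.assoc)

lemma frag_eval_sum: "frag_eval F (sum x I) = (\<Sum>i\<in>I. frag_eval F (x i))"
  by (induction I rule: infinite_finite_induct) (auto simp: frag_eval_add)

lemma frag_eval_cong:
  "(\<And>i. i \<in> Poly_Mapping.keys x \<Longrightarrow> F i = G i) \<Longrightarrow> frag_eval F x = frag_eval G x"
  unfolding frag_eval_def by (intro sum.cong) auto

lemma frag_eval_plus: "frag_eval (\<lambda>i. F i + G i) x = frag_eval F x + frag_eval G x"
  by (simp add: frag_eval_def algebra_simps sum.distrib)

lemma frag_eval_mult: "frag_eval (\<lambda>i. c * F i) x = c * frag_eval F x"
  by (simp add: frag_eval_def sum_distrib_left algebra_simps)

lemma frag_eval_setsum: "frag_eval (\<lambda>i. \<Sum>j\<in>J. F j i) x = (\<Sum>j\<in>J. frag_eval (F j) x)"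
  by (simp add: frag_eval_def sum_distrib_left sum.swap[of _ J])

lemma frag_eval_of_int: "frag_eval (\<lambda>i. of_int (F i)) x = of_int (frag_eval F x)"
  by (simp add: frag_eval_def)

lemma frag_eval_frag_extend: "frag_eval F (frag_extend g x) = frag_eval (\<lambda>i. frag_eval F (g i)) x"
proof (rule frag_induction[of x UNIV])
  fix a b
  assume "frag_eval F (frag_extend g a) = frag_eval (\<lambda>i. frag_eval F (g i)) a"
    "frag_eval F (frag_extend g b) = frag_eval (\<lambda>i. frag_eval F (g i)) b"
  then show "frag_eval F (frag_extend g (a - b)) = frag_eval (\<lambda>i. frag_eval F (g i)) (a - b)"
    by (simp add: frag_extend_diff frag_eval_diff)
qed auto

lemma chain_integral_eq: "chain_integral \<gamma> \<omega> = frag_eval (\<lambda>(e, a, b). of_int (\<omega> e) * (b - a)) \<gamma>"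
  by (simp add: chain_integral_def frag_eval_def split_beta mult.assoc)

section \<open>Closed chains and integral cycles on a tropical curve\<close>

locale curve =
  fixes \<Gamma> :: metric_graph
  assumes tropical: "tropical_curve \<Gamma>"
begin

abbreviation "EE \<equiv> arcs (graph \<Gamma>)"
abbreviation "src \<equiv> tail (graph \<Gamma>)"
abbreviation "tgt \<equiv> head (graph \<Gamma>)"
abbreviation "VV \<equiv> verts (graph \<Gamma>)"

lemma fin_digraph: "fin_digraph (graph \<Gamma>)"
  using tropical by (simp add: tropical_curve_def)

lemma finite_EE [simp]: "finite EE"
  using fin_digraph by (rule fin_digraph.finite_arcs)

lemma finite_VV [simp]: "finite VV"
  using fin_digraph by (rule fin_digraph.finite_verts)

lemma wf: "wf_digraph (graph \<Gamma>)"
  using fin_digraph by (simp add: fin_digraph_def)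

lemma src_VV [simp]: "e \<in> EE \<Longrightarrow> src e \<in> VV"
  using wf by (rule wf_digraph.tail_in_verts)

lemma tgt_VV [simp]: "e \<in> EE \<Longrightarrow> tgt e \<in> VV"
  using wf by (rule wf_digraph.head_in_verts)

lemma len_pos: "e \<in> EE \<Longrightarrow> 0 < len \<Gamma> e"
  using tropical by (simp add: tropical_curve_def)

lemma balancedD:
  assumes "c \<in> balanced \<Gamma>" "v \<in> VV"
  shows "(\<Sum>e | e \<in> EE \<and> tgt e = v. c e) = (\<Sum>e | e \<in> EE \<and> src e = v. c e)"
  using assms by (simp add: balanced_def)

lemma comm_group_balanced:
  "comm_group \<lparr>carrier = balanced \<Gamma>, mult = (\<lambda>b c e. b e + c e), one = (\<lambda>e. 0)\<rparr>" (is "comm_group ?G")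
proof (rule comm_groupI)
  fix x assume x: "x \<in> carrier ?G"
  have "(\<lambda>e. - x e) \<in> balanced \<Gamma>"
    using x by (simp add: balanced_def sum_negf)
  then show "\<exists>y\<in>carrier ?G. y \<otimes>\<^bsub>?G\<^esub> x = \<one>\<^bsub>?G\<^esub>"
    by (intro bexI[of _ "\<lambda>e. - x e"]) auto
next
  fix x y assume "x \<in> carrier ?G" "y \<in> carrier ?G"
  then show "x \<otimes>\<^bsub>?G\<^esub> y \<in> carrier ?G"
    by (simp add: balanced_def sum.distrib)
next
  show "\<one>\<^bsub>?G\<^esub> \<in> carrier ?G"
    by (simp add: balanced_def)
qed (simp_all add: ac_simps)

lemma integral_torus_Jac: "integral_torus (Jac \<Gamma>)"
proof (rule integral_torus.intro)
  show "comm_group (lattice (Jac \<Gamma>))" "comm_group (colattice (Jac \<Gamma>))"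
    using comm_group_balanced by (simp_all add: Jac_def harmonic_forms_def H1_def)
qed (simp_all add: Jac_def harmonic_forms_def H1_def distrib_left distrib_right sum.distrib)

lemma carrier_Jac [simp]:
  "carrier (lattice (Jac \<Gamma>)) = balanced \<Gamma>" "carrier (colattice (Jac \<Gamma>)) = balanced \<Gamma>"
  by (auto simp: Jac_def harmonic_forms_def H1_def)

lemma pt_eq_Vertex_iff:
  "e \<in> EE \<Longrightarrow> pt \<Gamma> e x = Vertex v \<longleftrightarrow> x = 0 \<and> src e = v \<or> x = len \<Gamma> e \<and> tgt e = v"
  using len_pos[of e] by (auto simp: pt_def)

lemma pt_in_points:
  "e \<in> EE \<Longrightarrow> 0 \<le> x \<Longrightarrow> x \<le> len \<Gamma> e \<Longrightarrow> pt \<Gamma> e x \<in> points \<Gamma>"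
  by (auto simp: pt_def points_def)

text \<open>Detects how often a chain arrives at the head of an edge; for a closed chain this is the
  multiplicity of the edge in the homology class.\<close>

definition arrivals :: "nat \<Rightarrow> chain \<Rightarrow> int" where
  "arrivals e = frag_eval (\<lambda>(e', a, b). if e' = e then of_bool (b = len \<Gamma> e) - of_bool (a = len \<Gamma>
    e) else 0)"

text \<open>A signed count of arrivals at coordinate 0: a segment that starts there counts -1, which
  explains the sign in \<open>closed_chain_departures\<close>.\<close>

definition departures :: "nat \<Rightarrow> chain \<Rightarrow> int" where
  "departures e = frag_eval (\<lambda>(e', a, b). if e' = e then of_bool (b = 0) - of_bool (a = 0) else 0)"

lemma frag_eval_chain_boundary:
  "frag_eval F (chain_boundary \<Gamma> \<gamma>) = frag_eval (\<lambda>(e, a, b). F (pt \<Gamma> e b) - F (pt \<Gamma> e a)) \<gamma>"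
  unfolding chain_boundary_def frag_eval_frag_extend
  by (intro frag_eval_cong) (auto simp: frag_eval_diff)

lemma segmentD:
  assumes "\<gamma> \<in> chains \<Gamma>" "(e, a, b) \<in> Poly_Mapping.keys \<gamma>"
  shows "e \<in> EE" "0 \<le> a" "a \<le> len \<Gamma> e" "0 \<le> b" "b \<le> len \<Gamma> e"
  using assms by (auto simp: chains_def)

text \<open>Pair the boundary with the coordinate function on the interior of \<open>e\<close>,
  extended by 0 to all vertices. It differs from the coordinate along \<open>e\<close> only at the
  head, by \<open>len \<Gamma> e\<close>, and this difference is what \<open>arrivals\<close>
  counts.\<close>

lemma closed_chain_edge_length:
  assumes "\<gamma> \<in> chains \<Gamma>" "chain_boundary \<Gamma> \<gamma> = 0" "e \<in> EE"
  shows "frag_eval (\<lambda>(e', a, b). if e' = e then b - a else 0) \<gamma> = len \<Gamma> e * of_int (arrivals e \<gamma>)"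
proof -
  let ?F = "\<lambda>P. case P of Inner e' x \<Rightarrow> if e' = e then x else 0 | Vertex _ \<Rightarrow> (0::real)"
  have "frag_eval (\<lambda>(e', a, b). if e' = e then b - a else 0) \<gamma> =
    frag_eval (\<lambda>i. (case i of (e', a, b) \<Rightarrow> ?F (pt \<Gamma> e' b) - ?F (pt \<Gamma> e' a)) + len \<Gamma> e *
      of_int (case i of (e', a, b) \<Rightarrow> if e' = e then of_bool (b = len \<Gamma> e) - of_bool (a = len \<Gamma> e)
        else 0)) \<gamma>"
  proof (rule frag_eval_cong)
    fix i assume i: "i \<in> Poly_Mapping.keys \<gamma>"
    obtain e' a b where ie: "i = (e', a, b)" by (cases i)
    have F: "?F (pt \<Gamma> e' x) = (if e' = e then x - len \<Gamma> e * of_bool (x = len \<Gamma> e) else 0)" for x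
      by (simp add: pt_def)
    show "(case i of (e', a, b) \<Rightarrow> if e' = e then b - a else 0) =
      (case i of (e', a, b) \<Rightarrow> ?F (pt \<Gamma> e' b) - ?F (pt \<Gamma> e' a)) + len \<Gamma> e *
      of_int (case i of (e', a, b) \<Rightarrow> if e' = e then of_bool (b = len \<Gamma> e) - of_bool (a = len \<Gamma> e)
        else 0)"
      unfolding ie prod.case F by (simp add: algebra_simps)
  qed
  also have "\<dots> = frag_eval ?F (chain_boundary \<Gamma> \<gamma>) + len \<Gamma> e * of_int (arrivals e \<gamma>)"
    by (simp add: frag_eval_plus frag_eval_mult frag_eval_of_int frag_eval_chain_boundary arrivals_def)
  finally show ?thesis using assms(2) by simp
qed

text \<open>Pair the boundary with the indicator of the interior of \<open>e\<close>. Every endpoint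
  on \<open>e\<close> is at coordinate 0, at the head or inside, so the three signed counts add up
  to zero on each segment.\<close>

lemma closed_chain_departures:
  assumes "\<gamma> \<in> chains \<Gamma>" "chain_boundary \<Gamma> \<gamma> = 0" "e \<in> EE"
  shows "departures e \<gamma> = - arrivals e \<gamma>"
proof -
  let ?F = "\<lambda>P. case P of Inner e' x \<Rightarrow> of_bool (e' = e) | Vertex _ \<Rightarrow> (0::int)"
  have "departures e \<gamma> + arrivals e \<gamma> + frag_eval ?F (chain_boundary \<Gamma> \<gamma>) = frag_eval (\<lambda>i. 0) \<gamma>"
    unfolding departures_def arrivals_def frag_eval_chain_boundary frag_eval_plus[symmetric]
  proof (rule frag_eval_cong)
    fix i assume i: "i \<in> Poly_Mapping.keys \<gamma>"
    obtain e' a b where ie: "i = (e', a, b)" by (cases i)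
    have F: "?F (pt \<Gamma> e' x) = (if e' = e then 1 - of_bool (x = 0) - of_bool (x = len \<Gamma> e) else 0)" for x
      using len_pos[OF assms(3)] by (simp add: pt_def)
    show "(case i of (e', a, b) \<Rightarrow> if e' = e then of_bool (b = 0) - of_bool (a = 0) else 0) +
      (case i of (e', a, b) \<Rightarrow> if e' = e then of_bool (b = len \<Gamma> e) - of_bool (a = len \<Gamma> e) else 0) +
      (case i of (e, a, b) \<Rightarrow> ?F (pt \<Gamma> e b) - ?F (pt \<Gamma> e a)) = 0"
      unfolding ie prod.case F by simp
  qed
  then show ?thesis using assms(2) by (simp add: frag_eval_def)
qed

text \<open>Pair the boundary with the indicator of the vertex \<open>v\<close>: it collects
  arrivals at the heads and at the tails that lie at \<open>v\<close>, and the latter are minus the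
  arrivals at the other ends.\<close>

lemma arrivals_balanced:
  assumes "\<gamma> \<in> chains \<Gamma>" "chain_boundary \<Gamma> \<gamma> = 0"
  shows "(\<lambda>e. if e \<in> EE then arrivals e \<gamma> else 0) \<in> balanced \<Gamma>"
proof -
  have "(\<Sum>e | e \<in> EE \<and> tgt e = v. arrivals e \<gamma>) = (\<Sum>e | e \<in> EE \<and> src e = v. arrivals e \<gamma>)"
    if v: "v \<in> VV" for v
  proof -
    have "(\<Sum>e | e \<in> EE \<and> tgt e = v. arrivals e \<gamma>) + (\<Sum>e | e \<in> EE \<and> src e = v. departures e \<gamma>) =
      frag_eval (\<lambda>P. of_bool (P = Vertex v)) (chain_boundary \<Gamma> \<gamma>)"
      unfolding arrivals_def departures_def frag_eval_chain_boundary
        frag_eval_setsum[symmetric] frag_eval_plus[symmetric]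
    proof (rule frag_eval_cong)
      fix i assume i: "i \<in> Poly_Mapping.keys \<gamma>"
      obtain e a b where ie: "i = (e, a, b)" by (cases i)
      have e: "e \<in> EE" using segmentD[OF assms(1)] i ie by blast
      have S: "(\<Sum>e' | e' \<in> EE \<and> P e'. if e = e' then F e' else 0) = (if P e then F e else 0)"
        for P and F :: "nat \<Rightarrow> int"
        using e by (subst sum.delta') auto
      show "(\<Sum>j | j \<in> EE \<and> tgt j = v. case i of (e', a, b) \<Rightarrow>
            if e' = j then of_bool (b = len \<Gamma> j) - of_bool (a = len \<Gamma> j) else 0) +
          (\<Sum>j | j \<in> EE \<and> src j = v. case i of (e', a, b) \<Rightarrow> if e' = j then of_bool (b = 0) -
            of_bool (a = 0) else 0) =
          (case i of (e, a, b) \<Rightarrow> of_bool (pt \<Gamma> e b = Vertex v) - (of_bool (pt \<Gamma> e a = Vertex v) ::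
            int))"
        using len_pos[OF e] e by (auto simp: ie S pt_eq_Vertex_iff[OF e])
    qed
    moreover have "(\<Sum>e | e \<in> EE \<and> src e = v. departures e \<gamma>) = - (\<Sum>e | e \<in> EE \<and> src e = v.
      arrivals e \<gamma>)"
      using closed_chain_departures[OF assms] by (simp add: sum_negf)
    ultimately show ?thesis using assms(2) by simp
  qed
  then show ?thesis
    by (auto simp: balanced_def intro!: sum.cong)
qed

text \<open>Sort the segments by edges. On each edge only the total displacement matters, a multiple
  of the length by \<open>closed_chain_edge_length\<close>.\<close>

lemma closed_chain_integral:
  assumes "\<gamma> \<in> chains \<Gamma>" "chain_boundary \<Gamma> \<gamma> = 0"
  shows "chain_integral \<gamma> \<omega> =
    pairing (Jac \<Gamma>) \<omega> (\<lambda>e. if e \<in> EE then arrivals e \<gamma> else 0)"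
proof -
  have "chain_integral \<gamma> \<omega> =
    frag_eval (\<lambda>i. \<Sum>e\<in>EE. of_int (\<omega> e) * (case i of (e', a, b) \<Rightarrow> if e' = e then b - a else 0)) \<gamma>"
    unfolding chain_integral_eq
  proof (rule frag_eval_cong)
    fix i assume i: "i \<in> Poly_Mapping.keys \<gamma>"
    obtain e a b where ie: "i = (e, a, b)" by (cases i)
    have e: "e \<in> EE" using segmentD[OF assms(1)] i ie by blast
    have "(\<Sum>j\<in>EE. of_int (\<omega> j) * (if e = j then b - a else 0)) =
      (\<Sum>j\<in>EE. if e = j then of_int (\<omega> j) * (b - a) else 0)"
      by (intro sum.cong) auto
    then show "(case i of (e, a, b) \<Rightarrow> of_int (\<omega> e) * (b - a)) =
      (\<Sum>j\<in>EE. of_int (\<omega> j) * (case i of (e', a, b) \<Rightarrow> if e' = j then b - a else 0))"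
      using e by (simp add: ie)
  qed
  also have "\<dots> = (\<Sum>e\<in>EE. of_int (\<omega> e) * (len \<Gamma> e * of_int (arrivals e \<gamma>)))"
    unfolding frag_eval_setsum frag_eval_mult
    using closed_chain_edge_length[OF assms] by simp
  finally show ?thesis
    by (simp add: Jac_def algebra_simps)
qed

lemma chain_integral_diff: "chain_integral (\<gamma> - \<gamma>') \<omega> = chain_integral \<gamma> \<omega> - chain_integral \<gamma>' \<omega>"
  by (simp add: chain_integral_eq frag_eval_diff)

lemma chain_boundary_diff:
  "chain_boundary \<Gamma> (\<gamma> - \<gamma>') = chain_boundary \<Gamma> \<gamma> - chain_boundary \<Gamma> \<gamma>'"
  by (simp add: chain_boundary_def frag_extend_diff)

lemma chains_diff: "\<gamma> \<in> chains \<Gamma> \<Longrightarrow> \<gamma>' \<in> chains \<Gamma> \<Longrightarrow> \<gamma> - \<gamma>' \<in> chains \<Gamma>"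
  using keys_diff[of \<gamma> \<gamma>'] unfolding chains_def by auto

lemma frag_cmul_diff_right: "frag_cmul c (a - b) = frag_cmul c a - frag_cmul c b"
  using frag_cmul_distrib2[of c "a - b" b] by (simp add: algebra_simps)

lemma pt_0 [simp]: "pt \<Gamma> e 0 = Vertex (src e)"
  by (simp add: pt_def)

lemma pt_len [simp]: "e \<in> EE \<Longrightarrow> pt \<Gamma> e (len \<Gamma> e) = Vertex (tgt e)"
  using len_pos[of e] by (simp add: pt_def)

lemma frag_cmul_sum_left: "frag_cmul (sum f I) x = (\<Sum>i\<in>I. frag_cmul (f i) x)"
  by (induction I rule: infinite_finite_induct) (auto simp: frag_cmul_distrib)

text \<open>A cycle run through edge by edge; it realizes the period of \<open>c\<close> as an
  integral.\<close>

definition cycle_chain :: "(nat \<Rightarrow> int) \<Rightarrow> chain" where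
  "cycle_chain c = (\<Sum>e\<in>EE. frag_cmul (c e) (frag_of (e, 0, len \<Gamma> e)))"

lemma cycle_chain_in_chains: "cycle_chain c \<in> chains \<Gamma>"
  unfolding cycle_chain_def chains_def
  by (rule sum_closed_free_Abelian_group) (use len_pos in \<open>auto simp: less_imp_le\<close>)

lemma cycle_chain_integral: "chain_integral (cycle_chain c) \<omega> = pairing (Jac \<Gamma>) \<omega> c"
  by (simp add: cycle_chain_def chain_integral_eq frag_eval_sum frag_eval_cmul Jac_def algebra_simps)

lemma cycle_chain_boundary:
  assumes "c \<in> balanced \<Gamma>"
  shows "chain_boundary \<Gamma> (cycle_chain c) = 0"
proof -
  have g: "(\<Sum>e\<in>EE. frag_cmul (c e) (frag_of (Vertex (k e)))) =
    (\<Sum>v\<in>VV. frag_cmul (\<Sum>e | e \<in> EE \<and> k e = v. c e) (frag_of (Vertex v)))"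
    if "\<And>e. e \<in> EE \<Longrightarrow> k e \<in> VV" for k
  proof -
    have "(\<Sum>e\<in>EE. frag_cmul (c e) (frag_of (Vertex (k e)))) =
      (\<Sum>v\<in>VV. \<Sum>e | e \<in> EE \<and> k e = v. frag_cmul (c e) (frag_of (Vertex (k e))))"
      using that by (intro sum.group[symmetric]) auto
    also have "\<dots> = (\<Sum>v\<in>VV. frag_cmul (\<Sum>e | e \<in> EE \<and> k e = v. c e) (frag_of (Vertex v)))"
      by (intro sum.cong refl) (simp add: frag_cmul_sum_left)
    finally show ?thesis .
  qed
  have "chain_boundary \<Gamma> (cycle_chain c) =
    (\<Sum>e\<in>EE. frag_cmul (c e) (frag_of (Vertex (tgt e)))) - (\<Sum>e\<in>EE. frag_cmul (c e) (frag_of (Vertex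
      (src e))))"
    unfolding chain_boundary_def cycle_chain_def
    by (simp add: frag_extend_sum frag_extend_cmul frag_cmul_diff_right sum_subtractf)
  then show ?thesis
    using balancedD[OF assms] by (simp add: g)
qed

text \<open>Two chains with the same boundary differ by a closed chain, whose integral is a period;
  conversely every period is reached by adding a \<open>cycle_chain\<close>. To compute the
  Abel-Jacobi image of a divisor it is therefore enough to exhibit one chain.\<close>

lemma abel_jacobi_boundary:
  assumes "\<gamma> \<in> chains \<Gamma>"
  shows "abel_jacobi \<Gamma> (chain_boundary \<Gamma> \<gamma>) = point_class (Jac \<Gamma>) (chain_integral \<gamma>)"
proof (intro Set.set_eqI iffI)
  fix u assume "u \<in> abel_jacobi \<Gamma> (chain_boundary \<Gamma> \<gamma>)"
  then obtain \<gamma>' where g: "\<gamma>' \<in> chains \<Gamma>" "chain_boundary \<Gamma> \<gamma>' = chain_boundary \<Gamma> \<gamma>"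
    "u = restrict (chain_integral \<gamma>') (balanced \<Gamma>)"
    by (auto simp: abel_jacobi_def harmonic_forms_def)
  let ?c = "\<lambda>e. if e \<in> EE then arrivals e (\<gamma>' - \<gamma>) else 0"
  have closed: "\<gamma>' - \<gamma> \<in> chains \<Gamma>" "chain_boundary \<Gamma> (\<gamma>' - \<gamma>) = 0"
    using g assms by (simp_all add: chains_diff chain_boundary_diff)
  have "chain_integral \<gamma>' \<omega> = chain_integral \<gamma> \<omega> + pairing (Jac \<Gamma>) \<omega> ?c" for \<omega>
    using closed_chain_integral[OF closed, of \<omega>] by (simp add: chain_integral_diff)
  then have "u = restrict (\<lambda>\<omega>. chain_integral \<gamma> \<omega> + pairing (Jac \<Gamma>) \<omega> ?c) (balanced \<Gamma>)"
    unfolding g(3) by (intro restrict_cong) auto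
  then show "u \<in> point_class (Jac \<Gamma>) (chain_integral \<gamma>)"
    using arrivals_balanced[OF closed] unfolding point_class_def carrier_Jac by blast
next
  fix u assume "u \<in> point_class (Jac \<Gamma>) (chain_integral \<gamma>)"
  then obtain c where c: "c \<in> balanced \<Gamma>"
    "u = restrict (\<lambda>\<omega>. chain_integral \<gamma> \<omega> + pairing (Jac \<Gamma>) \<omega> c) (balanced \<Gamma>)"
    by (auto simp: point_class_def)
  let ?g = "\<gamma> + cycle_chain c"
  have "?g \<in> chains \<Gamma>"
    using assms cycle_chain_in_chains[of c] keys_add[of \<gamma> "cycle_chain c"]
    unfolding chains_def by auto
  moreover have "chain_boundary \<Gamma> ?g = chain_boundary \<Gamma> \<gamma>"
    using cycle_chain_boundary[OF c(1)] by (simp add: chain_boundary_def frag_extend_add)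
  moreover have "u = restrict (chain_integral ?g) (balanced \<Gamma>)"
    unfolding c(2) by (simp add: chain_integral_eq frag_eval_add cycle_chain_integral[unfolded
      chain_integral_eq]
        cong: restrict_cong)
  ultimately show "u \<in> abel_jacobi \<Gamma> (chain_boundary \<Gamma> \<gamma>)"
    unfolding abel_jacobi_def harmonic_forms_def by auto
qed

end

section \<open>Uniformization of elliptic curves\<close>

context curve begin

text \<open>A loop at \<open>v\<close> occurs in both parts, once with each sign.\<close>

lemma directions_Vertex:
  "directions \<Gamma> (Vertex v) = (\<lambda>e. (e, 0, 1)) ` {e \<in> EE. src e = v} \<union>
     (\<lambda>e. (e, len \<Gamma> e, -1)) ` {e \<in> EE. tgt e = v}"
  by (auto simp: directions_def pt_eq_Vertex_iff image_iff dest: len_pos)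

lemma sum_directions_Vertex:
  "(\<Sum>d\<in>directions \<Gamma> (Vertex v). F d) =
     (\<Sum>e | e \<in> EE \<and> src e = v. F (e, 0, 1)) + (\<Sum>e | e \<in> EE \<and> tgt e = v. F (e, len \<Gamma> e, -1))"
  unfolding directions_Vertex
  by (subst sum.union_disjoint) (auto simp: sum.reindex inj_on_def)

lemma directions_Inner:
  assumes "e \<in> EE" "0 < x" "x < len \<Gamma> e"
  shows "directions \<Gamma> (Inner e x) = {(e, x, 1), (e, x, -1)}"
  using assms by (auto simp: directions_def pt_def split: if_splits)

lemma pt_inner: "0 < x \<Longrightarrow> x < len \<Gamma> e \<Longrightarrow> pt \<Gamma> e x = Inner e x"
  by (simp add: pt_def)

lemma points_cases:
  assumes "P \<in> points \<Gamma>"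
  obtains v where "v \<in> VV" "P = Vertex v"
  | e x where "e \<in> EE" "0 < x" "x < len \<Gamma> e" "P = Inner e x"
  using assms by (auto simp: points_def)

end

lemma additive_int:
  fixes f :: "int \<Rightarrow> 'a::ring_1"
  assumes add: "\<And>m n. f (m + n) = f m + f n"
  shows "f n = of_int n * f 1"
proof (induction n rule: int_induct[of _ 0])
  case base
  show ?case using add[of 0 0] by simp
next
  case (step1 i)
  then show ?case by (simp add: add algebra_simps)
next
  case (step2 i)
  then show ?case using add[of "i - 1" 1] by (simp add: algebra_simps)
qed

lemma keys_singleton: "Poly_Mapping.keys x \<subseteq> {i} \<Longrightarrow> x = frag_cmul (Poly_Mapping.lookup x i) (frag_of i)"
  by (intro poly_mapping_eqI) (auto simp: in_keys_iff lookup_single when_def)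

text \<open>\<open>\<rho>\<close> is the universal covering of the circle, with period
  \<open>l\<close>. On it \<open>a e\<close> is a lift of the tail of \<open>e\<close> and
  \<open>\<sigma> e\<close> tells whether \<open>e\<close> runs with or against the line. The value
  0 off the arcs makes \<open>\<sigma>\<close> a candidate for a balanced form.\<close>

locale uniformized = curve E for E +
  fixes l :: real and \<rho> :: "real \<Rightarrow> point" and a :: "nat \<Rightarrow> real" and \<sigma> :: "nat \<Rightarrow> int"
  assumes l_pos: "0 < l"
    and \<rho>_points [simp]: "\<rho> t \<in> points E"
    and \<rho>_surj: "P \<in> points E \<Longrightarrow> \<exists>t. P = \<rho> t"
    and \<rho>_eq: "\<rho> t = \<rho> t' \<longleftrightarrow> (\<exists>n::int. t - t' = of_int n * l)"
    and \<sigma>_arc: "e \<in> EE \<Longrightarrow> \<sigma> e = 1 \<or> \<sigma> e = -1"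
    and \<sigma>_no_arc: "e \<notin> EE \<Longrightarrow> \<sigma> e = 0"
    and pt_\<rho>: "e \<in> EE \<Longrightarrow> 0 \<le> x \<Longrightarrow> x \<le> len E e \<Longrightarrow> pt E e x = \<rho> (a e + of_int (\<sigma> e) * x)"
begin

lemma \<rho>_inj_near: "\<rho> t = \<rho> t' \<Longrightarrow> \<bar>t - t'\<bar> < l \<Longrightarrow> t = t'"
proof -
  assume "\<rho> t = \<rho> t'" and lt: "\<bar>t - t'\<bar> < l"
  then obtain n :: int where n: "t - t' = of_int n * l" by (auto simp: \<rho>_eq)
  then have "\<bar>of_int n\<bar> * l < 1 * l" using lt l_pos by (simp add: abs_mult)
  then have "\<bar>real_of_int n\<bar> < 1" using l_pos by (simp only: mult_less_cancel_right_pos)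
  then have "n = 0" by linarith
  then show "t = t'" using n by simp
qed

lemma \<rho>_add_period [simp]: "\<rho> (t + of_int n * l) = \<rho> t"
  by (auto simp: \<rho>_eq)

lemma \<rho>_shift: "\<rho> c = \<rho> c' \<Longrightarrow> \<rho> (c + z) = \<rho> (c' + z)"
  by (simp add: \<rho>_eq)

text \<open>\<open>\<rho>\<close> is injective on distances below \<open>l\<close>, so after
  removing a period the two affine lifts agree at a small positive
  \<open>\<epsilon>\<close>.\<close>

lemma slope_unique:
  assumes "0 < \<delta>" and eq: "\<And>\<epsilon>. 0 \<le> \<epsilon> \<Longrightarrow> \<epsilon> \<le> \<delta> \<Longrightarrow> \<rho> (c + k * \<epsilon>) = \<rho> (c' + k' * \<epsilon>)"
  shows "k = k'"
proof -
  obtain n :: int where n: "c - c' = of_int n * l" using eq[of 0] assms(1) by (auto simp: \<rho>_eq)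
  define K where "K = \<bar>k - k'\<bar>"
  have K: "0 \<le> K" by (simp add: K_def)
  \<comment> \<open>Chosen such that \<open>K * \<epsilon> < l\<close>; the summand 1 guards against
    \<open>K = 0\<close>.\<close>
  define \<epsilon> where "\<epsilon> = min \<delta> (l / (2 * (K + 1)))"
  have \<epsilon>: "0 < \<epsilon>" "\<epsilon> \<le> \<delta>" "\<epsilon> \<le> l / (2 * (K + 1))" using assms(1) K l_pos by (auto simp: \<epsilon>_def)
  have "\<epsilon> * (2 * (K + 1)) \<le> l" using \<epsilon>(3) K by (simp add: pos_le_divide_eq)
  moreover have "0 \<le> K * \<epsilon>" using K \<epsilon> by simp
  ultimately have small: "K * \<epsilon> < l" using \<epsilon>(1) by (simp add: algebra_simps)
  have "c + k * \<epsilon> = c' + k * \<epsilon> + of_int n * l" using n by simp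
  then have "\<rho> (c' + k * \<epsilon>) = \<rho> (c' + k' * \<epsilon>)" using eq[of \<epsilon>] \<epsilon> by (metis \<rho>_add_period less_imp_le)
  then have "c' + k * \<epsilon> = c' + k' * \<epsilon>"
  proof (rule \<rho>_inj_near)
    have "\<bar>c' + k * \<epsilon> - (c' + k' * \<epsilon>)\<bar> = K * \<epsilon>"
      using \<epsilon>(1) by (simp add: K_def abs_mult left_diff_distrib[symmetric])
    then show "\<bar>c' + k * \<epsilon> - (c' + k' * \<epsilon>)\<bar> < l" using small by simp
  qed
  then show ?thesis using \<epsilon>(1) by simp
qed

lemma \<sigma>_square: "e \<in> EE \<Longrightarrow> \<sigma> e * \<sigma> e = 1"
  using \<sigma>_arc by fastforce

lemma \<sigma>_square_real: "e \<in> EE \<Longrightarrow> real_of_int (\<sigma> e) * (real_of_int (\<sigma> e) * x) = x"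
  using \<sigma>_arc by fastforce

lemma abs_\<sigma> [simp]: "e \<in> EE \<Longrightarrow> \<bar>\<sigma> e\<bar> = 1"
  using \<sigma>_arc by fastforce

text \<open>The steps tend to 0 along any infinite set of indices, so the weak inequality survives
  in the limit.\<close>

lemma infinite_small_steps:
  fixes t \<tau> :: real
  assumes "infinite N" "\<And>n. n \<in> N \<Longrightarrow> (c::real) \<le> x + \<tau> * (l / real (n + 2))" "\<bar>\<tau>\<bar> = 1"
  shows "c \<le> x"
proof (rule ccontr)
  assume "\<not> c \<le> x"
  then have "0 < (c - x) / l" using l_pos by simp
  then obtain m where m: "1 / real (Suc m) < (c - x) / l"
    using nat_approx_posE by metis
  obtain n where n: "n \<in> N" "n > m"
    using assms(1) by (meson infinite_nat_iff_unbounded)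
  have "l / real (n + 2) \<le> l / real (Suc m)"
    using n l_pos by (intro divide_left_mono) auto
  also have "\<dots> = l * (1 / real (Suc m))" by simp
  also have "\<dots> < l * ((c - x) / l)" using m l_pos by (intro mult_strict_left_mono) auto
  also have "\<dots> = c - x" using l_pos by simp
  finally have "l / real (n + 2) < c - x" .
  moreover have "\<tau> * (l / real (n + 2)) \<le> l / real (n + 2)"
    using assms(3) l_pos by (cases "\<tau> = 1") (auto simp: abs_if split: if_splits)
  ultimately show False using assms(2)[OF n(1)] by linarith
qed

text \<open>Points approaching \<open>\<rho> t\<close> from one side lie infinitely often on the same edge, hence so does
  a whole one-sided neighbourhood.\<close>

lemma direction_exists:
  fixes \<tau> :: int
  assumes \<tau>: "\<tau> = 1 \<or> \<tau> = -1"
  obtains e x s where "(e, x, s) \<in> directions E (\<rho> t)" "of_int (\<sigma> e) * s = of_int \<tau>"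
proof -
  \<comment> \<open>The offset 2 keeps all steps strictly between 0 and \<open>l\<close>. Hence the
    points \<open>\<rho> (T n)\<close> are distinct, and only finitely many of them are
    vertices.\<close>
  define T where "T n = t + of_int \<tau> * (l / real (n + 2))" for n
  have inj: "inj (\<lambda>n. \<rho> (T n))"
  proof (rule injI)
    fix m n assume "\<rho> (T m) = \<rho> (T n)"
    have bd: "0 < l / real (k + 2) \<and> l / real (k + 2) < l" for k
    proof -
      have "l * 1 < l * real (k + 2)" using l_pos by (intro mult_strict_left_mono) auto
      then show ?thesis using l_pos by (simp add: pos_divide_less_eq)
    qed
    have "\<bar>T m - T n\<bar> < l"
    proof -
      have "\<bar>T m - T n\<bar> = \<bar>l / real (m + 2) - l / real (n + 2)\<bar>"
        using \<tau> by (auto simp: T_def abs_minus_commute)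
      then show ?thesis using bd[of m] bd[of n] by linarith
    qed
    then have "T m = T n" using \<rho>_inj_near \<open>\<rho> (T m) = \<rho> (T n)\<close> by blast
    then have "l / real (m + 2) = l / real (n + 2)" using \<tau> by (auto simp: T_def)
    then show "m = n" using l_pos by (simp add: frac_eq_eq)
  qed
  have "finite {n. \<rho> (T n) \<in> Vertex ` VV}"
    using finite_vimageI[OF _ inj, of "Vertex ` VV"] by (simp add: vimage_def)
  moreover have "{n. \<rho> (T n) \<in> Vertex ` VV} \<union> {n. \<rho> (T n) \<notin> Vertex ` VV} = UNIV" by auto
  ultimately have "infinite {n. \<rho> (T n) \<notin> Vertex ` VV}" (is "infinite ?N")
    using infinite_UNIV_nat by (metis finite_UnI)
  have "\<exists>e x. e \<in> EE \<and> 0 < x \<and> x < len E e \<and> \<rho> (T n) = Inner e x" if "n \<in> ?N" for n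
    using \<rho>_points[of "T n"] that by (auto simp: points_def)
  then obtain ed xd where ex: "\<And>n. n \<in> ?N \<Longrightarrow> ed n \<in> EE \<and> 0 < xd n \<and> xd n < len E (ed n) \<and> \<rho> (T n) =
    Inner (ed n) (xd n)"
    by metis
  \<comment> \<open>First pigeonhole: there are finitely many edges, so one of them carries
    infinitely many of the points.\<close>
  obtain n0 where n0: "infinite {n \<in> ?N. ed n = ed n0}" "n0 \<in> ?N"
    using pigeonhole_infinite[of ?N ed] \<open>infinite ?N\<close> ex
    by (metis (no_types, lifting) finite_EE finite_subset image_subsetI)
  define e where "e = ed n0"
  have e: "e \<in> EE" using ex n0 by (auto simp: e_def)
  let ?M = "{n \<in> ?N. ed n = e}"
  have "\<exists>k::int. T n - (a e + of_int (\<sigma> e) * xd n) = of_int k * l" if "n \<in> ?M" for n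
  proof -
    have "\<rho> (T n) = pt E e (xd n)" using ex[of n] that by (simp add: pt_inner)
    also have "\<dots> = \<rho> (a e + of_int (\<sigma> e) * xd n)" using ex[of n] that e by (intro pt_\<rho>) auto
    finally show ?thesis by (simp add: \<rho>_eq)
  qed
  then have "\<forall>n\<in>?M. \<exists>k::int. T n - (a e + of_int (\<sigma> e) * xd n) = of_int k * l" by blast
  from bchoice[OF this] obtain k :: "nat \<Rightarrow> int"
    where k: "\<And>n. n \<in> ?M \<Longrightarrow> T n - (a e + of_int (\<sigma> e) * xd n) = of_int (k n) * l"
    by blast
  have xd: "xd n = of_int (\<sigma> e) * (T n - a e - of_int (k n) * l)" if "n \<in> ?M" for n
    using k[OF that] \<sigma>_square_real[OF e, of "xd n"] by (simp add: algebra_simps)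
  \<comment> \<open>Second pigeonhole: the periods \<open>k n\<close> between the lift on the edge
    and \<open>T n\<close> are bounded, so one of them occurs infinitely often.\<close>
  let ?B = "\<bar>t\<bar> + l + \<bar>a e\<bar> + len E e"
  have "k ` ?M \<subseteq> {-\<lceil>?B / l\<rceil>..\<lceil>?B / l\<rceil>}"
  proof (rule image_subsetI)
    fix n assume n: "n \<in> ?M"
    have "l * 1 \<le> l * real (n + 2)" using l_pos by (intro mult_left_mono) auto
    then have "l / real (n + 2) \<le> l" using l_pos by (simp add: pos_divide_le_eq)
    moreover have "0 < l / real (n + 2)" using l_pos by simp
    ultimately have "\<bar>T n\<bar> \<le> \<bar>t\<bar> + l" using \<tau> unfolding T_def by auto
    moreover have "\<bar>of_int (\<sigma> e) * xd n\<bar> \<le> len E e"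
      using ex[of n] n \<sigma>_arc[OF e] by (auto simp: abs_mult)
    ultimately have "\<bar>of_int (k n) * l\<bar> \<le> ?B" using k[OF n] by linarith
    then have "\<bar>of_int (k n)\<bar> \<le> ?B / l" using l_pos by (simp add: abs_mult field_simps)
    then show "k n \<in> {-\<lceil>?B / l\<rceil>..\<lceil>?B / l\<rceil>}"
      unfolding atLeastAtMost_iff by linarith
  qed
  then have "finite (k ` ?M)" using finite_subset by blast
  moreover have "infinite ?M" using n0 by (simp add: e_def)
  ultimately obtain n1 where n1: "n1 \<in> ?M" "infinite {n \<in> ?M. k n = k n1}"
    using pigeonhole_infinite by blast
  let ?K = "{n \<in> ?M. k n = k n1}"
  \<comment> \<open>The limit of the coordinates \<open>xd n\<close> along the remaining indices,
    which is the coordinate of \<open>\<rho> t\<close> on the edge \<open>e\<close>.\<close>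
  define x where "x = of_int (\<sigma> e) * (t - a e - of_int (k n1) * l)"
  have xn: "xd n = x + of_int (\<sigma> e * \<tau>) * (l / real (n + 2))" if "n \<in> ?K" for n
    using xd[of n] that by (simp add: x_def T_def algebra_simps)
  have st: "\<bar>real_of_int (\<sigma> e * \<tau>)\<bar> = 1" using \<sigma>_arc[OF e] \<tau> by auto
  have "0 \<le> x"
  proof (rule infinite_small_steps[OF n1(2) _ st])
    fix n assume n: "n \<in> ?K"
    show "0 \<le> x + of_int (\<sigma> e * \<tau>) * (l / real (n + 2))"
      unfolding xn[OF n, symmetric] using ex[of n] n by (auto intro: less_imp_le)
  qed
  have "- len E e \<le> - x"
  proof (rule infinite_small_steps[OF n1(2)])
    show "\<bar>- real_of_int (\<sigma> e * \<tau>)\<bar> = 1" using st by simp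
    show "- len E e \<le> - x + - real_of_int (\<sigma> e * \<tau>) * (l / real (n + 2))" if "n \<in> ?K" for n
    proof -
      have "xd n \<le> len E e" using ex[of n] that by (auto intro: less_imp_le)
      then show ?thesis unfolding xn[OF that] by linarith
    qed
  qed
  have "n1 \<in> ?K" using n1 by simp
  from xn[OF this] ex[of n1] n1 have inner: "0 < x + of_int (\<sigma> e * \<tau>) * (l / real (n1 + 2))"
    "x + of_int (\<sigma> e * \<tau>) * (l / real (n1 + 2)) < len E e"
    by auto
  have "pt E e x = \<rho> (a e + of_int (\<sigma> e) * x)"
    using \<open>0 \<le> x\<close> \<open>- len E e \<le> - x\<close> e by (intro pt_\<rho>) auto
  also have "a e + of_int (\<sigma> e) * x = t + of_int (- k n1) * l"
    unfolding x_def \<sigma>_square_real[OF e] by simp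
  finally have "pt E e x = \<rho> t" unfolding \<rho>_add_period .
  moreover have "0 < l / real (n1 + 2)" using l_pos by simp
  ultimately have "(e, x, of_int (\<sigma> e * \<tau>)) \<in> directions E (\<rho> t)"
    using inner \<open>0 \<le> x\<close> \<open>- len E e \<le> - x\<close> e \<sigma>_arc[OF e] \<tau>
    by (auto simp: directions_def)
  moreover have "of_int (\<sigma> e) * of_int (\<sigma> e * \<tau>) = real_of_int \<tau>"
    unfolding of_int_mult \<sigma>_square_real[OF e] ..
  ultimately show ?thesis by (rule that)
qed

text \<open>The product of \<open>\<sigma> e\<close> and \<open>s\<close> is the direction of travel
  on the real line. It is the invariant by which directions of E are told apart from here
  on.\<close>

lemma direction_along:
  assumes "(e, x, s) \<in> directions E (\<rho> t)"
  obtains \<delta> where "\<delta> > 0" "\<And>\<epsilon>. 0 \<le> \<epsilon> \<Longrightarrow> \<epsilon> \<le> \<delta> \<Longrightarrow> 0 \<le> x + s * \<epsilon>" "\<And>\<epsilon>. 0 \<le> \<epsilon> \<Longrightarrow> \<epsilon> \<le> \<delta> \<Longrightarrow> x + s * \<epsilon> \<le> len E e"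
    "\<And>\<epsilon>. 0 < \<epsilon> \<Longrightarrow> \<epsilon> < \<delta> \<Longrightarrow> 0 < x + s * \<epsilon> \<and> x + s * \<epsilon> < len E e"
    "\<And>\<epsilon>. 0 \<le> \<epsilon> \<Longrightarrow> \<epsilon> \<le> \<delta> \<Longrightarrow> pt E e (x + s * \<epsilon>) = \<rho> (t + of_int (\<sigma> e) * s * \<epsilon>)"
proof -
  have d: "e \<in> EE" "0 \<le> x" "x \<le> len E e" "pt E e x = \<rho> t" "s = 1 \<and> x < len E e \<or> s = -1 \<and> 0 < x"
    using assms by (auto simp: directions_def)
  define \<delta> where "\<delta> = (if s = 1 then len E e - x else x)"
  have r: "0 \<le> x + s * \<epsilon> \<and> x + s * \<epsilon> \<le> len E e" if "0 \<le> \<epsilon>" "\<epsilon> \<le> \<delta>" for \<epsilon>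
    using d that by (auto simp: \<delta>_def split: if_splits)
  have r': "0 < x + s * \<epsilon> \<and> x + s * \<epsilon> < len E e" if "0 < \<epsilon>" "\<epsilon> < \<delta>" for \<epsilon>
    using d that by (auto simp: \<delta>_def split: if_splits)
  have "\<rho> t = \<rho> (a e + of_int (\<sigma> e) * x)" using pt_\<rho>[OF d(1-3)] d(4) by simp
  then obtain n :: int where n: "t - (a e + of_int (\<sigma> e) * x) = of_int n * l" by (auto simp: \<rho>_eq)
  have "pt E e (x + s * \<epsilon>) = \<rho> (t + of_int (\<sigma> e) * s * \<epsilon>)" if "0 \<le> \<epsilon>" "\<epsilon> \<le> \<delta>" for \<epsilon>
  proof -
    have "pt E e (x + s * \<epsilon>) = \<rho> (a e + of_int (\<sigma> e) * (x + s * \<epsilon>))"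
      using r[OF that] d by (intro pt_\<rho>) auto
    also have "a e + of_int (\<sigma> e) * (x + s * \<epsilon>) = t + of_int (\<sigma> e) * s * \<epsilon> + of_int (- n) * l"
      using n by (simp add: algebra_simps)
    finally show ?thesis unfolding \<rho>_add_period .
  qed
  moreover have "\<delta> > 0" using d by (auto simp: \<delta>_def)
  ultimately show ?thesis using r r' that by blast
qed

text \<open>Two directions with the same travel on the line run through the same points near
  \<open>\<rho> t\<close>, and an inner point determines its edge and its coordinate.\<close>

lemma direction_unique:
  assumes "(e, x, s) \<in> directions E (\<rho> t)" "(e', x', s') \<in> directions E (\<rho> t)"
    "of_int (\<sigma> e) * s = of_int (\<sigma> e') * s'"
  shows "(e, x, s) = (e', x', s')"
proof -
  obtain \<delta> where d: "\<delta> > 0" "\<And>\<epsilon>. 0 < \<epsilon> \<Longrightarrow> \<epsilon> < \<delta> \<Longrightarrow> 0 < x + s * \<epsilon> \<and> x + s * \<epsilon> < len E e"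
    "\<And>\<epsilon>. 0 \<le> \<epsilon> \<Longrightarrow> \<epsilon> \<le> \<delta> \<Longrightarrow> pt E e (x + s * \<epsilon>) = \<rho> (t + of_int (\<sigma> e) * s * \<epsilon>)"
    using direction_along[OF assms(1)] by metis
  obtain \<delta>' where d': "\<delta>' > 0" "\<And>\<epsilon>. 0 < \<epsilon> \<Longrightarrow> \<epsilon> < \<delta>' \<Longrightarrow> 0 < x' + s' * \<epsilon> \<and> x' + s' * \<epsilon> < len E e'"
    "\<And>\<epsilon>. 0 \<le> \<epsilon> \<Longrightarrow> \<epsilon> \<le> \<delta>' \<Longrightarrow> pt E e' (x' + s' * \<epsilon>) = \<rho> (t + of_int (\<sigma> e') * s' * \<epsilon>)"
    using direction_along[OF assms(2)] by metis
  define \<epsilon> where "\<epsilon> = min \<delta> \<delta>' / 2"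
  have eps: "0 < \<epsilon>" "\<epsilon> < \<delta>" "\<epsilon> < \<delta>'" using d(1) d'(1) by (auto simp: \<epsilon>_def)
  have "Inner e (x + s * \<epsilon>) = Inner e' (x' + s' * \<epsilon>)"
    using d(2)[of \<epsilon>] d(3)[of \<epsilon>] d'(2)[of \<epsilon>] d'(3)[of \<epsilon>] eps assms(3) by (auto simp: pt_inner)
  then have e: "e = e'" "x + s * \<epsilon> = x' + s' * \<epsilon>" by auto
  moreover have "s = s'"
  proof -
    have "e \<in> EE" using assms(1) by (auto simp: directions_def)
    then show ?thesis using assms(3) e(1) \<sigma>_arc by fastforce
  qed
  ultimately show ?thesis by auto
qed

text \<open>Existence comes from the two one-sided approaches to \<open>t\<close>, uniqueness from
  \<open>direction_unique\<close>. So at every point, a vertex or not, E looks like a line, and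
  harmonicity becomes a comparison of two numbers.\<close>

lemma directions_pair:
  obtains d d' where "directions E (\<rho> t) = {d, d'}" "d \<noteq> d'"
    "(\<lambda>(e, x, s). of_int (\<sigma> e) * s) d = (1::real)" "(\<lambda>(e, x, s). of_int (\<sigma> e) * s) d' = (-1::real)"
proof -
  obtain e x s where d: "(e, x, s) \<in> directions E (\<rho> t)" "of_int (\<sigma> e) * s = 1"
    using direction_exists[of 1 t] by auto
  obtain e' x' s' where d': "(e', x', s') \<in> directions E (\<rho> t)" "of_int (\<sigma> e') * s' = -1"
    using direction_exists[of "-1" t] by auto
  have "\<delta> = (e, x, s) \<or> \<delta> = (e', x', s')" if "\<delta> \<in> directions E (\<rho> t)" for \<delta>
  proof -
    obtain e2 x2 s2 where \<delta>: "\<delta> = (e2, x2, s2)" by (cases \<delta>)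
    have "of_int (\<sigma> e2) * s2 = 1 \<or> of_int (\<sigma> e2) * s2 = -1"
      using that \<sigma>_arc[of e2] unfolding \<delta> by (auto simp: directions_def)
    then show ?thesis
      using direction_unique[of e2 x2 s2 t e x s] direction_unique[of e2 x2 s2 t e' x' s'] that d d' \<delta>
      by auto
  qed
  then have "directions E (\<rho> t) = {(e, x, s), (e', x', s')}" using d d' by auto
  moreover have "(e, x, s) \<noteq> (e', x', s')" using d d' by auto
  ultimately show ?thesis using that d d' by auto
qed

lemma directions_nonempty: "P \<in> points E \<Longrightarrow> directions E P \<noteq> {}"
proof -
  assume "P \<in> points E"
  then obtain t where "P = \<rho> t" using \<rho>_surj by blast
  then show ?thesis using direction_exists[of 1 t] by auto
qed

lemma EE_nonempty: "EE \<noteq> {}"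
  using direction_exists[of 1 0] by (auto simp: directions_def)

text \<open>The travel signs of the two directions at a vertex cancel, which is the balancing
  condition there.\<close>

lemma \<sigma>_balanced: "\<sigma> \<in> balanced E"
proof -
  have "(\<Sum>e | e \<in> EE \<and> tgt e = v. \<sigma> e) = (\<Sum>e | e \<in> EE \<and> src e = v. \<sigma> e)" if "v \<in> VV" for v
  proof -
    obtain t where t: "Vertex v = \<rho> t" using \<rho>_surj[of "Vertex v"] \<open>v \<in> VV\<close> by (auto simp: points_def)
    obtain d d' where "directions E (\<rho> t) = {d, d'}" "d \<noteq> d'"
      "(\<lambda>(e, x, s). of_int (\<sigma> e) * s) d = (1::real)" "(\<lambda>(e, x, s). of_int (\<sigma> e) * s) d' = (-1::real)"
      by (rule directions_pair)
    then have "(\<Sum>d\<in>directions E (Vertex v). (\<lambda>(e, x, s). of_int (\<sigma> e) * s) d) = (0::real)"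
      unfolding t by simp
    then have "real_of_int (\<Sum>e | e \<in> EE \<and> src e = v. \<sigma> e) = of_int (\<Sum>e | e \<in> EE \<and> tgt e = v. \<sigma> e)"
      unfolding sum_directions_Vertex by (simp add: sum_negf)
    then show ?thesis by (simp only: of_int_eq_iff)
  qed
  then show ?thesis by (auto simp: balanced_def \<sigma>_no_arc)
qed

text \<open>Genus 1 provides some generator \<open>g\<close>. As \<open>\<sigma>\<close> is a
  multiple of \<open>g\<close> with values 1 and -1, the factor is a unit and
  \<open>\<sigma>\<close> generates as well.\<close>

lemma balanced_multiple:
  assumes "has_genus E 1" "c \<in> balanced E"
  obtains n where "c = (\<lambda>e. n * \<sigma> e)"
proof -
  have "free_Abelian_group {..<1::nat} \<cong> H1 E"
    using assms(1) group.iso_sym[of "H1 E"] comm_group_balanced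
    by (simp add: has_genus_def H1_def comm_group_def)
  then obtain h where h: "h \<in> iso (free_Abelian_group {..<1::nat}) (H1 E)"
    by (auto simp: is_iso_def)
  interpret h: group_hom "free_Abelian_group {..<1::nat}" "H1 E" h
    using h comm_group_balanced
    by (auto simp: group_hom_def group_hom_axioms_def iso_def H1_def comm_group_def)
  define u :: "nat \<Rightarrow>\<^sub>0 int" where "u = frag_of 0"
  define g where "g = h u"
  have ku: "Poly_Mapping.keys (frag_cmul n u) \<subseteq> {..<1}" for n
    using keys_cmul[of n u] keys_frag_of[of "0::nat"] by (auto simp: u_def)
  have cmul: "h (frag_cmul n u) = (\<lambda>e. n * g e)" for n
  proof
    fix e
    let ?f = "\<lambda>n. h (frag_cmul n u) e"
    have "?f (m + n) = ?f m + ?f n" for m n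
      using h.hom_mult[of "frag_cmul m u" "frag_cmul n u"] ku[of m] ku[of n]
      by (simp add: H1_def frag_cmul_distrib)
    from additive_int[of ?f, OF this] show "?f n = n * g e" by (simp add: g_def)
  qed
  have gen: "\<exists>n. c = (\<lambda>e. n * g e)" if "c \<in> balanced E" for c
  proof -
    have "c \<in> h ` carrier (free_Abelian_group {..<1::nat})"
      using h that by (auto simp: iso_def bij_betw_def H1_def)
    then obtain x where x: "c = h x" "Poly_Mapping.keys x \<subseteq> {..<1::nat}" by auto
    have "x = frag_cmul (Poly_Mapping.lookup x 0) u"
      unfolding u_def using x(2) by (intro keys_singleton) auto
    then have "h x = (\<lambda>e. Poly_Mapping.lookup x 0 * g e)" using cmul by metis
    then show ?thesis using x by auto
  qed
  obtain m where m: "\<sigma> = (\<lambda>e. m * g e)" using gen[OF \<sigma>_balanced] by blast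
  obtain e0 where e0: "e0 \<in> EE" using EE_nonempty by blast
  have "m * g e0 = 1 \<or> m * g e0 = -1" using \<sigma>_arc[OF e0] m by metis
  then have "m dvd 1"
    by (metis dvd_minus_iff dvd_triv_left)
  then have mm: "m * m = 1" by (auto simp: zdvd1_eq abs_if split: if_splits)
  obtain n where "c = (\<lambda>e. n * g e)" using gen[OF assms(2)] by blast
  then have "c = (\<lambda>e. (n * m) * \<sigma> e)" using mm by (simp add: m mult.assoc[symmetric]) (simp add:
    mult.assoc)
  then show ?thesis by (rule that)
qed

text \<open>Continuity of \<open>\<rho>\<close>: on either side of \<open>t\<close> the line follows
  one edge, where openness in the quotient topology is an ordinary condition on an interval.\<close>

lemma open_\<rho>_vimage:
  assumes U: "openin (realization E) U"
  shows "open {t. \<rho> t \<in> U}"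
proof -
  have half: "\<exists>\<delta>>0. \<forall>\<epsilon>. 0 \<le> \<epsilon> \<and> \<epsilon> < \<delta> \<longrightarrow> \<rho> (t + of_int \<tau> * \<epsilon>) \<in> U" if t: "\<rho> t \<in> U" and \<tau>: "\<tau> = 1 \<or>
    \<tau> = -1"
    for t and \<tau> :: int
  proof -
    obtain e x s where d: "(e, x, s) \<in> directions E (\<rho> t)" and o: "of_int (\<sigma> e) * s = of_int \<tau>"
      using direction_exists[OF \<tau>] by blast
    obtain \<delta> where \<delta>: "\<delta> > 0" "\<And>\<epsilon>. 0 \<le> \<epsilon> \<Longrightarrow> \<epsilon> \<le> \<delta> \<Longrightarrow> 0 \<le> x + s * \<epsilon>" "\<And>\<epsilon>. 0 \<le> \<epsilon> \<Longrightarrow> \<epsilon> \<le> \<delta> \<Longrightarrow> x + s * \<epsilon> \<le>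
      len E e"
      "\<And>\<epsilon>. 0 \<le> \<epsilon> \<Longrightarrow> \<epsilon> \<le> \<delta> \<Longrightarrow> pt E e (x + s * \<epsilon>) = \<rho> (t + of_int (\<sigma> e) * s * \<epsilon>)"
      using direction_along[OF d] by metis
    have e: "e \<in> EE" "\<bar>s\<bar> = 1" using d by (auto simp: directions_def)
    have "openin (top_of_set {0..len E e}) {x \<in> {0..len E e}. pt E e x \<in> U}"
      using U e by (auto simp: openin_realization)
    moreover have "x \<in> {x \<in> {0..len E e}. pt E e x \<in> U}"
      using d t by (auto simp: directions_def)
    ultimately obtain r where r: "r > 0" "\<And>y. y \<in> {0..len E e} \<Longrightarrow> dist y x < r \<Longrightarrow> pt E e y \<in> U"
      unfolding openin_euclidean_subtopology_iff by blast
    have "\<rho> (t + of_int \<tau> * \<epsilon>) \<in> U" if "0 \<le> \<epsilon>" "\<epsilon> < min \<delta> r" for \<epsilon>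
    proof -
      have "dist (x + s * \<epsilon>) x < r" using that e by (simp add: dist_real_def abs_mult)
      then have "pt E e (x + s * \<epsilon>) \<in> U"
        using \<delta>(2)[of \<epsilon>] \<delta>(3)[of \<epsilon>] that by (intro r(2)) auto
      then show ?thesis using \<delta>(4)[of \<epsilon>] that o by simp
    qed
    then show ?thesis using \<delta>(1) r(1) by (intro exI[of _ "min \<delta> r"]) auto
  qed
  show ?thesis
    unfolding open_dist
  proof (intro ballI)
    fix t assume "t \<in> {t. \<rho> t \<in> U}"
    then obtain \<delta> \<delta>' where d: "\<delta> > 0" "\<And>\<epsilon>. 0 \<le> \<epsilon> \<Longrightarrow> \<epsilon> < \<delta> \<Longrightarrow> \<rho> (t + of_int 1 * \<epsilon>) \<in> U"
      "\<delta>' > 0" "\<And>\<epsilon>. 0 \<le> \<epsilon> \<Longrightarrow> \<epsilon> < \<delta>' \<Longrightarrow> \<rho> (t + of_int (-1) * \<epsilon>) \<in> U"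
      using half[of t 1] half[of t "-1"] by blast
    have "\<rho> y \<in> U" if "dist y t < min \<delta> \<delta>'" for y
      using d(2)[of "y - t"] d(4)[of "t - y"] that by (cases "y \<ge> t") (auto simp: dist_real_def)
    then show "\<exists>e>0. \<forall>y. dist y t < e \<longrightarrow> y \<in> {t. \<rho> t \<in> U}"
      using d by (intro exI[of _ "min \<delta> \<delta>'"]) auto
  qed
qed

end

section \<open>Maps to a circle given by a harmonic form\<close>

context curve begin

lemma sum_by_vertex:
  assumes "\<And>e. e \<in> EE \<Longrightarrow> k e \<in> VV"
  shows "(\<Sum>e\<in>EE. F e (k e)) = (\<Sum>v\<in>VV. \<Sum>e | e \<in> EE \<and> k e = v. F e v)"
proof -
  have "(\<Sum>v\<in>VV. \<Sum>e | e \<in> EE \<and> k e = v. F e (k e)) = (\<Sum>e\<in>EE. F e (k e))"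
    using assms by (intro sum.group) auto
  then show ?thesis by (auto intro!: sum.cong elim!: sym[THEN trans, rotated])
qed

text \<open>Summation by parts: collected at a vertex \<open>v\<close>, the coefficients of
  \<open>D v\<close> are the inflow minus the outflow. This is what eliminates every choice of lifts
  of vertices from the final formulas.\<close>

lemma balanced_sum_coboundary:
  fixes D :: "nat \<Rightarrow> real"
  assumes "\<omega> \<in> balanced \<Gamma>"
  shows "(\<Sum>e\<in>EE. of_int (\<omega> e) * (D (tgt e) - D (src e))) = 0"
proof -
  have "(\<Sum>e\<in>EE. of_int (\<omega> e) * D (k e)) = (\<Sum>v\<in>VV. of_int (\<Sum>e | e \<in> EE \<and> k e = v. \<omega> e) * D v)"
    if "\<And>e. e \<in> EE \<Longrightarrow> k e \<in> VV" for k
    using sum_by_vertex[of k "\<lambda>e v. of_int (\<omega> e) * D v", OF that] by (simp add: sum_distrib_right)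
  from this[of src] this[of tgt] show ?thesis
    using balancedD[OF assms] by (simp add: right_diff_distrib sum_subtractf)
qed

end

context uniformized
begin

text \<open>A natural slope exists exactly if \<open>o' * \<kappa>\<close> is nonnegative;
  \<open>nat\<close> reproduces the default 0 of \<open>dir_slope\<close> for a direction that is
  sent the opposite way.\<close>

lemma dir_slope_affine:
  fixes \<kappa> o' :: int
  assumes \<delta>: "0 < \<delta>1" and al: "\<And>\<epsilon>. 0 \<le> \<epsilon> \<Longrightarrow> \<epsilon> \<le> \<delta>1 \<Longrightarrow> f (along \<Gamma> v \<epsilon>) = \<rho> (y + of_int \<kappa> * \<epsilon>)"
    and w: "(e', x', \<tau>') \<in> directions E (\<rho> y)" and o': "of_int (\<sigma> e') * \<tau>' = of_int o'"
  shows "dir_slope \<Gamma> E f v (e', x', \<tau>') = nat (o' * \<kappa>)"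
proof -
  obtain \<delta>2 where \<delta>2: "\<delta>2 > 0" "\<And>\<epsilon>. 0 \<le> \<epsilon> \<Longrightarrow> \<epsilon> \<le> \<delta>2 \<Longrightarrow> pt E e' (x' + \<tau>' * \<epsilon>) = \<rho> (y + of_int o' * \<epsilon>)"
    using direction_along[OF w] o' by metis
  have o1: "o' * o' = 1"
  proof -
    have "e' \<in> EE" "\<tau>' = 1 \<or> \<tau>' = -1" using w by (auto simp: directions_def)
    then have "o' = 1 \<or> o' = -1" using o' \<sigma>_arc[of e'] by auto
    then show ?thesis by auto
  qed
  have iff: "(\<forall>\<^sub>F \<epsilon> in at_right 0. f (along \<Gamma> v \<epsilon>) = along E (e', x', \<tau>') (real m * \<epsilon>)) \<longleftrightarrow>
      int m = o' * \<kappa>" (is "?ev \<longleftrightarrow> _") for m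
  proof
    assume ?ev
    then obtain b where b: "b > 0" "\<And>\<epsilon>. 0 < \<epsilon> \<Longrightarrow> \<epsilon> < b \<Longrightarrow>
      f (along \<Gamma> v \<epsilon>) = along E (e', x', \<tau>') (real m * \<epsilon>)"
      by (auto simp: eventually_at_right_field)
    \<comment> \<open>Small enough that also \<open>real m * \<epsilon>\<close> stays within
      \<open>\<delta>2\<close>; the summand 1 allows \<open>m = 0\<close>.\<close>
    define B where "B = min (b / 2) (min \<delta>1 (\<delta>2 / (real m + 1)))"
    have "0 < \<delta>2 / (real m + 1)" using \<delta>2(1) by simp
    then have B: "0 < B" "B < b" "B \<le> \<delta>1" "B \<le> \<delta>2 / (real m + 1)"
      using b(1) \<delta> unfolding B_def by linarith+
    have "\<rho> (y + of_int \<kappa> * \<epsilon>) = \<rho> (y + of_int (o' * int m) * \<epsilon>)" if "0 \<le> \<epsilon>" "\<epsilon> \<le> B" for \<epsilon>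
    proof (cases "\<epsilon> = 0")
      case False
      have "\<epsilon> \<le> \<delta>2 / (real m + 1)" using that B(4) by linarith
      then have "\<epsilon> * (real m + 1) \<le> \<delta>2" by (simp add: pos_le_divide_eq)
      then have e3: "real m * \<epsilon> \<le> \<delta>2" using that by (simp add: algebra_simps)
      show ?thesis
        using b(2)[of \<epsilon>] al[of \<epsilon>] \<delta>2(2)[OF _ e3] that B False by (simp add: mult.assoc)
    qed simp
    then have "real_of_int \<kappa> = of_int (o' * int m)" by (rule slope_unique[OF B(1)])
    then have "\<kappa> = o' * int m" by (simp only: of_int_eq_iff)
    then have "o' * \<kappa> = (o' * o') * int m" by simp
    then show "int m = o' * \<kappa>" using o1 by simp
  next
    assume m: "int m = o' * \<kappa>"
    then have "o' * int m = (o' * o') * \<kappa>" by simp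
    then have om: "o' * int m = \<kappa>" using o1 by simp
    show ?ev
      unfolding eventually_at_right_field
    proof (intro exI[of _ "min \<delta>1 (\<delta>2 / (real m + 1))"] conjI allI impI)
      show "0 < min \<delta>1 (\<delta>2 / (real m + 1))" using \<delta> \<delta>2 by auto
      fix \<epsilon> assume \<epsilon>: "0 < \<epsilon>" "\<epsilon> < min \<delta>1 (\<delta>2 / (real m + 1))"
      then have e3: "real m * \<epsilon> \<le> \<delta>2" by (simp add: field_simps)
      have "along E (e', x', \<tau>') (real m * \<epsilon>) = \<rho> (y + of_int o' * (real m * \<epsilon>))"
        using \<delta>2(2)[OF _ e3] \<epsilon> by simp
      also have "of_int o' * (real m * \<epsilon>) = of_int (o' * int m) * \<epsilon>" by simp
      also have "\<rho> (y + of_int (o' * int m) * \<epsilon>) = f (along \<Gamma> v \<epsilon>)"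
        unfolding om using al[of \<epsilon>] \<epsilon> by simp
      finally show "f (along \<Gamma> v \<epsilon>) = along E (e', x', \<tau>') (real m * \<epsilon>)" by simp
    qed
  qed
  show ?thesis
  proof (cases "0 \<le> o' * \<kappa>")
    case True
    then have "(THE m. int m = o' * \<kappa>) = nat (o' * \<kappa>)"
      by (intro the_equality) auto
    moreover have "\<exists>m. int m = o' * \<kappa>"
      using True by (intro exI[of _ "nat (o' * \<kappa>)"]) simp
    ultimately show ?thesis unfolding dir_slope_def iff by simp
  next
    case False
    then have "\<not> (\<exists>m. int m = o' * \<kappa>)" by auto
    then show ?thesis using False unfolding dir_slope_def iff by simp
  qed
qed

lemma direction_sign:
  assumes "d \<in> directions E P"
  obtains e x \<tau> o' where "d = (e, x, \<tau>)" "of_int (\<sigma> e) * \<tau> = of_int o'" "o' = 1 \<or> o' = -1"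
proof -
  obtain e x \<tau> where d: "d = (e, x, \<tau>)" by (cases d)
  then have "e \<in> EE" "\<tau> = 1 \<or> \<tau> = -1" using assms by (auto simp: directions_def)
  then have "of_int (\<sigma> e) * \<tau> = of_int 1 \<or> of_int (\<sigma> e) * \<tau> = of_int (-1)"
    using \<sigma>_arc[of e] by auto
  then show ?thesis using d that by blast
qed

end

text \<open>\<open>p\<close> lifts the images of the vertices. The lift of \<open>e\<close> that
  starts at \<open>p (src e)\<close> ends at \<open>p (tgt e) + of_int (w e) * l\<close>, so
  \<open>w\<close> depends on the choice of \<open>p\<close>, but only by a coboundary, which
  balanced forms do not see.\<close>

locale circle_map = E: uniformized E l \<rho> a \<sigma> + curve \<Gamma> for E l \<rho> a \<sigma> \<Gamma> +
  fixes \<phi> :: "point \<Rightarrow> point" and s w :: "nat \<Rightarrow> int" and p :: "nat \<Rightarrow> real"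
  assumes s_balanced: "s \<in> balanced \<Gamma>"
    and \<phi>_pt: "\<And>e x. e \<in> EE \<Longrightarrow> 0 \<le> x \<Longrightarrow> x \<le> len \<Gamma> e \<Longrightarrow> \<phi> (pt \<Gamma> e x) = \<rho> (p (src e) + of_int (s e) * x)"
    and \<phi>_Vertex: "\<And>v. v \<in> VV \<Longrightarrow> \<phi> (Vertex v) = \<rho> (p v)"
    and winding: "\<And>e. e \<in> EE \<Longrightarrow> of_int (s e) * len \<Gamma> e = p (tgt e) - p (src e) + of_int (w e) * l"
begin

lemma \<phi>_points: "P \<in> points \<Gamma> \<Longrightarrow> \<phi> P \<in> points E"
  by (erule points_cases) (auto simp: \<phi>_Vertex pt_inner[symmetric] \<phi>_pt simp del: pt_inner)

lemma \<phi>_Inner: "e \<in> EE \<Longrightarrow> 0 < x \<Longrightarrow> x < len \<Gamma> e \<Longrightarrow> \<phi> (Inner e x) = \<rho> (p (src e) + of_int (s e) * x)"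
  using \<phi>_pt[of e x] by (simp add: pt_inner)

lemma dir_slope_eq:
  fixes \<tau> o' :: int
  assumes v: "(e, x, of_int \<tau>) \<in> directions \<Gamma> P" and w: "(e', x', \<tau>') \<in> directions E (\<phi> P)"
    and o': "of_int (\<sigma> e') * \<tau>' = of_int o'"
  shows "dir_slope \<Gamma> E \<phi> (e, x, of_int \<tau>) (e', x', \<tau>') = nat (o' * \<tau> * s e)"
proof -
  have d: "e \<in> EE" "0 \<le> x" "x \<le> len \<Gamma> e" "pt \<Gamma> e x = P"
    "\<tau> = 1 \<and> x < len \<Gamma> e \<or> \<tau> = -1 \<and> 0 < x"
    using v by (auto simp: directions_def)
  define y where "y = p (src e) + of_int (s e) * x"
  have y: "\<phi> P = \<rho> y" using \<phi>_pt[OF d(1-3)] d(4) by (simp add: y_def)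
  define \<delta>1 where "\<delta>1 = (if \<tau> = 1 then len \<Gamma> e - x else x)"
  have "dir_slope \<Gamma> E \<phi> (e, x, of_int \<tau>) (e', x', \<tau>') = nat (o' * (\<tau> * s e))"
  proof (rule E.dir_slope_affine[of \<delta>1])
    show "0 < \<delta>1" using d by (auto simp: \<delta>1_def)
    fix \<epsilon> assume \<epsilon>: "0 \<le> \<epsilon>" "\<epsilon> \<le> \<delta>1"
    have "0 \<le> x + of_int \<tau> * \<epsilon>" "x + of_int \<tau> * \<epsilon> \<le> len \<Gamma> e"
      using d \<epsilon> by (auto simp: \<delta>1_def split: if_splits)
    then show "\<phi> (along \<Gamma> (e, x, of_int \<tau>) \<epsilon>) = \<rho> (y + of_int (\<tau> * s e) * \<epsilon>)"
      using \<phi>_pt[OF d(1)] by (simp add: y_def algebra_simps)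
  qed (use w o' y in auto)
  then show ?thesis by (simp add: mult.assoc)
qed

text \<open>The slopes at \<open>v\<close> counted along the directions whose images run upwards on
  the line.\<close>

definition mult :: "nat \<Rightarrow> nat" where
  "mult v = (\<Sum>e | e \<in> EE \<and> src e = v. nat (s e)) + (\<Sum>e | e \<in> EE \<and> tgt e = v. nat (- s e))"

text \<open>The count along the downward directions. Its agreement with \<open>mult\<close> is the
  balancing of \<open>s\<close>, and this is the harmonicity of the map at \<open>v\<close>.\<close>

lemma mult_alt:
  assumes "v \<in> VV"
  shows "mult v = (\<Sum>e | e \<in> EE \<and> src e = v. nat (- s e)) + (\<Sum>e | e \<in> EE \<and> tgt e = v. nat (s e))"
proof -
  have n: "int (nat k) - int (nat (- k)) = k" for k by simp
  have "(\<Sum>e | e \<in> EE \<and> src e = v. int (nat (s e)) - int (nat (- s e))) =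
    (\<Sum>e | e \<in> EE \<and> tgt e = v. int (nat (s e)) - int (nat (- s e)))"
    unfolding n using balancedD[OF s_balanced assms] by simp
  then have "int (mult v) = int ((\<Sum>e | e \<in> EE \<and> src e = v. nat (- s e)) + (\<Sum>e | e \<in> EE \<and> tgt e =
    v. nat (s e)))"
    unfolding mult_def sum_subtractf by simp
  then show ?thesis by (simp only: of_nat_eq_iff)
qed

lemma dir_deg_Inner:
  assumes e: "e \<in> EE" "0 < x" "x < len \<Gamma> e" and d: "d \<in> directions E (\<phi> (Inner e x))"
  shows "dir_deg \<Gamma> E \<phi> (Inner e x) d = nat \<bar>s e\<bar>"
proof -
  obtain e' x' \<tau>' o' where d': "d = (e', x', \<tau>')" "of_int (\<sigma> e') * \<tau>' = of_int o'" "o' = 1 \<or> o' = -1"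
    using d by (rule E.direction_sign)
  have "dir_slope \<Gamma> E \<phi> (e, x, of_int \<tau>) d = nat (o' * \<tau> * s e)" if "\<tau> = 1 \<or> \<tau> = -1" for \<tau>
    unfolding d'(1)
  proof (rule dir_slope_eq)
    show "(e, x, of_int \<tau>) \<in> directions \<Gamma> (Inner e x)" using e that by (auto simp: directions_Inner)
  qed (use d d' in auto)
  from this[of 1] this[of "-1"] show ?thesis
    using d'(3) by (auto simp: dir_deg_def directions_Inner[OF e] nat_abs_int_diff)
qed

lemma dir_deg_Vertex:
  assumes v: "v \<in> VV" and d: "d \<in> directions E (\<phi> (Vertex v))"
  shows "dir_deg \<Gamma> E \<phi> (Vertex v) d = mult v"
proof -
  obtain e' x' \<tau>' o' where d': "d = (e', x', \<tau>')" "of_int (\<sigma> e') * \<tau>' = of_int o'" "o' = 1 \<or> o' = -1"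
    using d by (rule E.direction_sign)
  have 1: "dir_slope \<Gamma> E \<phi> (e, 0, 1) d = nat (o' * s e)" if "e \<in> EE" "src e = v" for e
    using dir_slope_eq[of e 0 1 "Vertex v" e' x' \<tau>' o'] that d d' by (auto simp: directions_Vertex)
  have 2: "dir_slope \<Gamma> E \<phi> (e, len \<Gamma> e, -1) d = nat (- o' * s e)" if "e \<in> EE" "tgt e = v" for e
    using dir_slope_eq[of e "len \<Gamma> e" "-1" "Vertex v" e' x' \<tau>' o'] that d d' by (auto simp:
      directions_Vertex)
  have "dir_deg \<Gamma> E \<phi> (Vertex v) d =
    (\<Sum>e | e \<in> EE \<and> src e = v. nat (o' * s e)) + (\<Sum>e | e \<in> EE \<and> tgt e = v. nat (- o' * s e))"
    unfolding dir_deg_def sum_directions_Vertex using 1 2 by simp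
  then show ?thesis using d'(3) mult_alt[OF v] by (auto simp: mult_def)
qed

lemma harmonic: "harmonic \<Gamma> E \<phi>"
  unfolding harmonic_def
proof (intro ballI)
  fix P d d' assume "P \<in> points \<Gamma>" "d \<in> directions E (\<phi> P)" "d' \<in> directions E (\<phi> P)"
  then show "dir_deg \<Gamma> E \<phi> P d = dir_deg \<Gamma> E \<phi> P d'"
    by (cases rule: points_cases) (simp_all add: dir_deg_Vertex dir_deg_Inner)
qed

lemma some_direction: "P \<in> points \<Gamma> \<Longrightarrow> (SOME d. d \<in> directions E (\<phi> P)) \<in> directions E (\<phi> P)"
  using E.directions_nonempty[OF \<phi>_points, of P] by (simp add: some_in_eq)

lemma local_deg_Vertex: "v \<in> VV \<Longrightarrow> local_deg \<Gamma> E \<phi> (Vertex v) = mult v"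
  unfolding local_deg_def by (rule dir_deg_Vertex) (auto intro!: some_direction simp: points_def)

lemma local_deg_Inner: "e \<in> EE \<Longrightarrow> 0 < x \<Longrightarrow> x < len \<Gamma> e \<Longrightarrow> local_deg \<Gamma> E \<phi> (Inner e x) = nat \<bar>s e\<bar>"
  unfolding local_deg_def by (rule dir_deg_Inner) (auto intro!: some_direction simp: points_def)

end

section \<open>Counting integers in a window and summing truncations\<close>

lemma card_le_bounded:
  assumes "\<bar>z\<bar> \<le> real N"
  shows "int (card {j\<in>{-int N..int N}. of_int j \<le> z}) = int N + 1 + \<lfloor>z\<rfloor>"
proof -
  have "{j\<in>{-int N..int N}. of_int j \<le> z} = {-int N..\<lfloor>z\<rfloor>}"
    using assms by (auto simp: le_floor_iff)
  moreover have "- int N \<le> \<lfloor>z\<rfloor>" using assms by (simp add: le_floor_iff)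
  ultimately show ?thesis by simp
qed

lemma card_ge_bounded:
  assumes "\<bar>z\<bar> \<le> real N"
  shows "int (card {j\<in>{-int N..int N}. z \<le> of_int j}) = int N + 1 - \<lceil>z\<rceil>"
proof -
  have "{j\<in>{-int N..int N}. z \<le> of_int j} = {\<lceil>z\<rceil>..int N}"
    using assms by (auto simp: ceiling_le_iff)
  moreover have "\<lceil>z\<rceil> \<le> int N" using assms by (simp add: ceiling_le_iff)
  ultimately show ?thesis by simp
qed

lemma floor_plus_ceiling: "\<lceil>z\<rceil> = \<lfloor>z\<rfloor> + (if \<exists>n::int. z = of_int n then 0 else 1)"
proof (cases "\<exists>n::int. z = of_int n")
  case False
  then have "z \<noteq> of_int \<lfloor>z\<rfloor>" by metis
  then show ?thesis using False by (simp add: ceiling_altdef)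
qed auto

lemma frag_sum_const: "finite A \<Longrightarrow> (\<Sum>i\<in>A. c) = frag_cmul (int (card A)) c"
  by (induction A rule: finite_induct) (auto simp: frag_cmul_distrib)

text \<open>\<open>f\<close> is the last index with \<open>q + of_int j * l \<le> t\<close>. Up to
  it the terms form an arithmetic progression, and each of the remaining \<open>N - f\<close> terms
  equals \<open>t\<close>.\<close>

lemma sum_min_closed:
  fixes l t q :: real
  assumes "\<bar>(t - q) / l\<bar> \<le> real N" "0 < l"
  defines "f \<equiv> real_of_int \<lfloor>(t - q) / l\<rfloor>"
  shows "(\<Sum>j\<in>{-int N..int N}. min (q + of_int j * l) t) =
    (f + real N + 1) * q + l * (f * (f + 1) - real N * (real N + 1)) / 2 + (real N - f) * t"
proof -
  let ?f = "\<lfloor>(t - q) / l\<rfloor>"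
  have bf: "- int N \<le> ?f" "?f \<le> int N" using assms(1) by linarith+
  have gauss: "(\<Sum>j\<in>{-int N..m}. q + of_int j * l) =
    (of_int m + real N + 1) * q + l * (of_int m * (of_int m + 1) - real N * (real N + 1)) / 2"
    if "- int N \<le> m" for m
    using that
  proof (induction m rule: int_ge_induct)
    case base
    then show ?case by (simp add: algebra_simps)
  next
    case (step m)
    have "{-int N..m + 1} = insert (m + 1) {-int N..m}" using step by auto
    then show ?case using step by (simp add: field_simps)
  qed
  have le: "q + of_int j * l \<le> t \<longleftrightarrow> j \<le> ?f" for j :: int
  proof -
    have "j \<le> ?f \<longleftrightarrow> of_int j * l \<le> t - q" using assms(2) by (simp add: le_floor_iff pos_le_divide_eq)
    then show ?thesis by linarith
  qed
  have "{-int N..int N} = {-int N..?f} \<union> {?f + 1..int N}" using bf by auto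
  then have "(\<Sum>j\<in>{-int N..int N}. min (q + of_int j * l) t) =
    (\<Sum>j\<in>{-int N..?f}. min (q + of_int j * l) t) + (\<Sum>j\<in>{?f + 1..int N}. min (q + of_int j * l) t)"
    by (simp add: sum.union_disjoint)
  also have "(\<Sum>j\<in>{-int N..?f}. min (q + of_int j * l) t) = (\<Sum>j\<in>{-int N..?f}. q + of_int j * l)"
    using le by (intro sum.cong) (auto simp: min_def)
  also have "(\<Sum>j\<in>{?f + 1..int N}. min (q + of_int j * l) t) = (\<Sum>j\<in>{?f + 1..int N}. t)"
  proof (intro sum.cong refl)
    fix j assume "j \<in> {?f + 1..int N}"
    then have "\<not> q + of_int j * l \<le> t" by (simp add: le)
    then show "min (q + of_int j * l) t = t" by linarith
  qed
  also have "(\<Sum>j\<in>{?f + 1..int N}. t) = (real N - f) * t"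
    using bf by (simp add: f_def)
  finally show ?thesis using gauss[OF bf(1)] by (simp add: f_def)
qed

text \<open>Shifting \<open>t\<close> by \<open>k\<close> periods shifts the floor by
  \<open>k\<close>. What matters is that the change depends on \<open>q\<close> only through
  \<open>of_int k * q\<close>, so a difference of two values of \<open>q\<close> retains just
  \<open>k\<close> times that difference.\<close>

lemma sum_min_shift:
  fixes l t q :: real and k :: int
  assumes "\<bar>t - q\<bar> \<le> real N * l" "\<bar>t + of_int k * l - q\<bar> \<le> real N * l" "0 < l"
  shows "(\<Sum>j\<in>{-int N..int N}. min (q + of_int j * l) (t + of_int k * l)) =
    (\<Sum>j\<in>{-int N..int N}. min (q + of_int j * l) t) + of_int k * q +
      (l * (of_int k - of_int k * of_int k) / 2 + real N * of_int k * l - of_int k * t)"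
proof -
  have b: "\<bar>(t - q) / l\<bar> \<le> real N" "\<bar>(t + of_int k * l - q) / l\<bar> \<le> real N"
    using assms by (simp_all add: pos_divide_le_eq)
  have "(t + of_int k * l - q) / l = (t - q) / l + of_int k" using assms(3) by (simp add: field_simps)
  then have f: "\<lfloor>(t + of_int k * l - q) / l\<rfloor> = \<lfloor>(t - q) / l\<rfloor> + k" by simp
  show ?thesis
    unfolding sum_min_closed[OF b(1) assms(3)] sum_min_closed[OF b(2) assms(3)] f
    by (simp add: field_simps)
qed

section \<open>Lifts of the translates of a point, the pull-back divisor and the degree\<close>

context circle_map
begin

abbreviation J :: "nat \<Rightarrow> int set" where "J N \<equiv> {-int N..int N}"

text \<open>The coordinate on the line extending \<open>e\<close> whose lift is \<open>y\<close>. On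
  a contracted edge the division by 0 gives 0, which is harmless since the edge enters with weight
  \<open>\<bar>s e\<bar>\<close>.\<close>

definition preim :: "nat \<Rightarrow> real \<Rightarrow> real" where "preim e y = (y - p (src e)) / of_int (s e)"

definition clamp :: "nat \<Rightarrow> real \<Rightarrow> real" where "clamp e y = max 0 (min (len \<Gamma> e) (preim e y))"

text \<open>If \<open>N\<close> is good for \<open>q\<close>, then the translates \<open>q + j l\<close> with \<open>j \<in> J N\<close> cover the lifts of all edges,
  and every further translate would be clamped to the same end of each edge.\<close>

definition good :: "nat \<Rightarrow> real \<Rightarrow> bool" where
  "good N q \<longleftrightarrow> (\<forall>v\<in>VV. \<bar>p v - q\<bar> \<le> real N * l) \<and> (\<forall>e\<in>EE. \<bar>p (tgt e) + of_int (w e) * l - q\<bar> \<le> real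
    N * l)"

text \<open>For \<open>t\<close> within \<open>real N * l\<close> of \<open>q\<close> this is the
  number of translates of \<open>q\<close> in the window that are at most \<open>t\<close>. Defined
  by the formula rather than the cardinality, it obeys \<open>count_shift\<close> for all
  \<open>t\<close>.\<close>

definition le_count :: "nat \<Rightarrow> real \<Rightarrow> real \<Rightarrow> int" where
  "le_count N q t = int N + 1 + \<lfloor>(t - q) / l\<rfloor>"

definition ge_count :: "nat \<Rightarrow> real \<Rightarrow> real \<Rightarrow> int" where
  "ge_count N q t = int N + 1 - \<lceil>(t - q) / l\<rceil>"

lemma eventually_good: "\<forall>\<^sub>F N in sequentially. good N q"
proof -
  have "\<forall>\<^sub>F N in sequentially. c \<le> real N * l" for c
  proof -
    obtain N0 :: nat where "c / l \<le> real N0" using real_arch_simple by blast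
    then have "c \<le> real N * l" if "N \<ge> N0" for N
    proof -
      have "c / l \<le> real N" using \<open>c / l \<le> real N0\<close> that by linarith
      then show ?thesis using E.l_pos by (simp add: pos_divide_le_eq)
    qed
    then show ?thesis by (auto simp: eventually_sequentially)
  qed
  then show ?thesis
    unfolding good_def by (intro eventually_conj eventually_ball_finite ballI) auto
qed

lemma ex_good: obtains N where "good N q" "good N q'"
  using eventually_conj[OF eventually_good[of q] eventually_good[of q']]
  by (auto simp: eventually_sequentially)

lemma card_le_count:
  assumes "\<bar>t - q\<bar> \<le> real N * l"
  shows "int (card {j\<in>J N. q + of_int j * l \<le> t}) = le_count N q t"
proof -
  have "q + of_int j * l \<le> t \<longleftrightarrow> of_int j \<le> (t - q) / l" for j :: int
    using E.l_pos by (simp add: pos_le_divide_eq algebra_simps)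
  moreover have "\<bar>(t - q) / l\<bar> \<le> real N" using assms E.l_pos by (simp add: pos_divide_le_eq)
  ultimately show ?thesis using card_le_bounded by (simp add: le_count_def)
qed

lemma card_ge_count:
  assumes "\<bar>t - q\<bar> \<le> real N * l"
  shows "int (card {j\<in>J N. t \<le> q + of_int j * l}) = ge_count N q t"
proof -
  have "t \<le> q + of_int j * l \<longleftrightarrow> (t - q) / l \<le> of_int j" for j :: int
    using E.l_pos by (simp add: pos_divide_le_eq algebra_simps)
  moreover have "\<bar>(t - q) / l\<bar> \<le> real N" using assms E.l_pos by (simp add: pos_divide_le_eq)
  ultimately show ?thesis using card_ge_bounded by (simp add: ge_count_def)
qed

lemma count_shift:
  "le_count N q (t + of_int k * l) = le_count N q t + k"
  "ge_count N q (t + of_int k * l) = ge_count N q t - k"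
proof -
  have "(t + of_int k * l - q) / l = (t - q) / l + of_int k" using E.l_pos by (simp add: field_simps)
  then show "le_count N q (t + of_int k * l) = le_count N q t + k"
    "ge_count N q (t + of_int k * l) = ge_count N q t - k"
    by (simp_all add: le_count_def ge_count_def)
qed

text \<open>Each of the \<open>2 * N + 1\<close> translates lies on one side of \<open>t\<close>; a
  translate equal to \<open>t\<close> is counted on both. This extra 1 is how fibre points at
  vertices will appear.\<close>

lemma count_sum: "le_count N q t + ge_count N q t = 2 * int N + 1 + of_bool (\<rho> t = \<rho> q)"
proof -
  have "\<rho> t = \<rho> q \<longleftrightarrow> (\<exists>n::int. (t - q) / l = of_int n)"
    unfolding E.\<rho>_eq using E.l_pos by (simp add: field_simps)
  then show ?thesis
    using floor_plus_ceiling[of "(t - q) / l"] by (simp add: le_count_def ge_count_def)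
qed

text \<open>The translates truncated to the tail lie below \<open>p (src e)\<close> for a positive
  slope and above it for a negative one; a contracted edge gives 0 on both sides.\<close>

lemma tail_count:
  assumes "good N q" "e \<in> EE"
  shows "\<bar>s e\<bar> * int (card {j\<in>J N. preim e (q + of_int j * l) \<le> 0}) =
    int (nat (s e)) * le_count N q (p (src e)) + int (nat (- s e)) * ge_count N q (p (src e))"
proof -
  have g: "\<bar>p (src e) - q\<bar> \<le> real N * l" using assms by (simp add: good_def)
  consider "s e > 0" | "s e < 0" | "s e = 0" by linarith
  then show ?thesis
  proof cases
    case 1
    then have "preim e (q + of_int j * l) \<le> 0 \<longleftrightarrow> q + of_int j * l \<le> p (src e)" for j :: int
      by (simp add: preim_def pos_divide_le_eq)
    then show ?thesis using 1 card_le_count[OF g] by simp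
  next
    case 2
    then have "preim e (q + of_int j * l) \<le> 0 \<longleftrightarrow> p (src e) \<le> q + of_int j * l" for j :: int
      by (simp add: preim_def neg_divide_le_eq)
    then show ?thesis using 2 card_ge_count[OF g] by simp
  qed simp
qed

text \<open>The lift ends \<open>w e\<close> periods away from \<open>p (tgt e)\<close>. Moving the
  count back to \<open>p (tgt e)\<close> costs \<open>s e * w e\<close>, with the same sign for both
  signs of the slope; these terms add up to the degree.\<close>

lemma head_count:
  assumes "good N q" "e \<in> EE"
  shows "\<bar>s e\<bar> * int (card {j\<in>J N. len \<Gamma> e \<le> preim e (q + of_int j * l)}) =
    int (nat (s e)) * ge_count N q (p (tgt e)) + int (nat (- s e)) * le_count N q (p (tgt e)) - s
      e * w e"
proof -
  let ?t = "p (tgt e) + of_int (w e) * l"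
  have g: "\<bar>?t - q\<bar> \<le> real N * l" using assms by (simp add: good_def)
  have t: "of_int (s e) * len \<Gamma> e = ?t - p (src e)" using winding[OF assms(2)] by simp
  consider "s e > 0" | "s e < 0" | "s e = 0" by linarith
  then show ?thesis
  proof cases
    case 1
    then have "len \<Gamma> e \<le> preim e (q + of_int j * l) \<longleftrightarrow> ?t \<le> q + of_int j * l" for j :: int
      using t by (auto simp: preim_def pos_le_divide_eq mult.commute)
    then show ?thesis using 1 card_ge_count[OF g] unfolding count_shift by (simp add:
      right_diff_distrib)
  next
    case 2
    then have "len \<Gamma> e \<le> preim e (q + of_int j * l) \<longleftrightarrow> q + of_int j * l \<le> ?t" for j :: int
      using t by (auto simp: preim_def neg_le_divide_eq mult.commute)
    then show ?thesis using 2 card_le_count[OF g] unfolding count_shift by (simp add: distrib_left)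
  qed simp
qed

definition inner_idx :: "nat \<Rightarrow> real \<Rightarrow> (nat \<times> int) set" where
  "inner_idx N q = {(e, j). e \<in> EE \<and> s e \<noteq> 0 \<and> j \<in> J N \<and> 0 < preim e (q + of_int j * l) \<and>
     preim e (q + of_int j * l) < len \<Gamma> e}"

lemma finite_inner_idx [simp]: "finite (inner_idx N q)"
  by (rule finite_subset[of _ "EE \<times> J N"]) (auto simp: inner_idx_def)

lemma inner_fibre:
  assumes "good N q"
  shows "fibre \<Gamma> E \<phi> (\<rho> q) = Vertex ` {v \<in> VV. \<rho> (p v) = \<rho> q \<and> mult v \<noteq> 0} \<union>
    (\<lambda>(e, j). Inner e (preim e (q + of_int j * l))) ` inner_idx N q" (is "_ = ?A \<union> ?B")
proof (intro equalityI subsetI)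
  fix P assume "P \<in> fibre \<Gamma> E \<phi> (\<rho> q)"
  then have P: "P \<in> points \<Gamma>" "\<phi> P = \<rho> q" "local_deg \<Gamma> E \<phi> P \<noteq> 0" by (auto simp: fibre_def)
  from P(1) show "P \<in> ?A \<union> ?B"
  proof (cases rule: points_cases)
    case (1 v)
    then show ?thesis using P by (auto simp: local_deg_Vertex \<phi>_Vertex)
  next
    case (2 e x)
    then have se: "s e \<noteq> 0" using P by (auto simp: local_deg_Inner)
    have "\<rho> (p (src e) + of_int (s e) * x) = \<rho> q" using 2 P \<phi>_Inner by simp
    then obtain j :: int where j: "p (src e) + of_int (s e) * x - q = of_int j * l" by (auto simp:
      E.\<rho>_eq)
    have x: "preim e (q + of_int j * l) = x" using se j[symmetric] by (simp add: preim_def)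
    \<comment> \<open>The lift of an inner point lies between the lifts of the two ends of
      \<open>e\<close>, and \<open>good\<close> bounds the distance of both from
      \<open>q\<close>.\<close>
    have "\<bar>of_int j * l\<bar> \<le> real N * l"
    proof -
      have g: "\<bar>p (src e) - q\<bar> \<le> real N * l" "\<bar>p (tgt e) + of_int (w e) * l - q\<bar> \<le> real N * l"
        using assms 2 by (auto simp: good_def)
      then have g2: "\<bar>p (src e) + of_int (s e) * len \<Gamma> e - q\<bar> \<le> real N * l"
        using winding[of e] 2 by simp
      have "of_int (s e) * x \<le> max 0 (of_int (s e) * len \<Gamma> e)" "min 0 (of_int (s e) * len \<Gamma> e) \<le>
        of_int (s e) * x"
      proof -
        consider "s e > 0" | "s e < 0" using se by linarith
        then have "of_int (s e) * x \<le> max 0 (of_int (s e) * len \<Gamma> e) \<and> min 0 (of_int (s e) * len \<Gamma>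
          e) \<le> of_int (s e) * x"
        proof cases
          case 1
          then have "0 \<le> of_int (s e) * x" "of_int (s e) * x \<le> of_int (s e) * len \<Gamma> e" using 2 by auto
          then show ?thesis by auto
        next
          case neg: 2
          then have "of_int (s e) * x \<le> 0" "of_int (s e) * len \<Gamma> e \<le> of_int (s e) * x"
            using 2 by (auto simp: mult_le_0_iff)
          then show ?thesis by auto
        qed
        then show "of_int (s e) * x \<le> max 0 (of_int (s e) * len \<Gamma> e)" "min 0 (of_int (s e) * len \<Gamma>
          e) \<le> of_int (s e) * x"
          by auto
      qed
      then show ?thesis using j g(1) g2 by linarith
    qed
    then have "\<bar>real_of_int j\<bar> * l \<le> real N * l" using E.l_pos by (simp add: abs_mult)
    then have "\<bar>real_of_int j\<bar> \<le> real N" using E.l_pos by (simp only: mult_le_cancel_right_pos)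
    then have "j \<in> J N" by auto
    then have "(e, j) \<in> inner_idx N q" using 2 se x by (auto simp: inner_idx_def)
    then show ?thesis using 2 x by force
  qed
next
  fix P assume "P \<in> ?A \<union> ?B"
  then show "P \<in> fibre \<Gamma> E \<phi> (\<rho> q)"
  proof
    assume "P \<in> ?A"
    then show ?thesis by (auto simp: fibre_def local_deg_Vertex \<phi>_Vertex points_def)
  next
    assume "P \<in> ?B"
    then obtain e j where ej: "(e, j) \<in> inner_idx N q" "P = Inner e (preim e (q + of_int j * l))"
      by auto
    let ?x = "preim e (q + of_int j * l)"
    have e: "e \<in> EE" "s e \<noteq> 0" "0 < ?x" "?x < len \<Gamma> e" using ej by (auto simp: inner_idx_def)
    have "\<phi> P = \<rho> (p (src e) + of_int (s e) * ?x)" using e ej \<phi>_Inner by simp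
    also have "p (src e) + of_int (s e) * ?x = q + of_int j * l" using e by (simp add: preim_def)
    finally show ?thesis using e ej by (auto simp: fibre_def local_deg_Inner points_def)
  qed
qed

definition inner_part :: "nat \<Rightarrow> real \<Rightarrow> (point \<Rightarrow>\<^sub>0 int)" where
  "inner_part N q = (\<Sum>(e, j)\<in>inner_idx N q. frag_cmul \<bar>s e\<bar> (frag_of (Inner e (preim e (q + of_int
    j * l)))))"

lemma pullback_divisor_formula:
  assumes "good N q"
  shows "pullback_divisor \<Gamma> E \<phi> (frag_of (\<rho> q)) =
    (\<Sum>v\<in>VV. frag_cmul (int (mult v) * of_bool (\<rho> (p v) = \<rho> q)) (frag_of (Vertex v))) + inner_part N q"
proof -
  let ?F = "\<lambda>P. frag_cmul (int (local_deg \<Gamma> E \<phi> P)) (frag_of P)"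
  \<comment> \<open>With nonzero slope and nonzero period, different translates have different
    coordinates on the same edge.\<close>
  have inj: "inj_on (\<lambda>(e, j). Inner e (preim e (q + of_int j * l))) (inner_idx N q)"
    using E.l_pos by (auto simp: inj_on_def inner_idx_def preim_def)
  have "pullback_divisor \<Gamma> E \<phi> (frag_of (\<rho> q)) = (\<Sum>P\<in>fibre \<Gamma> E \<phi> (\<rho> q). ?F P)"
    by (simp add: pullback_divisor_def)
  also have "\<dots> = (\<Sum>P\<in>Vertex ` {v \<in> VV. \<rho> (p v) = \<rho> q \<and> mult v \<noteq> 0}. ?F P) +
      (\<Sum>P\<in>(\<lambda>(e, j). Inner e (preim e (q + of_int j * l))) ` inner_idx N q. ?F P)"
    unfolding inner_fibre[OF assms] by (intro sum.union_disjoint) auto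
  also have "(\<Sum>P\<in>Vertex ` {v \<in> VV. \<rho> (p v) = \<rho> q \<and> mult v \<noteq> 0}. ?F P) =
      (\<Sum>v\<in>{v \<in> VV. \<rho> (p v) = \<rho> q \<and> mult v \<noteq> 0}. frag_cmul (int (mult v)) (frag_of (Vertex v)))"
    by (subst sum.reindex) (auto simp: inj_on_def local_deg_Vertex)
  also have "\<dots> = (\<Sum>v\<in>VV. frag_cmul (int (mult v) * of_bool (\<rho> (p v) = \<rho> q)) (frag_of (Vertex v)))"
    by (intro sum.mono_neutral_cong_left) auto
  also have "(\<Sum>P\<in>(\<lambda>(e, j). Inner e (preim e (q + of_int j * l))) ` inner_idx N q. ?F P) =
    inner_part N q"
    unfolding inner_part_def
    by (subst sum.reindex[OF inj]) (auto simp: inner_idx_def local_deg_Inner intro!: sum.cong)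
  finally show ?thesis .
qed

definition clamped :: "nat \<Rightarrow> real \<Rightarrow> (point \<Rightarrow>\<^sub>0 int)" where
  "clamped N q = (\<Sum>e\<in>EE. \<Sum>j\<in>J N. frag_cmul \<bar>s e\<bar> (frag_of (pt \<Gamma> e (clamp e (q + of_int j * l)))))"

text \<open>The excess at the vertices caused by truncation. It does not mention \<open>q\<close>,
  so it cancels between the two ends of a path.\<close>

definition defect :: "nat \<Rightarrow> (point \<Rightarrow>\<^sub>0 int)" where
  "defect N = (\<Sum>v\<in>VV. frag_cmul (int (mult v) * (2 * int N + 1) - (\<Sum>e | e \<in> EE \<and> tgt e = v. s e *
    w e)) (frag_of (Vertex v)))"

lemma clamped_edge:
  assumes "e \<in> EE"
  shows "(\<Sum>j\<in>J N. frag_of (pt \<Gamma> e (clamp e (q + of_int j * l)))) =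
    frag_cmul (int (card {j\<in>J N. preim e (q + of_int j * l) \<le> 0})) (frag_of (Vertex (src e))) +
    frag_cmul (int (card {j\<in>J N. len \<Gamma> e \<le> preim e (q + of_int j * l)})) (frag_of (Vertex (tgt e))) +
    (\<Sum>j | j \<in> J N \<and> 0 < preim e (q + of_int j * l) \<and> preim e (q + of_int j * l) < len \<Gamma> e.
       frag_of (Inner e (preim e (q + of_int j * l))))"
proof -
  let ?x = "\<lambda>j::int. preim e (q + of_int j * l)"
  let ?f = "\<lambda>P c j. if P (?x j) then c j else (0::point \<Rightarrow>\<^sub>0 int)"
  have "frag_of (pt \<Gamma> e (clamp e (q + of_int j * l))) =
    ?f (\<lambda>x. x \<le> 0) (\<lambda>j. frag_of (Vertex (src e))) j + ?f (\<lambda>x. len \<Gamma> e \<le> x) (\<lambda>j. frag_of (Vertex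
      (tgt e))) j +
    ?f (\<lambda>x. 0 < x \<and> x < len \<Gamma> e) (\<lambda>j. frag_of (Inner e (?x j))) j" for j
  proof -
    consider "?x j \<le> 0" | "len \<Gamma> e \<le> ?x j" "0 < ?x j" | "0 < ?x j" "?x j < len \<Gamma> e" by linarith
    then show ?thesis
    proof cases
      case 1
      then have "clamp e (q + of_int j * l) = 0" using len_pos[OF assms] by (auto simp: clamp_def)
      then show ?thesis using 1 len_pos[OF assms] by simp
    next
      case 2
      then have "clamp e (q + of_int j * l) = len \<Gamma> e" using len_pos[OF assms] by (auto simp: clamp_def)
      then show ?thesis using 2 assms by simp
    next
      case 3
      then have "clamp e (q + of_int j * l) = ?x j" by (auto simp: clamp_def)
      then show ?thesis using 3 by (simp add: pt_inner)
    qed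
  qed
  then have "(\<Sum>j\<in>J N. frag_of (pt \<Gamma> e (clamp e (q + of_int j * l)))) =
    (\<Sum>j\<in>J N. ?f (\<lambda>x. x \<le> 0) (\<lambda>j. frag_of (Vertex (src e))) j) + (\<Sum>j\<in>J N. ?f (\<lambda>x. len \<Gamma> e \<le> x) (\<lambda>j.
      frag_of (Vertex (tgt e))) j) +
    (\<Sum>j\<in>J N. ?f (\<lambda>x. 0 < x \<and> x < len \<Gamma> e) (\<lambda>j. frag_of (Inner e (?x j))) j)"
    by (simp only: sum.distrib)
  also have "(\<Sum>j\<in>J N. ?f (\<lambda>x. x \<le> 0) (\<lambda>j. frag_of (Vertex (src e))) j) =
      frag_cmul (int (card {j\<in>J N. ?x j \<le> 0})) (frag_of (Vertex (src e)))"
    by (subst sum.inter_filter[symmetric], simp, rule frag_sum_const, rule finite_subset[of _ "J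
      N"], auto)
  also have "(\<Sum>j\<in>J N. ?f (\<lambda>x. len \<Gamma> e \<le> x) (\<lambda>j. frag_of (Vertex (tgt e))) j) =
      frag_cmul (int (card {j\<in>J N. len \<Gamma> e \<le> ?x j})) (frag_of (Vertex (tgt e)))"
    by (subst sum.inter_filter[symmetric], simp, rule frag_sum_const, rule finite_subset[of _ "J
      N"], auto)
  also have "(\<Sum>j\<in>J N. ?f (\<lambda>x. 0 < x \<and> x < len \<Gamma> e) (\<lambda>j. frag_of (Inner e (?x j))) j) =
    (\<Sum>j | j \<in> J N \<and> 0 < ?x j \<and> ?x j < len \<Gamma> e. frag_of (Inner e (?x j)))"
    by (subst sum.inter_filter[symmetric]) simp_all
  finally show ?thesis .
qed

text \<open>Inside the edges both sides have the same points. At a vertex the tails and heads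
  contribute multiples of \<open>le_count\<close> and of \<open>ge_count\<close>; harmonicity makes
  both factors equal to \<open>mult v\<close>, so only the sum of the two counts remains, and
  \<open>count_sum\<close> evaluates it.\<close>

lemma clamped_eq:
  assumes "good N q"
  shows "clamped N q = pullback_divisor \<Gamma> E \<phi> (frag_of (\<rho> q)) + defect N"
proof -
  let ?le = "\<lambda>v. le_count N q (p v)" and ?ge = "\<lambda>v. ge_count N q (p v)"
  let ?c1 = "\<lambda>e v. int (nat (s e)) * ?le v + int (nat (- s e)) * ?ge v"
  let ?c2 = "\<lambda>e v. int (nat (s e)) * ?ge v + int (nat (- s e)) * ?le v - s e * w e"
  let ?V = "\<lambda>v. frag_of (Vertex v)"
  let ?In = "\<lambda>e. {j \<in> J N. 0 < preim e (q + of_int j * l) \<and> preim e (q + of_int j * l) < len \<Gamma> e}"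
  have "clamped N q = (\<Sum>e\<in>EE. frag_cmul \<bar>s e\<bar> (\<Sum>j\<in>J N. frag_of (pt \<Gamma> e (clamp e (q + of_int j * l)))))"
    by (simp add: clamped_def frag_cmul_sum)
  also have "\<dots> = (\<Sum>e\<in>EE. frag_cmul (?c1 e (src e)) (?V (src e)) + frag_cmul (?c2 e (tgt e)) (?V
    (tgt e)) +
      (\<Sum>j\<in>?In e. frag_cmul \<bar>s e\<bar> (frag_of (Inner e (preim e (q + of_int j * l))))))"
    by (intro sum.cong refl)
      (simp only: clamped_edge frag_cmul_distrib2 frag_cmul_cmul frag_cmul_sum tail_count[OF
        assms] head_count[OF assms])
  also have "\<dots> = (\<Sum>e\<in>EE. frag_cmul (?c1 e (src e)) (?V (src e))) + (\<Sum>e\<in>EE. frag_cmul (?c2 e (tgt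
    e)) (?V (tgt e))) +
      (\<Sum>e\<in>EE. \<Sum>j\<in>?In e. frag_cmul \<bar>s e\<bar> (frag_of (Inner e (preim e (q + of_int j * l)))))"
    by (simp add: sum.distrib)
  also have "(\<Sum>e\<in>EE. \<Sum>j\<in>?In e. frag_cmul \<bar>s e\<bar> (frag_of (Inner e (preim e (q + of_int j * l))))) =
    inner_part N q"
  proof -
    have fin: "finite (?In e)" for e by (rule finite_subset[of _ "J N"]) auto
    have "(\<Sum>e\<in>EE. \<Sum>j\<in>?In e. frag_cmul \<bar>s e\<bar> (frag_of (Inner e (preim e (q + of_int j * l))))) =
      (\<Sum>(e, j)\<in>Sigma EE ?In. frag_cmul \<bar>s e\<bar> (frag_of (Inner e (preim e (q + of_int j * l)))))"
      by (rule sum.Sigma) (use fin finite_EE in blast)+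
    also have "\<dots> = inner_part N q"
      unfolding inner_part_def
    proof (rule sum.mono_neutral_right)
      show "finite (Sigma EE ?In)" by (intro finite_SigmaI fin finite_EE)
    qed (auto simp: inner_idx_def)
    finally show ?thesis .
  qed
  also have "(\<Sum>e\<in>EE. frag_cmul (?c1 e (src e)) (?V (src e))) =
      (\<Sum>v\<in>VV. frag_cmul (\<Sum>e | e \<in> EE \<and> src e = v. ?c1 e v) (?V v))"
    by (subst sum_by_vertex[of src]) (simp_all add: frag_cmul_sum_left)
  also have "(\<Sum>e\<in>EE. frag_cmul (?c2 e (tgt e)) (?V (tgt e))) =
      (\<Sum>v\<in>VV. frag_cmul (\<Sum>e | e \<in> EE \<and> tgt e = v. ?c2 e v) (?V v))"
    by (subst sum_by_vertex[of tgt]) (simp_all add: frag_cmul_sum_left)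
  also have "(\<Sum>v\<in>VV. frag_cmul (\<Sum>e | e \<in> EE \<and> src e = v. ?c1 e v) (?V v)) +
      (\<Sum>v\<in>VV. frag_cmul (\<Sum>e | e \<in> EE \<and> tgt e = v. ?c2 e v) (?V v)) =
      (\<Sum>v\<in>VV. frag_cmul (int (mult v) * of_bool (\<rho> (p v) = \<rho> q)) (?V v)) + defect N"
    unfolding defect_def sum.distrib[symmetric] frag_cmul_distrib[symmetric]
  proof (intro sum.cong refl arg_cong2[of _ _ _ _ frag_cmul])
    fix v assume v: "v \<in> VV"
    have "(\<Sum>e | e \<in> EE \<and> src e = v. ?c1 e v) + (\<Sum>e | e \<in> EE \<and> tgt e = v. ?c2 e v) =
      ?le v * int (mult v) + ?ge v * int ((\<Sum>e | e \<in> EE \<and> src e = v. nat (- s e)) + (\<Sum>e | e \<in> EE \<and>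
        tgt e = v. nat (s e)))
      - (\<Sum>e | e \<in> EE \<and> tgt e = v. s e * w e)"
      by (simp add: mult_def sum.distrib sum_subtractf sum_distrib_left sum_distrib_right algebra_simps)
    \<comment> \<open>The place where harmonicity enters, through \<open>mult_alt\<close>.\<close>
    also have "\<dots> = int (mult v) * (?le v + ?ge v) - (\<Sum>e | e \<in> EE \<and> tgt e = v. s e * w e)"
      by (simp only: mult_alt[OF v, symmetric]) (simp add: algebra_simps)
    also have "\<dots> = int (mult v) * (2 * int N + 1 + of_bool (\<rho> (p v) = \<rho> q)) - (\<Sum>e | e \<in> EE \<and> tgt e
      = v. s e * w e)"
      by (simp only: count_sum)
    also have "\<dots> = int (mult v) * of_bool (\<rho> (p v) = \<rho> q) +
      (int (mult v) * (2 * int N + 1) - (\<Sum>e | e \<in> EE \<and> tgt e = v. s e * w e))"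
      by (simp add: distrib_left)
    finally show "(\<Sum>e | e \<in> EE \<and> src e = v. ?c1 e v) + (\<Sum>e | e \<in> EE \<and> tgt e = v. ?c2 e v) =
      int (mult v) * of_bool (\<rho> (p v) = \<rho> q) + (int (mult v) * (2 * int N + 1) - (\<Sum>e | e \<in> EE \<and>
        tgt e = v. s e * w e))" .
  qed
  finally show ?thesis
    by (simp add: pullback_divisor_formula[OF assms] algebra_simps)
qed

definition degree :: int where "degree = (\<Sum>e\<in>EE. s e * w e)"

lemma sum_mult: "(\<Sum>v\<in>VV. int (mult v)) = (\<Sum>e\<in>EE. \<bar>s e\<bar>)"
proof -
  have "(\<Sum>v\<in>VV. int (mult v)) = (\<Sum>e\<in>EE. int (nat (s e))) + (\<Sum>e\<in>EE. int (nat (- s e)))"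
    using sum_by_vertex[of src "\<lambda>e v. int (nat (s e))"] sum_by_vertex[of tgt "\<lambda>e v. int (nat (- s e))"]
    by (simp add: mult_def sum.distrib)
  also have "\<dots> = (\<Sum>e\<in>EE. \<bar>s e\<bar>)"
    unfolding sum.distrib[symmetric] by (intro sum.cong) auto
  finally show ?thesis .
qed

text \<open>Compare degrees in \<open>clamped_eq\<close>: the terms with \<open>2 * N + 1\<close>
  cancel by \<open>sum_mult\<close>, and the winding terms of \<open>defect\<close> survive.\<close>

lemma frag_eval_pullback:
  "frag_eval (\<lambda>_. 1) (pullback_divisor \<Gamma> E \<phi> (frag_of (\<rho> q))) = degree"
proof -
  obtain N where N: "good N q" using ex_good by blast
  have "frag_eval (\<lambda>_. 1) (clamped N q) = (\<Sum>e\<in>EE. \<bar>s e\<bar> * (2 * int N + 1))"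
    by (simp add: clamped_def frag_eval_sum frag_eval_cmul algebra_simps)
  then have "frag_eval (\<lambda>_. 1) (clamped N q) = (\<Sum>e\<in>EE. \<bar>s e\<bar>) * (2 * int N + 1)"
    by (simp only: sum_distrib_right)
  moreover have "frag_eval (\<lambda>_. 1) (defect N) = (\<Sum>v\<in>VV. int (mult v)) * (2 * int N + 1) - degree"
    using sum_by_vertex[of tgt "\<lambda>e v. s e * w e"]
    by (simp add: defect_def frag_eval_sum frag_eval_cmul sum_subtractf sum_distrib_right degree_def)
  ultimately show ?thesis
    using clamped_eq[OF N] by (simp add: frag_eval_add sum_mult)
qed

lemma fibre_degree:
  assumes "Q \<in> points E"
  shows "int (\<Sum>P\<in>fibre \<Gamma> E \<phi> Q. local_deg \<Gamma> E \<phi> P) = degree"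
proof -
  obtain q where q: "Q = \<rho> q" using E.\<rho>_surj[OF assms] by blast
  have "int (\<Sum>P\<in>fibre \<Gamma> E \<phi> Q. local_deg \<Gamma> E \<phi> P) = frag_eval (\<lambda>_. 1) (pullback_divisor \<Gamma> E \<phi>
    (frag_of Q))"
    by (simp add: pullback_divisor_def frag_eval_sum frag_eval_cmul)
  then show ?thesis using frag_eval_pullback q by simp
qed

lemma has_degree:
  assumes "degree = int d"
  shows "has_degree \<Gamma> E \<phi> d"
  unfolding has_degree_def
proof
  fix Q assume "Q \<in> points E"
  then have "int (\<Sum>P\<in>fibre \<Gamma> E \<phi> Q. local_deg \<Gamma> E \<phi> P) = int d" using fibre_degree assms by simp
  then show "(\<Sum>P\<in>fibre \<Gamma> E \<phi> Q. local_deg \<Gamma> E \<phi> P) = d" by (simp only: of_nat_eq_iff)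
qed

lemma surj_of_degree:
  assumes "degree > 0"
  shows "\<phi> ` points \<Gamma> = points E"
proof (intro equalityI subsetI)
  fix Q assume "Q \<in> points E"
  then have "fibre \<Gamma> E \<phi> Q \<noteq> {}" using fibre_degree[of Q] assms by auto
  then show "Q \<in> \<phi> ` points \<Gamma>" by (auto simp: fibre_def)
qed (auto simp: \<phi>_points)

text \<open>The slope times the truncated coordinate is, up to sign and a constant, \<open>y\<close>
  truncated to the interval between the two lifted ends, i.e. a difference of two minima. The form
  with minima is the same for both signs of the slope, and for slope 0 the two ends
  coincide.\<close>

lemma clamp_diff:
  assumes "e \<in> EE"
  shows "of_int \<bar>s e\<bar> * (clamp e y' - clamp e y) =
    (min y' (p (tgt e) + of_int (w e) * l) - min y' (p (src e))) - (min y (p (tgt e) + of_int (w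
      e) * l) - min y (p (src e)))"
proof -
  let ?p = "p (src e)" and ?p' = "p (tgt e) + of_int (w e) * l"
  have p': "?p' = ?p + of_int (s e) * len \<Gamma> e" using winding[OF assms] by simp
  have L: "0 < len \<Gamma> e" using len_pos assms by simp
  consider "s e > 0" | "s e < 0" | "s e = 0" by linarith
  then show ?thesis
  proof cases
    case 1
    then have S: "0 < real_of_int (s e)" by simp
    have "of_int (s e) * clamp e y = min y ?p' - min y ?p" for y
    proof -
      have "of_int (s e) * clamp e y = max (of_int (s e) * 0) (min (of_int (s e) * len \<Gamma> e)
        (of_int (s e) * preim e y))"
        unfolding clamp_def using S by (simp add: max_mult_distrib_left min_mult_distrib_left)
      also have "of_int (s e) * preim e y = y - ?p" using S by (simp add: preim_def)
      finally show ?thesis using p' mult_pos_pos[OF S L] by (auto simp: min_def max_def)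
    qed
    then show ?thesis using 1 by (simp add: right_diff_distrib)
  next
    case 2
    then have S: "real_of_int (s e) < 0" by simp
    have "of_int (s e) * clamp e y = min y ?p - min y ?p' + of_int (s e) * len \<Gamma> e" for y
    proof -
      have "of_int (s e) * clamp e y = min (of_int (s e) * 0) (max (of_int (s e) * len \<Gamma> e)
        (of_int (s e) * preim e y))"
        unfolding clamp_def using S by (simp add: max_mult_distrib_left min_mult_distrib_left)
      also have "of_int (s e) * preim e y = y - ?p" using S by (simp add: preim_def)
      finally show ?thesis using p' mult_neg_pos[OF S L] by (auto simp: min_def max_def)
    qed
    then show ?thesis using 2 by (simp add: right_diff_distrib algebra_simps)
  next
    case 3
    then show ?thesis using p' by simp
  qed
qed

text \<open>The preimage of the path from \<open>\<rho> q\<close> to \<open>\<rho> q'\<close>: on each edge, every translate of the path is lifted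
  and clamped to the edge. By harmonicity the clamped ends do not contribute to the boundary.\<close>

definition pull_chain :: "nat \<Rightarrow> real \<Rightarrow> real \<Rightarrow> chain" where
  "pull_chain N q q' = (\<Sum>e\<in>EE. \<Sum>j\<in>J N. frag_cmul \<bar>s e\<bar> (frag_of (e, clamp e (q + of_int j * l),
    clamp e (q' + of_int j * l))))"

lemma pull_chain_in_chains: "pull_chain N q q' \<in> chains \<Gamma>"
  unfolding pull_chain_def chains_def
  by (intro sum_closed_free_Abelian_group) (auto simp: clamp_def len_pos less_imp_le)

lemma pull_chain_boundary: "chain_boundary \<Gamma> (pull_chain N q q') = clamped N q' - clamped N q"
  by (simp add: chain_boundary_def pull_chain_def clamped_def frag_extend_sum frag_extend_cmul
      frag_cmul_diff_right sum_subtractf)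

text \<open>On each edge the integral is a difference of sums of minima at the two lifted ends.
  \<open>sum_min_shift\<close> moves the end back to \<open>p (tgt e)\<close> at the cost of
  \<open>w e\<close> times \<open>q' - q\<close>; what is left is a coboundary, on which
  \<open>\<omega>\<close> vanishes.\<close>

lemma pull_chain_integral:
  assumes "good N q" "good N q'" "\<omega> \<in> balanced \<Gamma>"
  shows "chain_integral (pull_chain N q q') \<omega> = (q' - q) * of_int (\<Sum>e\<in>EE. \<omega> e * w e)"
proof -
  define S where "S q t = (\<Sum>j\<in>J N. min (q + of_int j * l) t)" for q t :: real
  let ?p' = "\<lambda>e. p (tgt e) + of_int (w e) * l"
  \<comment> \<open>The part of the shift that does not involve \<open>q\<close>, hence disappears
    in the difference.\<close>
  define K where "K e = (l * (of_int (w e) - of_int (w e) * of_int (w e)) / 2 + real N * of_int (w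
    e) * l - of_int (w e) * p (tgt e))" for e
  have sh: "S q (?p' e) = S q (p (tgt e)) + of_int (w e) * q + K e" if "good N q" "e \<in> EE" for q e
    unfolding S_def K_def using that by (intro sum_min_shift E.l_pos) (auto simp: good_def)
  define D where "D t = S q' t - S q t" for t
  have "chain_integral (pull_chain N q q') \<omega> =
    (\<Sum>e\<in>EE. \<Sum>j\<in>J N. of_int (\<omega> e) * (of_int \<bar>s e\<bar> * (clamp e (q' + of_int j * l) - clamp e (q +
      of_int j * l))))"
    by (simp add: pull_chain_def chain_integral_eq frag_eval_sum frag_eval_cmul algebra_simps)
  also have "\<dots> = (\<Sum>e\<in>EE. of_int (\<omega> e) * (\<Sum>j\<in>J N. of_int \<bar>s e\<bar> * (clamp e (q' + of_int j * l) -
    clamp e (q + of_int j * l))))"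
    by (simp only: sum_distrib_left)
  also have "\<dots> = (\<Sum>e\<in>EE. of_int (\<omega> e) * ((S q' (?p' e) - S q' (p (src e))) - (S q (?p' e) - S q (p
    (src e)))))"
    by (intro sum.cong refl) (simp only: clamp_diff sum_subtractf S_def)
  also have "\<dots> = (\<Sum>e\<in>EE. of_int (\<omega> e) * (D (p (tgt e)) - D (p (src e))) + (q' - q) * of_int (\<omega> e *
    w e))"
    by (intro sum.cong refl) (simp only: sh[OF assms(1)] sh[OF assms(2)] D_def, simp add: algebra_simps)
  also have "\<dots> = (q' - q) * of_int (\<Sum>e\<in>EE. \<omega> e * w e)"
    using balanced_sum_coboundary[OF assms(3), of "\<lambda>v. D (p v)"]
    by (simp add: sum.distrib sum_distrib_left)
  finally show ?thesis .
qed

lemma pullback_chain: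
  obtains \<gamma> where "\<gamma> \<in> chains \<Gamma>"
    "chain_boundary \<Gamma> \<gamma> = pullback_divisor \<Gamma> E \<phi> (frag_of (\<rho> q')) - pullback_divisor \<Gamma> E \<phi>
      (frag_of (\<rho> q))"
    "\<And>\<omega>. \<omega> \<in> balanced \<Gamma> \<Longrightarrow> chain_integral \<gamma> \<omega> = (q' - q) * of_int (\<Sum>e\<in>EE. \<omega> e * w e)"
proof -
  obtain N where N: "good N q" "good N q'" using ex_good by blast
  show ?thesis
  proof (rule that[of "pull_chain N q q'"])
    show "chain_boundary \<Gamma> (pull_chain N q q') =
      pullback_divisor \<Gamma> E \<phi> (frag_of (\<rho> q')) - pullback_divisor \<Gamma> E \<phi> (frag_of (\<rho> q))"
      by (simp add: pull_chain_boundary clamped_eq N)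
  qed (auto simp: pull_chain_in_chains pull_chain_integral N)
qed

end

section \<open>Models and the axioms of a tropical cover\<close>

context curve begin

lemma finite_arc_preimage:
  assumes "finite A"
  shows "finite {y. 0 \<le> y \<and> y \<le> len \<Gamma> e \<and> pt \<Gamma> e y \<in> A}"
proof (rule finite_subset)
  show "{y. 0 \<le> y \<and> y \<le> len \<Gamma> e \<and> pt \<Gamma> e y \<in> A} \<subseteq> {0, len \<Gamma> e} \<union> Inner e -` A"
    by (auto simp: pt_def split: if_splits)
  show "finite ({0, len \<Gamma> e} \<union> Inner e -` A)"
    using finite_vimageI[OF assms, of "Inner e"] by (simp add: inj_on_def)
qed

lemma model_edge_right:
  assumes A: "vertex_set \<Gamma> A" and e: "e \<in> EE" "0 \<le> x" "x < len \<Gamma> e"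
  obtains b c where "(e, b, c) \<in> model_edges \<Gamma> A" "b \<le> x" "x < c"
proof -
  let ?S = "{y. 0 \<le> y \<and> y \<le> len \<Gamma> e \<and> pt \<Gamma> e y \<in> A}"
  have fin: "finite ?S" using A by (intro finite_arc_preimage) (simp add: vertex_set_def)
  have V: "Vertex (src e) \<in> A" "Vertex (tgt e) \<in> A" using A e by (auto simp: vertex_set_def)
  let ?L = "{y \<in> ?S. y \<le> x}" and ?R = "{y \<in> ?S. x < y}"
  have L: "finite ?L" and R: "finite ?R" by (rule finite_subset[OF _ fin], blast)+
  have L0: "0 \<in> ?L" and R0: "len \<Gamma> e \<in> ?R" using V e by auto
  define b where "b = Max ?L"
  define c where "c = Min ?R"
  have b: "b \<in> ?L" unfolding b_def by (rule Max_in[OF L]) (use L0 in blast)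
  have c: "c \<in> ?R" unfolding c_def by (rule Min_in[OF R]) (use R0 in blast)
  have "pt \<Gamma> e y \<notin> A" if "b < y" "y < c" for y
  proof
    assume y: "pt \<Gamma> e y \<in> A"
    have "y \<in> ?S" using y b c that by auto
    then consider "y \<in> ?L" | "y \<in> ?R" by force
    then show False
    proof cases
      case 1 then show False using Max_ge[OF L 1] that b_def by simp
    next
      case 2 then show False using Min_le[OF R 2] that c_def by simp
    qed
  qed
  then have "(e, b, c) \<in> model_edges \<Gamma> A" using b c e by (auto simp: model_edges_def)
  then show ?thesis using b c by (intro that[of b c]) auto
qed

lemma model_edge_left:
  assumes A: "vertex_set \<Gamma> A" and e: "e \<in> EE" "0 < x" "x \<le> len \<Gamma> e"
  obtains b c where "(e, b, c) \<in> model_edges \<Gamma> A" "b < x" "x \<le> c"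
proof -
  let ?S = "{y. 0 \<le> y \<and> y \<le> len \<Gamma> e \<and> pt \<Gamma> e y \<in> A}"
  have fin: "finite ?S" using A by (intro finite_arc_preimage) (simp add: vertex_set_def)
  let ?L = "{y \<in> ?S. y < x}"
  have L: "finite ?L" by (rule finite_subset[OF _ fin], blast)
  have L0: "0 \<in> ?L" using A e by (auto simp: vertex_set_def)
  define b where "b = Max ?L"
  have b: "b \<in> ?L" unfolding b_def by (rule Max_in[OF L]) (use L0 in blast)
  then obtain b' c where m: "(e, b', c) \<in> model_edges \<Gamma> A" "b' \<le> b" "b < c"
    using model_edge_right[OF A e(1), of b] e by auto
  then have "pt \<Gamma> e c \<in> A" "c \<le> len \<Gamma> e" "b' = b"
    using b by (auto simp: model_edges_def less_le)
  moreover have "x \<le> c"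
  proof (rule ccontr)
    assume "\<not> x \<le> c"
    then have "c \<in> ?L" using calculation m b by auto
    then show False using Max_ge[OF L, of c] m b_def by simp
  qed
  ultimately show ?thesis using m b by (intro that[of b c]) auto
qed

lemma model_edge_around:
  assumes A: "vertex_set \<Gamma> A" and e: "e \<in> EE" "0 < x" "x < len \<Gamma> e" and x: "Inner e x \<notin> A"
  obtains b c where "(e, b, c) \<in> model_edges \<Gamma> A" "b < x" "x < c"
proof -
  obtain b c where m: "(e, b, c) \<in> model_edges \<Gamma> A" "b \<le> x" "x < c"
    using model_edge_right[OF A e(1), of x] e by auto
  then have "b \<noteq> x" using x e by (auto simp: model_edges_def pt_inner)
  then show ?thesis using m by (intro that[of b c]) auto
qed

end

context circle_map
begin

lemma finite_fibre:
  assumes "Q \<in> points E"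
  shows "finite (fibre \<Gamma> E \<phi> Q)"
proof -
  obtain q where q: "Q = \<rho> q" using E.\<rho>_surj assms by blast
  obtain N where "good N q" using ex_good by blast
  then show ?thesis unfolding q by (subst inner_fibre) auto
qed

definition cover_B :: "point set" where "cover_B = Vertex ` E.VV \<union> \<phi> ` Vertex ` VV"

text \<open>The whole of a contracted edge maps to a point of \<open>cover_B\<close>; the condition
  \<open>s e \<noteq> 0\<close> leaves its interior out and keeps the set finite.\<close>

definition cover_A :: "point set" where
  "cover_A = Vertex ` VV \<union> {Inner e x | e x. e \<in> EE \<and> 0 < x \<and> x < len \<Gamma> e \<and> s e \<noteq> 0 \<and> \<phi> (Inner e
    x) \<in> cover_B}"

lemma cover_B_vertex_set: "vertex_set E cover_B"
  using \<phi>_points by (auto simp: vertex_set_def cover_B_def points_def)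

lemma cover_A_vertex_set: "vertex_set \<Gamma> cover_A"
proof -
  have B: "finite cover_B" "cover_B \<subseteq> points E" using cover_B_vertex_set by (auto simp: vertex_set_def)
  have "cover_A \<subseteq> Vertex ` VV \<union> (\<Union>Q\<in>cover_B. fibre \<Gamma> E \<phi> Q)"
    by (auto simp: cover_A_def fibre_def local_deg_Inner points_def)
  moreover have "finite (Vertex ` VV \<union> (\<Union>Q\<in>cover_B. fibre \<Gamma> E \<phi> Q))"
    using B finite_fibre by auto
  ultimately have "finite cover_A" by (rule finite_subset)
  then show ?thesis by (auto simp: vertex_set_def cover_A_def points_def)
qed

lemma \<phi>_cover_A: "\<phi> ` cover_A \<subseteq> cover_B"
  by (auto simp: cover_A_def cover_B_def)

text \<open>The interior of a model edge cannot run over a vertex of E, for the point doing so would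
  belong to \<open>cover_A\<close>. So the image stays on the edge \<open>e'\<close> on which it
  starts.\<close>

lemma model_edge_image:
  assumes me: "(e, b, c) \<in> model_edges \<Gamma> cover_A" and se: "s e \<noteq> 0"
  obtains e' d where "e' \<in> E.EE"
    "\<And>x. b \<le> x \<Longrightarrow> x \<le> c \<Longrightarrow> 0 \<le> d + of_int (\<sigma> e' * s e) * x"
    "\<And>x. b \<le> x \<Longrightarrow> x \<le> c \<Longrightarrow> d + of_int (\<sigma> e' * s e) * x \<le> len E e'"
    "\<And>x. b \<le> x \<Longrightarrow> x \<le> c \<Longrightarrow> \<phi> (pt \<Gamma> e x) = pt E e' (d + of_int (\<sigma> e' * s e) * x)"
    "\<And>x. b < x \<Longrightarrow> x < c \<Longrightarrow> 0 < d + of_int (\<sigma> e' * s e) * x"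
    "\<And>x. b < x \<Longrightarrow> x < c \<Longrightarrow> d + of_int (\<sigma> e' * s e) * x < len E e'"
proof -
  have m: "e \<in> EE" "0 \<le> b" "b < c" "c \<le> len \<Gamma> e" "\<And>x. b < x \<Longrightarrow> x < c \<Longrightarrow> pt \<Gamma> e x \<notin> cover_A"
    using me by (auto simp: model_edges_def)
  define \<tau> where "\<tau> = sgn (s e)"
  have \<tau>: "\<tau> = 1 \<or> \<tau> = -1" using se by (auto simp: \<tau>_def sgn_if)
  have \<tau>s: "\<tau> * \<bar>s e\<bar> = s e" by (simp add: \<tau>_def abs_sgn mult.commute)
  define y where "y = p (src e) + of_int (s e) * b"
  obtain e' x' \<tau>' where d: "(e', x', \<tau>') \<in> directions E (\<rho> y)" "of_int (\<sigma> e') * \<tau>' = of_int \<tau>"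
    using E.direction_exists[OF \<tau>] by metis
  have d': "e' \<in> E.EE" "0 \<le> x'" "x' \<le> len E e'" "pt E e' x' = \<rho> y" "\<tau>' = 1 \<and> x' < len E e' \<or> \<tau>' =
    -1 \<and> 0 < x'"
    using d by (auto simp: directions_def)
  have "\<tau>' = of_int (\<sigma> e') * (of_int (\<sigma> e') * \<tau>')" by (simp only: E.\<sigma>_square_real[OF d'(1)])
  then have \<tau>': "\<tau>' = of_int (\<sigma> e' * \<tau>)" unfolding d(2) by simp
  \<comment> \<open>The distance from the image of the initial point to the end of \<open>e'\<close>
    in the direction of travel.\<close>
  define R where "R = (if \<tau>' = 1 then len E e' - x' else x')"
  have R: "0 < R" using d' by (auto simp: R_def)
  have Rend: "pt E e' (x' + \<tau>' * R) \<in> Vertex ` E.VV"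
    using d' by (auto simp: R_def)
  have along: "pt E e' (x' + \<tau>' * \<eta>) = \<rho> (y + of_int \<tau> * \<eta>)" if "0 \<le> \<eta>" "\<eta> \<le> R" for \<eta>
  proof -
    have "\<rho> y = \<rho> (a e' + of_int (\<sigma> e') * x')" using E.pt_\<rho>[OF d'(1-3)] d'(4) by simp
    then obtain n :: int where n: "y - (a e' + of_int (\<sigma> e') * x') = of_int n * l" by (auto simp:
      E.\<rho>_eq)
    have "pt E e' (x' + \<tau>' * \<eta>) = \<rho> (a e' + of_int (\<sigma> e') * (x' + \<tau>' * \<eta>))"
      using d' that by (intro E.pt_\<rho>) (auto simp: R_def split: if_splits)
    also have "a e' + of_int (\<sigma> e') * (x' + \<tau>' * \<eta>) = a e' + of_int (\<sigma> e') * x' + (of_int (\<sigma> e') *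
      \<tau>') * \<eta>"
      by (simp add: algebra_simps)
    also have "\<dots> = y + of_int \<tau> * \<eta> + of_int (- n) * l" unfolding d(2) using n by simp
    finally show ?thesis unfolding E.\<rho>_add_period .
  qed
  define A' where "A' = real_of_int \<bar>s e\<bar>"
  have A': "A' > 0" using se by (simp add: A'_def)
  have \<tau>A: "of_int \<tau> * A' = of_int (s e)" unfolding A'_def of_int_mult[symmetric] \<tau>s ..
  have \<phi>x: "\<phi> (pt \<Gamma> e x) = pt E e' (x' + \<tau>' * (A' * (x - b)))" if "b \<le> x" "x \<le> c" "A' * (x - b) \<le>
    R" for x
  proof -
    have "\<phi> (pt \<Gamma> e x) = \<rho> (p (src e) + of_int (s e) * x)" using m that by (intro \<phi>_pt) auto
    also have "p (src e) + of_int (s e) * x = y + of_int \<tau> * (A' * (x - b))"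
      unfolding mult.assoc[symmetric] \<tau>A by (simp add: y_def algebra_simps)
    also have "\<rho> \<dots> = pt E e' (x' + \<tau>' * (A' * (x - b)))"
      using that A' by (intro along[symmetric]) auto
    finally show ?thesis .
  qed
  \<comment> \<open>Otherwise the point at distance \<open>R / A'\<close> from the initial point is
    mapped to a vertex of E while lying strictly inside the model edge.\<close>
  have "A' * (c - b) \<le> R"
  proof (rule ccontr)
    assume "\<not> A' * (c - b) \<le> R"
    then have lt: "R / A' < c - b" using A' by (simp add: pos_divide_less_eq mult.commute)
    define x where "x = b + R / A'"
    have x: "b < x" "x < c" using lt R A' by (auto simp: x_def)
    have xR: "A' * (x - b) = R" using A' by (simp add: x_def)
    have "\<phi> (pt \<Gamma> e x) \<in> cover_B" using \<phi>x[of x] x xR Rend by (auto simp: cover_B_def)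
    moreover have "pt \<Gamma> e x = Inner e x" using x m by (intro pt_inner) auto
    ultimately have "pt \<Gamma> e x \<in> cover_A" using x m se by (auto simp: cover_A_def)
    then show False using m(5) x by blast
  qed
  have le: "A' * (x - b) \<le> R" if "x \<le> c" for x
  proof -
    have "A' * (x - b) \<le> A' * (c - b)" using A' that by (intro mult_left_mono) auto
    then show ?thesis using \<open>A' * (c - b) \<le> R\<close> by linarith
  qed
  have lt: "A' * (x - b) < R" if "x < c" for x
  proof -
    have "A' * (x - b) < A' * (c - b)" using A' that by (intro mult_strict_left_mono) auto
    then show ?thesis using \<open>A' * (c - b) \<le> R\<close> by linarith
  qed
  have eq: "x' - of_int (\<sigma> e' * s e) * b + of_int (\<sigma> e' * s e) * x = x' + \<tau>' * (A' * (x - b))" for x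
  proof -
    have "\<tau>' * A' = of_int (\<sigma> e' * s e)" unfolding \<tau>' using \<tau>A by (simp add: mult.assoc)
    then have "\<tau>' * (A' * (x - b)) = of_int (\<sigma> e' * s e) * (x - b)" by (simp only:
      mult.assoc[symmetric])
    then show ?thesis by (simp add: right_diff_distrib)
  qed
  show ?thesis
  proof (rule that[of e' "x' - of_int (\<sigma> e' * s e) * b"])
    fix x assume x: "b \<le> x" "x \<le> c"
    have "0 \<le> A' * (x - b)" using A' x by simp
    then show "0 \<le> x' - of_int (\<sigma> e' * s e) * b + of_int (\<sigma> e' * s e) * x"
      "x' - of_int (\<sigma> e' * s e) * b + of_int (\<sigma> e' * s e) * x \<le> len E e'"
      unfolding eq using le[OF x(2)] d' by (auto simp: R_def split: if_splits)
    show "\<phi> (pt \<Gamma> e x) = pt E e' (x' - of_int (\<sigma> e' * s e) * b + of_int (\<sigma> e' * s e) * x)"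
      unfolding eq using \<phi>x le x by simp
  next
    fix x assume x: "b < x" "x < c"
    have "0 < A' * (x - b)" using A' x by simp
    then show "0 < x' - of_int (\<sigma> e' * s e) * b + of_int (\<sigma> e' * s e) * x"
      "x' - of_int (\<sigma> e' * s e) * b + of_int (\<sigma> e' * s e) * x < len E e'"
      unfolding eq using lt[OF x(2)] d' by (auto simp: R_def split: if_splits)
  qed (rule d'(1))
qed

text \<open>In the quotient topology it suffices to look at each closed edge, where the map is
  \<open>\<rho>\<close> composed with an affine function.\<close>

lemma continuous: "continuous_map (realization \<Gamma>) (realization E) \<phi>"
proof -
  have ts: "topspace (realization C) = points C" if "curve C" for C
  proof -
    interpret C: curve C by fact
    have "openin (realization C) (points C)"
      unfolding openin_realization
    proof (intro conjI ballI)
      fix e assume "e \<in> arcs (graph C)"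
      then have "{x \<in> {0..len C e}. pt C e x \<in> points C} = {0..len C e}" using C.pt_in_points by auto
      then show "openin (top_of_set {0..len C e}) {x \<in> {0..len C e}. pt C e x \<in> points C}" by simp
    qed simp
    moreover have "U \<subseteq> points C" if "openin (realization C) U" for U
      using that by (simp add: openin_realization)
    ultimately show ?thesis by (metis openin_topspace openin_subset subset_antisym)
  qed
  have c: "curve \<Gamma>" "curve E" by unfold_locales
  show ?thesis
    unfolding continuous_map_alt
  proof (intro conjI allI impI)
    show "\<phi> \<in> topspace (realization \<Gamma>) \<rightarrow> topspace (realization E)"
      using \<phi>_points by (auto simp: ts c)
    fix U assume U: "openin (realization E) U"
    show "openin (realization \<Gamma>) (\<phi> -` U \<inter> topspace (realization \<Gamma>))"
      unfolding openin_realization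
    proof (intro conjI ballI)
      show "\<phi> -` U \<inter> topspace (realization \<Gamma>) \<subseteq> points \<Gamma>" by (simp add: ts c)
      fix e assume e: "e \<in> EE"
      have "{x \<in> {0..len \<Gamma> e}. pt \<Gamma> e x \<in> \<phi> -` U \<inter> topspace (realization \<Gamma>)} =
        {0..len \<Gamma> e} \<inter> (\<lambda>x. p (src e) + of_int (s e) * x) -` {t. \<rho> t \<in> U}"
        using e by (auto simp: ts c pt_in_points \<phi>_pt)
      moreover have "open ((\<lambda>x. p (src e) + of_int (s e) * x) -` {t. \<rho> t \<in> U})"
        by (intro open_vimage E.open_\<rho>_vimage U continuous_intros)
      ultimately show "openin (top_of_set {0..len \<Gamma> e}) {x \<in> {0..len \<Gamma> e}. pt \<Gamma> e x \<in> \<phi> -` U \<inter>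
        topspace (realization \<Gamma>)}"
        by (auto simp: openin_open)
    qed
  qed
qed

lemma preimage_open_edge:
  assumes J: "K \<in> open_edges E cover_B"
  shows "\<exists>\<I>\<subseteq>open_edges \<Gamma> cover_A. {P \<in> points \<Gamma>. \<phi> P \<in> K} = \<Union>\<I>"
proof -
  obtain e1 a1 b1 where K: "K = pt E e1 ` {a1<..<b1}" and m1: "(e1, a1, b1) \<in> model_edges E cover_B"
    using J by (auto simp: open_edges_def)
  have m1': "e1 \<in> E.EE" "0 \<le> a1" "a1 < b1" "b1 \<le> len E e1" "pt E e1 a1 \<in> cover_B" "pt E e1 b1 \<in> cover_B"
    "\<And>x. a1 < x \<Longrightarrow> x < b1 \<Longrightarrow> pt E e1 x \<notin> cover_B"
    using m1 by (auto simp: model_edges_def)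
  have KB: "Q \<notin> cover_B" if "Q \<in> K" for Q using that m1' by (auto simp: K)
  let ?I = "{I \<in> open_edges \<Gamma> cover_A. I \<subseteq> {P \<in> points \<Gamma>. \<phi> P \<in> K}}"
  have "P \<in> \<Union>?I" if P: "P \<in> points \<Gamma>" "\<phi> P \<in> K" for P
    using P(1)
  proof (cases rule: points_cases)
    case (1 v)
    then show ?thesis using KB[OF P(2)] by (auto simp: cover_B_def)
  next
    case (2 e x)
    \<comment> \<open>A contracted edge goes to the image of its tail, a point of
      \<open>cover_B\<close>, and thus misses \<open>K\<close>.\<close>
    have se: "s e \<noteq> 0"
    proof
      assume "s e = 0"
      then have "\<phi> P = \<phi> (Vertex (src e))" using 2 by (simp add: \<phi>_Inner \<phi>_Vertex)
      then show False using KB[OF P(2)] 2 by (auto simp: cover_B_def)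
    qed
    have "Inner e x \<notin> cover_A" using KB[OF P(2)] 2 \<phi>_cover_A by auto
    then obtain b c where bc: "(e, b, c) \<in> model_edges \<Gamma> cover_A" "b < x" "x < c"
      using model_edge_around[OF cover_A_vertex_set] 2 by blast
    then have m: "0 \<le> b" "c \<le> len \<Gamma> e" "\<And>x. b < x \<Longrightarrow> x < c \<Longrightarrow> pt \<Gamma> e x \<notin> cover_A" by (auto simp:
      model_edges_def)
    obtain e' d where e': "e' \<in> E.EE"
      "\<And>x. b \<le> x \<Longrightarrow> x \<le> c \<Longrightarrow> \<phi> (pt \<Gamma> e x) = pt E e' (d + of_int (\<sigma> e' * s e) * x)"
      "\<And>x. b < x \<Longrightarrow> x < c \<Longrightarrow> 0 < d + of_int (\<sigma> e' * s e) * x"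
      "\<And>x. b < x \<Longrightarrow> x < c \<Longrightarrow> d + of_int (\<sigma> e' * s e) * x < len E e'"
      using model_edge_image[OF bc(1) se] by metis
    define k where "k = real_of_int (\<sigma> e' * s e)"
    have k: "k \<noteq> 0" using se E.\<sigma>_arc[OF e'(1)] by (auto simp: k_def)
    have eq: "\<phi> (Inner e z) = Inner e' (d + k * z)" if "b < z" "z < c" for z
      using e'(2)[of z] e'(3)[of z] e'(4)[of z] that m pt_inner[of z e] E.pt_inner[of _ e'] by
        (auto simp: k_def)
    obtain x1 where x1: "a1 < x1" "x1 < b1" "\<phi> P = pt E e1 x1" using P(2) by (auto simp: K)
    then have "Inner e' (d + k * x) = Inner e1 x1" using eq[of x] bc 2 m1' E.pt_inner[of x1 e1] by auto
    then have ee: "e' = e1" "d + k * x = x1" by auto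
    have noB: "d + k * z \<noteq> y" if "b < z" "z < c" "pt E e1 y \<in> cover_B" for z y
    proof
      assume y: "d + k * z = y"
      have "\<phi> (Inner e z) = pt E e1 y" using eq[OF that(1,2)] e'(3)[OF that(1,2)] e'(4)[OF
        that(1,2)] E.pt_inner[of y e1] y ee
        by (auto simp: k_def)
      then have "Inner e z \<in> cover_A" using that 2 m se by (auto simp: cover_A_def)
      then show False using m(3)[OF that(1,2)] pt_inner[of z e] that m by auto
    qed
    \<comment> \<open>The image of the model edge moves monotonically. To leave the interval
      \<open>(a1, b1)\<close> it would have to pass through an end, i.e. through a point of
      \<open>cover_B\<close>, inside the model edge.\<close>
    have in1: "a1 < d + k * z \<and> d + k * z < b1" if z: "b < z" "z < c" for z
    proof (rule ccontr)
      assume "\<not> (a1 < d + k * z \<and> d + k * z < b1)"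
      then have "d + k * z \<le> a1 \<and> a1 \<le> d + k * x \<or> d + k * x \<le> b1 \<and> b1 \<le> d + k * z"
        using x1 ee by linarith
      then obtain y where y: "y = a1 \<or> y = b1" "(d + k * z \<le> y \<and> y \<le> d + k * x) \<or> (d + k * x \<le> y \<and>
        y \<le> d + k * z)"
        by blast
      define u where "u = (y - d) / k"
      have u: "d + k * u = y" using k by (simp add: u_def)
      have "(k * z \<le> k * u \<and> k * u \<le> k * x) \<or> (k * x \<le> k * u \<and> k * u \<le> k * z)"
        using y(2) u by auto
      then have "(z \<le> u \<and> u \<le> x) \<or> (x \<le> u \<and> u \<le> z)"
        using k by (auto simp: mult_le_cancel_left split: if_splits)
      then have "b < u" "u < c" using z bc by auto
      then show False using noB[of u y] u y(1) m1' by auto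
    qed
    have "pt \<Gamma> e ` {b<..<c} \<in> ?I"
    proof -
      have "pt \<Gamma> e ` {b<..<c} \<in> open_edges \<Gamma> cover_A" using bc by (auto simp: open_edges_def)
      moreover have "\<phi> (pt \<Gamma> e z) \<in> K" if "b < z" "z < c" for z
        using e'(2)[of z] in1[OF that] that ee by (auto simp: K k_def)
      ultimately show ?thesis using m 2 pt_in_points by auto
    qed
    moreover have "P \<in> pt \<Gamma> e ` {b<..<c}"
      using 2 bc by (auto simp: pt_inner intro!: image_eqI[of _ _ x])
    ultimately show ?thesis by blast
  qed
  then have "{P \<in> points \<Gamma>. \<phi> P \<in> K} = \<Union>?I" by auto
  then show ?thesis by (intro exI[of _ ?I]) auto
qed

lemma tropical_cover:
  assumes "\<phi> ` points \<Gamma> = points E"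
  shows "tropical_cover \<Gamma> E \<phi>"
proof -
  have aff: "affine_on_edge \<Gamma> E \<phi> j" if "j \<in> model_edges \<Gamma> cover_A" for j
  proof -
    obtain e b c where j: "j = (e, b, c)" by (cases j)
    have jm: "(e, b, c) \<in> model_edges \<Gamma> cover_A" using that by (simp add: j)
    show ?thesis
    proof (cases "s e = 0")
      case False
      obtain e' d where e': "e' \<in> E.EE"
        "\<And>x. b \<le> x \<Longrightarrow> x \<le> c \<Longrightarrow> 0 \<le> d + of_int (\<sigma> e' * s e) * x"
        "\<And>x. b \<le> x \<Longrightarrow> x \<le> c \<Longrightarrow> d + of_int (\<sigma> e' * s e) * x \<le> len E e'"
        "\<And>x. b \<le> x \<Longrightarrow> x \<le> c \<Longrightarrow> \<phi> (pt \<Gamma> e x) = pt E e' (d + of_int (\<sigma> e' * s e) * x)"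
        using model_edge_image[OF jm False] by metis
      show ?thesis
        unfolding j affine_on_edge_def prod.case
        by (rule bexI[OF _ e'(1)], rule exI[of _ "\<sigma> e' * s e"], rule exI[of _ d])
          (use e'(2-4) in simp)
    next
      \<comment> \<open>The image of a contracted edge is one point; any direction at it names an
        edge of E on which the map is affine with slope 0.\<close>
      case True
      have m: "e \<in> EE" "0 \<le> b" "c \<le> len \<Gamma> e" using that by (auto simp: model_edges_def j)
      obtain e' x' \<tau>' where d: "(e', x', \<tau>') \<in> directions E (\<rho> (p (src e)))"
        using E.direction_exists[of 1] by metis
      then have "e' \<in> E.EE" "0 \<le> x'" "x' \<le> len E e'" "pt E e' x' = \<rho> (p (src e))" by (auto simp:
        directions_def)
      moreover have "\<phi> (pt \<Gamma> e x) = \<rho> (p (src e))" if "b \<le> x" "x \<le> c" for x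
        using \<phi>_pt[of e x] m that True by simp
      ultimately show ?thesis
        unfolding j affine_on_edge_def
        by (auto intro!: bexI[of _ e'] exI[of _ "0::int"] exI[of _ x'])
    qed
  qed
  show ?thesis
    unfolding tropical_cover_def
    by (intro conjI exI[of _ cover_A] exI[of _ cover_B] continuous assms harmonic
        cover_A_vertex_set cover_B_vertex_set \<phi>_cover_A ballI preimage_open_edge aff)
qed

end

section \<open>Jacobians of elliptic curves and pull-back\<close>

lemma point_class_cong:
  "(\<And>x. x \<in> carrier (lattice \<Sigma>) \<Longrightarrow> h x = h' x) \<Longrightarrow> point_class \<Sigma> h = point_class \<Sigma> h'"
proof -
  assume "\<And>x. x \<in> carrier (lattice \<Sigma>) \<Longrightarrow> h x = h' x"
  then have "restrict (\<lambda>x. h x + pairing \<Sigma> x y) (carrier (lattice \<Sigma>)) =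
    restrict (\<lambda>x. h' x + pairing \<Sigma> x y) (carrier (lattice \<Sigma>))" for y by auto
  then show ?thesis by (simp add: point_class_def)
qed

lemma frag_extend_frag_extend: "frag_extend f (frag_extend g D) = frag_extend (\<lambda>i. frag_extend f
  (g i)) D"
proof (rule frag_induction[of D UNIV])
  fix a b
  assume "frag_extend f (frag_extend g a) = frag_extend (\<lambda>i. frag_extend f (g i)) a"
    "frag_extend f (frag_extend g b) = frag_extend (\<lambda>i. frag_extend f (g i)) b"
  then show "frag_extend f (frag_extend g (a - b)) = frag_extend (\<lambda>i. frag_extend f (g i)) (a - b)"
    by (simp add: frag_extend_diff)
qed auto

lemma chain_integral_frag_extend:
  "chain_integral (frag_extend g D) \<omega> = frag_eval (\<lambda>Q. chain_integral (g Q) \<omega>) D"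
  by (simp add: chain_integral_eq frag_eval_frag_extend)

lemma frag_extend_diff_const:
  "frag_extend (\<lambda>Q. g Q - c) D = frag_extend g D - frag_cmul (frag_eval (\<lambda>_. 1) D) c"
proof (rule frag_induction[of D UNIV])
  fix a b
  assume "frag_extend (\<lambda>Q. g Q - c) a = frag_extend g a - frag_cmul (frag_eval (\<lambda>_. 1) a) c"
    "frag_extend (\<lambda>Q. g Q - c) b = frag_extend g b - frag_cmul (frag_eval (\<lambda>_. 1) b) c"
  then show "frag_extend (\<lambda>Q. g Q - c) (a - b) = frag_extend g (a - b) - frag_cmul (frag_eval (\<lambda>_.
    1) (a - b)) c"
    by (simp add: frag_extend_diff frag_eval_diff frag_cmul_diff_distrib)
qed auto

text \<open>A map that is affine on each edge with unrelated offsets \<open>c e\<close> is brought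
  to the normal form: vertices are lifted once and for all, offsets are corrected by periods, and
  the period missing at the head defines \<open>w\<close>.\<close>

lemma circle_map_intro:
  assumes "uniformized E l \<rho> a \<sigma>" "curve \<Gamma>" "s \<in> balanced \<Gamma>"
    and c: "\<And>e x. e \<in> arcs (graph \<Gamma>) \<Longrightarrow> 0 \<le> x \<Longrightarrow> x \<le> len \<Gamma> e \<Longrightarrow> f (pt \<Gamma> e x) = \<rho> (c e + of_int (s e) * x)"
    and V: "\<And>v. v \<in> verts (graph \<Gamma>) \<Longrightarrow> f (Vertex v) \<in> points E"
  obtains w p where "circle_map E l \<rho> a \<sigma> \<Gamma> f s w p"
proof -
  interpret E: uniformized E l \<rho> a \<sigma> by fact
  interpret curve \<Gamma> by fact
  define p where "p v = (SOME t. f (Vertex v) = \<rho> t)" for v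
  have p: "f (Vertex v) = \<rho> (p v)" if "v \<in> VV" for v
    unfolding p_def using E.\<rho>_surj[OF V[OF that]] by (rule someI_ex)
  have lift: "f (pt \<Gamma> e x) = \<rho> (p (src e) + of_int (s e) * x)" if e: "e \<in> EE" "0 \<le> x" "x \<le> len \<Gamma>
    e" for e x
  proof -
    have "\<rho> (c e) = \<rho> (p (src e))" using c[OF e(1), of 0] p[of "src e"] e by simp
    then obtain n :: int where n: "c e - p (src e) = of_int n * l" by (auto simp: E.\<rho>_eq)
    then have "c e + of_int (s e) * x = p (src e) + of_int (s e) * x + of_int n * l" by simp
    then show ?thesis unfolding c[OF e] by (simp only: E.\<rho>_add_period)
  qed
  have "\<exists>n::int. p (src e) + of_int (s e) * len \<Gamma> e - p (tgt e) = of_int n * l" if e: "e \<in> EE" for e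
    using lift[OF e, of "len \<Gamma> e"] p[of "tgt e"] e len_pos[OF e] by (simp add: E.\<rho>_eq[symmetric])
  then have "\<forall>e\<in>EE. \<exists>n::int. p (src e) + of_int (s e) * len \<Gamma> e - p (tgt e) = of_int n * l" by blast
  from bchoice[OF this] obtain w :: "nat \<Rightarrow> int"
    where w: "\<And>e. e \<in> EE \<Longrightarrow> p (src e) + of_int (s e) * len \<Gamma> e - p (tgt e) = of_int (w e) * l" by blast
  have "circle_map E l \<rho> a \<sigma> \<Gamma> f s w p"
  proof unfold_locales
    show "of_int (s e) * len \<Gamma> e = p (tgt e) - p (src e) + of_int (w e) * l" if "e \<in> EE" for e
      using w[OF that] by simp
  qed (use assms lift p in auto)
  then show ?thesis by (rule that)
qed

context uniformized
begin

text \<open>The identity is itself a map to E, with slopes \<open>\<sigma>\<close>. Thus the general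
  theory also yields the length, the paths and the Jacobian of E.\<close>

lemma identity_map: obtains w p where "circle_map E l \<rho> a \<sigma> E id \<sigma> w p"
  by (rule circle_map_intro[of E l \<rho> a \<sigma> E \<sigma> id a])
    (use pt_\<rho> \<sigma>_balanced in \<open>auto simp: points_def uniformized_axioms curve_axioms\<close>)

text \<open>At the midpoint of an edge the local degree is 1 and the fibre is a single point, so the
  degree is 1; constancy of the degree then gives local degree 1 at every point, including
  vertices.\<close>

lemma identity_map_degree:
  assumes "circle_map E l \<rho> a \<sigma> E id \<sigma> w p"
  shows "(\<Sum>e\<in>EE. \<sigma> e * w e) = 1"
    and "Q \<in> points E \<Longrightarrow> pullback_divisor E E id (frag_of Q) = frag_of Q"
proof -
  interpret I: circle_map E l \<rho> a \<sigma> E id \<sigma> w p by fact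
  obtain e where e: "e \<in> EE" using EE_nonempty by blast
  let ?Q = "Inner e (len E e / 2)"
  have Q: "?Q \<in> points E" "local_deg E E id ?Q = 1"
    using e len_pos[OF e] I.local_deg_Inner[OF e, of "len E e / 2"] pt_in_points[OF e, of "len E e / 2"]
    by (auto simp: pt_inner)
  have "fibre E E id ?Q = {?Q}" using Q by (auto simp: fibre_def)
  then have d1: "I.degree = 1" using I.fibre_degree[OF Q(1)] Q(2) by simp
  then show "(\<Sum>e\<in>EE. \<sigma> e * w e) = 1" by (simp add: I.degree_def)
  assume Q: "Q \<in> points E"
  have sub: "fibre E E id Q \<subseteq> {Q}" by (auto simp: fibre_def)
  then have "fibre E E id Q = {Q}" using I.fibre_degree[OF Q] d1 by (cases "fibre E E id Q = {}") auto
  moreover from this have "int (local_deg E E id Q) = 1" using I.fibre_degree[OF Q] d1 by simp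
  ultimately show "pullback_divisor E E id (frag_of Q) = frag_of Q"
    by (simp add: pullback_divisor_def)
qed

text \<open>The squares of \<open>\<sigma>\<close> turn the sum of lengths into lengths of lifts.
  The differences of lifts cancel, and the windings of the identity sum to its degree 1.\<close>

lemma total_length: "(\<Sum>e\<in>EE. len E e) = l"
proof -
  obtain w p where I: "circle_map E l \<rho> a \<sigma> E id \<sigma> w p" by (rule identity_map)
  interpret I: circle_map E l \<rho> a \<sigma> E id \<sigma> w p by (rule I)
  have "(\<Sum>e\<in>EE. len E e) = (\<Sum>e\<in>EE. of_int (\<sigma> e) * (of_int (\<sigma> e) * len E e))"
    by (intro sum.cong refl) (simp only: \<sigma>_square_real)
  also have "\<dots> = (\<Sum>e\<in>EE. of_int (\<sigma> e) * (p (tgt e) - p (src e)) + l * of_int (\<sigma> e * w e))"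
    by (intro sum.cong refl) (simp only: I.winding, simp add: algebra_simps)
  also have "\<dots> = l * of_int (\<Sum>e\<in>EE. \<sigma> e * w e)"
    using balanced_sum_coboundary[OF \<sigma>_balanced, of p] by (simp add: sum.distrib sum_distrib_left)
  finally show ?thesis by (simp add: identity_map_degree(1)[OF I])
qed

text \<open>The coordinate with respect to the generator \<open>\<sigma>\<close>, read off at an
  arbitrary arc; multiplying by \<open>\<sigma>\<close> divides by it, as its value there is 1 or
  -1.\<close>

definition coeff :: "(nat \<Rightarrow> int) \<Rightarrow> int" where
  "coeff c = c (SOME e. e \<in> EE) * \<sigma> (SOME e. e \<in> EE)"

lemma some_EE: "(SOME e. e \<in> EE) \<in> EE"
  using EE_nonempty by (simp add: some_in_eq)

lemma coeff_multiple [simp]: "coeff (\<lambda>e. n * \<sigma> e) = n"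
  using \<sigma>_square[OF some_EE] by (simp add: coeff_def mult.assoc)

lemma coeff_add: "coeff (\<lambda>e. c e + c' e) = coeff c + coeff c'"
  by (simp add: coeff_def algebra_simps)

lemma multiple_balanced [simp]: "(\<lambda>e. n * \<sigma> e) \<in> balanced E"
  using \<sigma>_balanced by (auto simp: balanced_def sum_distrib_left[symmetric])

end

locale elliptic = uniformized +
  assumes genus_1: "has_genus E 1"
begin

lemma coeff: "c \<in> balanced E \<Longrightarrow> c = (\<lambda>e. coeff c * \<sigma> e)"
  using balanced_multiple[OF genus_1] by (metis coeff_multiple)

lemma pairing_Jac:
  assumes "\<omega> \<in> balanced E" "c \<in> balanced E"
  shows "pairing (Jac E) \<omega> c = of_int (coeff \<omega>) * of_int (coeff c) * l"
proof -
  have "pairing (Jac E) \<omega> c = (\<Sum>e\<in>EE. of_int (coeff \<omega> * \<sigma> e) * of_int (coeff c * \<sigma> e) * len E e)"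
    using coeff[OF assms(1)] coeff[OF assms(2)] by (simp add: Jac_def) (metis (no_types, lifting)
      of_int_mult)
  also have "\<dots> = (\<Sum>e\<in>EE. of_int (coeff \<omega>) * of_int (coeff c) * (of_int (\<sigma> e) * (of_int (\<sigma> e) * len
    E e)))"
    by (simp add: algebra_simps)
  also have "\<dots> = (\<Sum>e\<in>EE. of_int (coeff \<omega>) * of_int (coeff c) * len E e)"
    by (intro sum.cong refl) (simp only: \<sigma>_square_real)
  finally show ?thesis by (simp add: sum_distrib_left[symmetric] total_length)
qed

interpretation J: integral_torus "Jac E" by (rule integral_torus_Jac)

lemma lattice_mult: "x \<otimes>\<^bsub>lattice (Jac E)\<^esub> y = (\<lambda>e. x e + y e)"
  by (simp add: Jac_def harmonic_forms_def)

text \<open>The homomorphism that sends the generator \<open>\<sigma>\<close> to \<open>r\<close>.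
  With \<open>carrier_points_scale\<close> and \<open>scale_eq_one_iff\<close> the points of the
  Jacobian are the reals modulo multiples of \<open>l\<close>.\<close>

definition scale :: "real \<Rightarrow> (nat \<Rightarrow> int) \<Rightarrow> real" where
  "scale r \<omega> = of_int (coeff \<omega>) * r"

lemma additive_scale: "additive_on (lattice (Jac E)) (scale r)"
  by (simp add: additive_on_def lattice_mult scale_def coeff_add algebra_simps)

lemma additive_eq_scale:
  assumes "additive_on (lattice (Jac E)) h" "\<omega> \<in> balanced E"
  shows "h \<omega> = scale (h \<sigma>) \<omega>"
proof -
  let ?f = "\<lambda>n::int. h (\<lambda>e. n * \<sigma> e)"
  have "?f (m + n) = ?f m + ?f n" for m n
  proof -
    have "h ((\<lambda>e. m * \<sigma> e) \<otimes>\<^bsub>lattice (Jac E)\<^esub> (\<lambda>e. n * \<sigma> e)) = ?f m + ?f n"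
      using assms(1) by (simp add: additive_on_def)
    then show ?thesis by (simp add: lattice_mult algebra_simps)
  qed
  from additive_int[of ?f, OF this, of "coeff \<omega>"] show ?thesis
    using coeff[OF assms(2)] by (simp add: scale_def)
qed

lemma carrier_points_scale: "carrier (torus_points (Jac E)) = range (\<lambda>r. point_class (Jac E) (scale r))"
proof -
  have "point_class (Jac E) h = point_class (Jac E) (scale (h \<sigma>))" if "additive_on (lattice (Jac
    E)) h" for h
    using additive_eq_scale[OF that] by (intro point_class_cong) simp
  then show ?thesis unfolding J.carrier_points using additive_scale by blast
qed

lemma scale_eq_one_iff: "point_class (Jac E) (scale r) = \<one>\<^bsub>torus_points (Jac E)\<^esub> \<longleftrightarrow> (\<exists>n::int. r =
  of_int n * l)"
  unfolding J.point_class_eq_one_iff carrier_Jac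
proof
  assume "\<exists>y\<in>balanced E. \<forall>x\<in>balanced E. scale r x = pairing (Jac E) x y"
  then obtain y where y: "y \<in> balanced E" "\<forall>x\<in>balanced E. scale r x = pairing (Jac E) x y" by blast
  have "scale r (\<lambda>e. 1 * \<sigma> e) = pairing (Jac E) (\<lambda>e. 1 * \<sigma> e) y" using y multiple_balanced by blast
  then have "r = of_int (coeff y) * l"
    using y(1) by (simp only: pairing_Jac multiple_balanced coeff_multiple scale_def)
  then show "\<exists>n::int. r = of_int n * l" by blast
next
  assume "\<exists>n::int. r = of_int n * l"
  then obtain n :: int where "r = of_int n * l" by blast
  then have "\<forall>x\<in>balanced E. scale r x = pairing (Jac E) x (\<lambda>e. n * \<sigma> e)"
    by (simp add: pairing_Jac scale_def)
  then show "\<exists>y\<in>balanced E. \<forall>x\<in>balanced E. scale r x = pairing (Jac E) x y"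
    using multiple_balanced by blast
qed

definition torsion_pt :: "nat \<Rightarrow> int \<Rightarrow> ((nat \<Rightarrow> int) \<Rightarrow> real) set" where
  "torsion_pt d n = point_class (Jac E) (scale (of_int n * l / real d))"

lemma torsion_pt_hom: "torsion_pt d \<in> hom integer_group (torus_points (Jac E))"
proof (rule homI)
  fix x y :: int
  show "torsion_pt d (x \<otimes>\<^bsub>integer_group\<^esub> y) = torsion_pt d x \<otimes>\<^bsub>torus_points (Jac E)\<^esub> torsion_pt d y"
    by (simp add: torsion_pt_def J.point_class_mult scale_def[abs_def] algebra_simps add_divide_distrib)
qed (auto simp: torsion_pt_def carrier_points_scale)

lemma torsion_pt_eq_one_iff:
  assumes "0 < d"
  shows "torsion_pt d n = \<one>\<^bsub>torus_points (Jac E)\<^esub> \<longleftrightarrow> int d dvd n"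
proof -
  have "of_int n * l / real d = of_int m * l \<longleftrightarrow> n = int d * m" for m
  proof -
    have "of_int n * l / real d = of_int m * l \<longleftrightarrow> real_of_int n * l = of_int (int d * m) * l"
      using assms by (simp add: field_simps)
    also have "\<dots> \<longleftrightarrow> n = int d * m" using l_pos by (simp only: mult_cancel_right of_int_eq_iff) auto
    finally show ?thesis .
  qed
  then show ?thesis unfolding torsion_pt_def scale_eq_one_iff by (auto simp: dvd_def)
qed

lemma torsion_group_eq:
  assumes "0 < d"
  shows "torsion_group (Jac E) d = (torus_points (Jac E))\<lparr>carrier := torsion_pt d ` carrier
    integer_group\<rparr>"
proof -
  have "{x \<in> carrier (torus_points (Jac E)). x [^]\<^bsub>torus_points (Jac E)\<^esub> d = \<one>\<^bsub>torus_points (Jac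
    E)\<^esub>} = range (torsion_pt d)"
  proof (intro equalityI subsetI)
    fix x assume x: "x \<in> {x \<in> carrier (torus_points (Jac E)). x [^]\<^bsub>torus_points (Jac E)\<^esub> d =
      \<one>\<^bsub>torus_points (Jac E)\<^esub>}"
    then obtain r where r: "x = point_class (Jac E) (scale r)" by (auto simp: carrier_points_scale)
    have "point_class (Jac E) (scale (real d * r)) = \<one>\<^bsub>torus_points (Jac E)\<^esub>"
      using x unfolding r by (simp add: J.point_class_pow scale_def[abs_def] algebra_simps)
    then obtain n :: int where "real d * r = of_int n * l" by (auto simp: scale_eq_one_iff)
    then have "r = of_int n * l / real d" using assms by (simp add: field_simps)
    then show "x \<in> range (torsion_pt d)" by (auto simp: r torsion_pt_def)
  next
    fix x assume "x \<in> range (torsion_pt d)"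
    then obtain n where n: "x = torsion_pt d n" by auto
    have "x [^]\<^bsub>torus_points (Jac E)\<^esub> d = point_class (Jac E) (scale (of_int n * l))"
      using assms by (simp add: n torsion_pt_def J.point_class_pow scale_def[abs_def] algebra_simps)
    then show "x \<in> {x \<in> carrier (torus_points (Jac E)). x [^]\<^bsub>torus_points (Jac E)\<^esub> d =
      \<one>\<^bsub>torus_points (Jac E)\<^esub>}"
      by (auto simp: n torsion_pt_def carrier_points_scale scale_eq_one_iff)
  qed
  then show ?thesis by (simp add: torsion_group_def)
qed

text \<open>Join every point of \<open>D\<close> to the base point \<open>\<rho> 0\<close> by the
  path between chosen lifts; since \<open>D\<close> has degree 0, the base point drops out of the
  boundary. The integral is the sum of the lifts, weighted by \<open>D\<close>.\<close>

lemma degree_zero_chain: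
  assumes D: "D \<in> degree_zero_divisors E"
  obtains q \<gamma> where "\<And>Q. Q \<in> points E \<Longrightarrow> Q = \<rho> (q Q)" "\<gamma> \<in> chains E" "chain_boundary E \<gamma> = D"
    "\<And>n. chain_integral \<gamma> (\<lambda>e. n * \<sigma> e) = of_int n * frag_eval q D"
proof -
  have D': "Poly_Mapping.keys D \<subseteq> points E" "frag_eval (\<lambda>_. 1) D = (0::int)"
    using D by (auto simp: degree_zero_divisors_def frag_eval_def)
  obtain w p where I: "circle_map E l \<rho> a \<sigma> E id \<sigma> w p" by (rule identity_map)
  interpret I: circle_map E l \<rho> a \<sigma> E id \<sigma> w p by (rule I)
  define q where "q Q = (SOME t. Q = \<rho> t)" for Q
  have q: "Q = \<rho> (q Q)" if "Q \<in> points E" for Q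
    unfolding q_def using \<rho>_surj[OF that] by (rule someI_ex)
  have "\<exists>\<gamma>. \<gamma> \<in> chains E \<and> chain_boundary E \<gamma> = frag_of (\<rho> t) - frag_of (\<rho> 0) \<and>
    (\<forall>n. chain_integral \<gamma> (\<lambda>e. n * \<sigma> e) = of_int n * t)" for t
  proof -
    obtain \<gamma> where g: "\<gamma> \<in> chains E"
      "chain_boundary E \<gamma> = pullback_divisor E E id (frag_of (\<rho> t)) - pullback_divisor E E id
        (frag_of (\<rho> 0))"
      "\<And>\<omega>. \<omega> \<in> balanced E \<Longrightarrow> chain_integral \<gamma> \<omega> = (t - 0) * of_int (\<Sum>e\<in>EE. \<omega> e * w e)"
      using I.pullback_chain by blast
    have "chain_integral \<gamma> (\<lambda>e. n * \<sigma> e) = of_int n * t" for n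
    proof -
      have "(\<Sum>e\<in>EE. n * \<sigma> e * w e) = n * (\<Sum>e\<in>EE. \<sigma> e * w e)" by (simp add: sum_distrib_left mult.assoc)
      then have "(\<Sum>e\<in>EE. n * \<sigma> e * w e) = n" by (simp add: identity_map_degree(1)[OF I])
      then show ?thesis unfolding g(3)[OF multiple_balanced] by simp
    qed
    then show ?thesis using g identity_map_degree(2)[OF I] by auto
  qed
  then obtain g where g: "\<And>t. g t \<in> chains E" "\<And>t. chain_boundary E (g t) = frag_of (\<rho> t) -
    frag_of (\<rho> 0)"
    "\<And>t n. chain_integral (g t) (\<lambda>e. n * \<sigma> e) = of_int n * t" by metis
  \<comment> \<open>The lifts \<open>q\<close> are returned together with the chain because the
    pull-back has to use the same ones.\<close>
  define \<gamma> where "\<gamma> = frag_extend (\<lambda>Q. g (q Q)) D"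
  have "\<gamma> \<in> chains E"
    using g(1) keys_frag_extend[of "\<lambda>Q. g (q Q)" D] unfolding \<gamma>_def chains_def
      carrier_free_Abelian_group_iff by blast
  moreover have "chain_boundary E \<gamma> = D"
  proof -
    have "chain_boundary E \<gamma> = frag_extend (\<lambda>Q. chain_boundary E (g (q Q))) D"
      unfolding \<gamma>_def chain_boundary_def by (simp add: frag_extend_frag_extend)
    also have "\<dots> = frag_extend (\<lambda>Q. frag_of Q - frag_of (\<rho> 0)) D"
      using D'(1) q g(2) by (intro frag_extend_eq) (metis subsetD)
    finally show ?thesis using D'(2) frag_expansion[of D] by (simp add: frag_extend_diff_const)
  qed
  moreover have "chain_integral \<gamma> (\<lambda>e. n * \<sigma> e) = of_int n * frag_eval q D" for n
    unfolding \<gamma>_def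
    by (simp add: chain_integral_frag_extend g(3) frag_eval_mult)
  ultimately show ?thesis using q that by blast
qed

end

locale elliptic_map = circle_map + E: elliptic E l \<rho> a \<sigma>
begin

definition pull_form :: "(nat \<Rightarrow> int) \<Rightarrow> int" where
  "pull_form \<omega> = (\<Sum>e\<in>EE. \<omega> e * w e)"

text \<open>Read as a cycle, \<open>\<omega>\<close> is wrapped \<open>pull_form \<omega>\<close>
  times around E; in the other direction, the fundamental cycle \<open>\<sigma>\<close> is pulled
  back to its preimage weighted with the slopes, which is \<open>s\<close>.\<close>

definition pull :: "((nat \<Rightarrow> int) \<Rightarrow> (nat \<Rightarrow> int)) \<times> ((nat \<Rightarrow> int) \<Rightarrow> (nat \<Rightarrow> int))" where
  "pull = (\<lambda>\<omega> e. pull_form \<omega> * \<sigma> e, \<lambda>c e. E.coeff c * s e)"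

lemma pull_form_add: "pull_form (\<lambda>e. \<omega> e + \<eta> e) = pull_form \<omega> + pull_form \<eta>"
  by (simp add: pull_form_def algebra_simps sum.distrib)

text \<open>Replace slope times length by the winding relation: the lifts of vertices form a
  coboundary and vanish against \<open>\<omega>\<close>. This is the adjointness of the two halves
  of \<open>pull\<close>.\<close>

lemma pairing_s:
  assumes "\<omega> \<in> balanced \<Gamma>"
  shows "pairing (Jac \<Gamma>) \<omega> (\<lambda>e. n * s e) = of_int (pull_form \<omega>) * of_int n * l"
proof -
  have "pairing (Jac \<Gamma>) \<omega> (\<lambda>e. n * s e) = (\<Sum>e\<in>EE. of_int n * (of_int (\<omega> e) * (of_int (s e) * len \<Gamma> e)))"
    by (simp add: Jac_def algebra_simps)
  also have "\<dots> = (\<Sum>e\<in>EE. of_int n * (of_int (\<omega> e) * (p (tgt e) - p (src e))) + of_int n * l *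
    of_int (\<omega> e * w e))"
    by (intro sum.cong refl) (simp only: winding, simp add: algebra_simps)
  also have "\<dots> = of_int n * (\<Sum>e\<in>EE. of_int (\<omega> e) * (p (tgt e) - p (src e))) + of_int n * l *
    of_int (pull_form \<omega>)"
    by (simp only: sum.distrib sum_distrib_left[symmetric] pull_form_def of_int_sum)
  finally show ?thesis using balanced_sum_coboundary[OF assms, of p] by simp
qed

lemma multiple_s_balanced: "(\<lambda>e. n * s e) \<in> balanced \<Gamma>"
  using s_balanced by (auto simp: balanced_def sum_distrib_left[symmetric])

lemma pull_morphism: "torus_morphism (Jac E) (Jac \<Gamma>) pull"
  unfolding torus_morphism_def pull_def prod.case
proof (intro conjI ballI)
  show "(\<lambda>\<omega> e. pull_form \<omega> * \<sigma> e) \<in> hom (lattice (Jac \<Gamma>)) (lattice (Jac E))"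
    by (auto simp: hom_def pull_form_add Jac_def harmonic_forms_def distrib_right)
  show "(\<lambda>c e. E.coeff c * s e) \<in> hom (colattice (Jac E)) (colattice (Jac \<Gamma>))"
    using multiple_s_balanced by (auto simp: hom_def E.coeff_add Jac_def H1_def distrib_right)
  fix \<omega> c assume "\<omega> \<in> carrier (lattice (Jac \<Gamma>))" "c \<in> carrier (colattice (Jac E))"
  then show "pairing (Jac E) (\<lambda>e. pull_form \<omega> * \<sigma> e) c = pairing (Jac \<Gamma>) \<omega> (\<lambda>e. E.coeff c * s e)"
    by (simp add: pairing_s E.pairing_Jac)
qed

text \<open>Lift the paths chosen for \<open>D\<close> by \<open>pullback_chain\<close> and add them
  up. Both sides then integrate \<open>\<omega>\<close> to \<open>pull_form \<omega>\<close> times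
  the same weighted sum of lifts.\<close>

lemma pullback_morphism_pull: "pullback_morphism \<Gamma> E \<phi> pull"
  unfolding pullback_morphism_def
proof (intro conjI ballI pull_morphism)
  fix D assume D: "D \<in> degree_zero_divisors E"
  have D': "Poly_Mapping.keys D \<subseteq> points E" "frag_eval (\<lambda>_. 1) D = (0::int)"
    using D by (auto simp: degree_zero_divisors_def frag_eval_def)
  obtain q \<gamma> where q: "\<And>Q. Q \<in> points E \<Longrightarrow> Q = \<rho> (q Q)" and \<gamma>: "\<gamma> \<in> chains E" "chain_boundary E \<gamma> = D"
    "\<And>n. chain_integral \<gamma> (\<lambda>e. n * \<sigma> e) = of_int n * frag_eval q D"
    using E.degree_zero_chain[OF D] by metis
  let ?PB = "\<lambda>Q. pullback_divisor \<Gamma> E \<phi> (frag_of Q)"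
  have "\<exists>\<gamma>. \<gamma> \<in> chains \<Gamma> \<and> chain_boundary \<Gamma> \<gamma> = ?PB (\<rho> t) - ?PB (\<rho> 0) \<and>
    (\<forall>\<omega>\<in>balanced \<Gamma>. chain_integral \<gamma> \<omega> = of_int (pull_form \<omega>) * t)" for t
    by (rule pullback_chain[of t 0]) (auto simp: pull_form_def mult.commute)
  then obtain g where g: "\<And>t. g t \<in> chains \<Gamma>" "\<And>t. chain_boundary \<Gamma> (g t) = ?PB (\<rho> t) - ?PB (\<rho> 0)"
    "\<And>t \<omega>. \<omega> \<in> balanced \<Gamma> \<Longrightarrow> chain_integral (g t) \<omega> = of_int (pull_form \<omega>) * t" by metis
  define \<delta> where "\<delta> = frag_extend (\<lambda>Q. g (q Q)) D"
  have \<delta>: "\<delta> \<in> chains \<Gamma>"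
    using g(1) keys_frag_extend[of "\<lambda>Q. g (q Q)" D] unfolding \<delta>_def chains_def
      carrier_free_Abelian_group_iff by blast
  have "chain_boundary \<Gamma> \<delta> = frag_extend (\<lambda>Q. chain_boundary \<Gamma> (g (q Q))) D"
    unfolding \<delta>_def chain_boundary_def by (simp add: frag_extend_frag_extend)
  also have "\<dots> = frag_extend (\<lambda>Q. ?PB Q - ?PB (\<rho> 0)) D"
    using D'(1) q g(2) by (intro frag_extend_eq) (metis subsetD)
  also have "\<dots> = frag_extend ?PB D"
    using D'(2) by (simp add: frag_extend_diff_const)
  also have "\<dots> = pullback_divisor \<Gamma> E \<phi> D"
    by (simp add: pullback_divisor_def)
  finally have bd: "chain_boundary \<Gamma> \<delta> = pullback_divisor \<Gamma> E \<phi> D" .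
  have int: "chain_integral \<delta> \<omega> = of_int (pull_form \<omega>) * frag_eval q D" if "\<omega> \<in> balanced \<Gamma>" for \<omega>
    unfolding \<delta>_def
    by (simp add: chain_integral_frag_extend g(3)[OF that] frag_eval_mult)
  have "abel_jacobi E D = point_class (Jac E) (chain_integral \<gamma>)"
    using E.abel_jacobi_boundary[OF \<gamma>(1)] \<gamma>(2) by simp
  then have "on_points (Jac E) (Jac \<Gamma>) pull (abel_jacobi E D) = point_class (Jac \<Gamma>)
    (chain_integral \<gamma> \<circ> fst pull)"
    using on_points_point_class[OF E.integral_torus_Jac integral_torus_Jac pull_morphism] by simp
  also have "\<dots> = point_class (Jac \<Gamma>) (chain_integral \<delta>)"
    using int by (intro point_class_cong) (simp add: pull_def \<gamma>(3))
  also have "\<dots> = abel_jacobi \<Gamma> (pullback_divisor \<Gamma> E \<phi> D)"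
    using abel_jacobi_boundary[OF \<delta>] bd by simp
  finally show "on_points (Jac E) (Jac \<Gamma>) pull (abel_jacobi E D) = abel_jacobi \<Gamma> (pullback_divisor
    \<Gamma> E \<phi> D)" .
qed

end

section \<open>The splitting isogeny\<close>

text \<open>In the coordinates \<open>M'.pull_form\<close> and \<open>M.pull_form\<close> the slope
  forms \<open>s'\<close> and \<open>s\<close> are (d, 0) and (0, d): they span a sublattice along
  the two axes. \<open>separating\<close> says that the coordinates are injective, and
  \<open>image\<close> describes their range.\<close>

locale splitting_pair =
  M': elliptic_map E' l' \<rho>' a' \<sigma>' \<Gamma> \<phi>' s' w' p' + M: elliptic_map E l \<rho> a \<sigma> \<Gamma> \<phi> s w p
  for E' l' \<rho>' a' \<sigma>' \<Gamma> \<phi>' s' w' p' E l \<rho> a \<sigma> \<phi> s w p +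
  fixes d :: nat
  assumes d_pos: "0 < d"
    and orthogonal: "M'.pull_form s' = int d" "M.pull_form s = int d" "M'.pull_form s = 0"
      "M.pull_form s' = 0"
    and separating: "\<And>\<omega>. \<omega> \<in> balanced \<Gamma> \<Longrightarrow> M'.pull_form \<omega> = 0 \<Longrightarrow> M.pull_form \<omega> = 0 \<Longrightarrow> \<omega> = (\<lambda>_. 0)"
    and image: "\<And>x y. (\<exists>\<omega>\<in>balanced \<Gamma>. M'.pull_form \<omega> = x \<and> M.pull_form \<omega> = y) \<longleftrightarrow> int d dvd x - y"
begin

abbreviation "\<Sigma> \<equiv> torus_sum (Jac E') (Jac E)"
abbreviation "T \<equiv> Jac \<Gamma>"

definition \<Phi> :: "((nat \<Rightarrow> int) \<Rightarrow> (nat \<Rightarrow> int) \<times> (nat \<Rightarrow> int)) \<times> ((nat \<Rightarrow> int) \<times> (nat \<Rightarrow> int) \<Rightarrow> (nat \<Rightarrow>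
  int))" where
  "\<Phi> = (\<lambda>\<omega>. (fst M'.pull \<omega>, fst M.pull \<omega>), \<lambda>(c', c) e. snd M'.pull c' e + snd M.pull c e)"

interpretation S: integral_torus \<Sigma>
  by (intro integral_torus_sum M'.E.integral_torus_Jac M.E.integral_torus_Jac)
interpretation T: integral_torus T by (rule M'.integral_torus_Jac)

lemma \<Phi>_fst: "fst \<Phi> \<omega> = (\<lambda>e. M'.pull_form \<omega> * \<sigma>' e, \<lambda>e. M.pull_form \<omega> * \<sigma> e)"
  by (simp add: \<Phi>_def M'.pull_def M.pull_def)

lemma carrier_sum [simp]:
  "carrier (lattice \<Sigma>) = balanced E' \<times> balanced E" "carrier (colattice \<Sigma>) = balanced E' \<times> balanced E"
  by (simp_all add: torus_sum_def)

lemma colattice_mult: "x \<otimes>\<^bsub>colattice T\<^esub> y = (\<lambda>e. x e + y e)"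
  by (simp add: Jac_def H1_def)

lemma pairing_sum: "pairing \<Sigma> (x, y) (x', y') = pairing (Jac E') x x' + pairing (Jac E) y y'"
  by (simp add: torus_sum_def)

lemma \<Phi>_morphism: "torus_morphism \<Sigma> T \<Phi>"
proof -
  obtain up' down' up down where f: "M'.pull = (up', down')" "M.pull = (up, down)" by (meson surj_pair)
  have m': "up' \<in> hom (lattice T) (lattice (Jac E'))" "down' \<in> hom (colattice (Jac E')) (colattice T)"
    "\<And>x y. x \<in> balanced \<Gamma> \<Longrightarrow> y \<in> balanced E' \<Longrightarrow> pairing (Jac E') (up' x) y = pairing T x (down' y)"
    using M'.pull_morphism by (auto simp: torus_morphism_def f)
  have m: "up \<in> hom (lattice T) (lattice (Jac E))" "down \<in> hom (colattice (Jac E)) (colattice T)"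
    "\<And>x y. x \<in> balanced \<Gamma> \<Longrightarrow> y \<in> balanced E \<Longrightarrow> pairing (Jac E) (up x) y = pairing T x (down y)"
    using M.pull_morphism by (auto simp: torus_morphism_def f)
  have down: "down' c' \<in> balanced \<Gamma>" "down c \<in> balanced \<Gamma>" if "c' \<in> balanced E'" "c \<in> balanced E"
    for c c'
    using m'(2) m(2) that by (auto simp: hom_def)
  interpret C: comm_group "colattice T" by (rule T.comm_group_colattice)
  have "pairing T x (\<lambda>e. down' c' e + down c e) = pairing T x (down' c') + pairing T x (down c)"
    if "x \<in> balanced \<Gamma>" "c' \<in> balanced E'" "c \<in> balanced E" for x c c'
    using T.pairing_right[of x "down' c'" "down c"] that down by (simp add: colattice_mult)
  moreover have "(\<lambda>x. (up' x, up x)) \<in> hom (lattice T) (lattice \<Sigma>)"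
    using m'(1) m(1) by (auto simp: hom_def torus_sum_def)
  moreover have "(\<lambda>(c', c) e. down' c' e + down c e) \<in> hom (colattice \<Sigma>) (colattice T)"
  proof (rule homI)
    fix x assume "x \<in> carrier (colattice \<Sigma>)"
    then show "(\<lambda>(c', c) e. down' c' e + down c e) x \<in> carrier (colattice T)"
      using down C.m_closed by (auto simp: colattice_mult)
  next
    fix x y assume "x \<in> carrier (colattice \<Sigma>)" "y \<in> carrier (colattice \<Sigma>)"
    then show "(\<lambda>(c', c) e. down' c' e + down c e) (x \<otimes>\<^bsub>colattice \<Sigma>\<^esub> y) =
      (\<lambda>(c', c) e. down' c' e + down c e) x \<otimes>\<^bsub>colattice T\<^esub> (\<lambda>(c', c) e. down' c' e + down c e) y"
      using m'(2) m(2) by (auto simp: hom_def torus_sum_def colattice_mult algebra_simps)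
  qed
  ultimately show ?thesis
    using m'(3) m(3) by (auto simp: torus_morphism_def \<Phi>_def f pairing_sum)
qed

lemma pull_form_diff:
  "M.pull_form (\<lambda>e. \<omega> e - \<eta> e) = M.pull_form \<omega> - M.pull_form \<eta>"
  "M'.pull_form (\<lambda>e. \<omega> e - \<eta> e) = M'.pull_form \<omega> - M'.pull_form \<eta>"
  by (simp_all add: M.pull_form_def M'.pull_form_def algebra_simps sum_subtractf)

lemma pull_form_mult:
  "M.pull_form (\<lambda>e. n * \<omega> e) = n * M.pull_form \<omega>" "M'.pull_form (\<lambda>e. n * \<omega> e) = n * M'.pull_form \<omega>"
  by (simp_all add: M.pull_form_def M'.pull_form_def sum_distrib_left mult.assoc)

lemma diff_balanced: "\<omega> \<in> balanced \<Gamma> \<Longrightarrow> \<eta> \<in> balanced \<Gamma> \<Longrightarrow> (\<lambda>e. \<omega> e - \<eta> e) \<in> balanced \<Gamma>"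
  by (simp add: balanced_def sum_subtractf)

lemma pull_forms_inj:
  assumes "\<omega> \<in> balanced \<Gamma>" "\<eta> \<in> balanced \<Gamma>" "M'.pull_form \<omega> = M'.pull_form \<eta>" "M.pull_form \<omega> =
    M.pull_form \<eta>"
  shows "\<omega> = \<eta>"
proof -
  have "(\<lambda>e. \<omega> e - \<eta> e) = (\<lambda>_. 0)"
    using assms by (intro separating diff_balanced) (simp_all add: pull_form_diff)
  then show ?thesis by (metis (no_types) eq_iff_diff_eq_0 ext)
qed

text \<open>Injectivity on forms is \<open>separating\<close>. On cycles, the coordinates of the
  image are \<open>d\<close> times the coefficients, and \<open>d\<close> is positive.\<close>

lemma \<Phi>_isogeny: "isogeny \<Sigma> T \<Phi>"
  unfolding isogeny_def
proof (intro conjI \<Phi>_morphism inj_onI)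
  fix \<omega> \<eta> assume b: "\<omega> \<in> carrier (lattice T)" "\<eta> \<in> carrier (lattice T)" and eq: "fst \<Phi> \<omega> = fst \<Phi> \<eta>"
  have "M'.pull_form \<omega> = M'.pull_form \<eta>" "M.pull_form \<omega> = M.pull_form \<eta>"
    using eq M'.E.coeff_multiple M.E.coeff_multiple unfolding \<Phi>_fst prod.inject by metis+
  then show "\<omega> = \<eta>" using pull_forms_inj b by simp
next
  fix x y assume "x \<in> carrier (colattice \<Sigma>)" "y \<in> carrier (colattice \<Sigma>)" and eq: "snd \<Phi> x = snd \<Phi> y"
  then obtain c' c b' b where xy: "x = (c', c)" "y = (b', b)" "c' \<in> balanced E'" "c \<in> balanced E"
    "b' \<in> balanced E'" "b \<in> balanced E" by auto
  let ?F = "\<lambda>c' c e. M'.E.coeff c' * s' e + M.E.coeff c * s e"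
  have F: "?F c' c = ?F b' b"
    using eq by (simp add: xy \<Phi>_def M'.pull_def M.pull_def)
  have "M'.pull_form (?F c' c) = M'.E.coeff c' * int d" "M.pull_form (?F c' c) = M.E.coeff c * int
    d" for c c'
    by (simp_all only: M'.pull_form_add M.pull_form_add pull_form_mult orthogonal)
  then have "M'.E.coeff c' * int d = M'.E.coeff b' * int d" "M.E.coeff c * int d = M.E.coeff b * int d"
    using F by metis+
  then have "M'.E.coeff c' = M'.E.coeff b'" "M.E.coeff c = M.E.coeff b" using d_pos by auto
  then have "c' = b'" "c = b" using xy M'.E.coeff M.E.coeff by metis+
  then show "x = y" by (simp add: xy)
qed

text \<open>Comparison of coordinates expresses \<open>d\<close> times \<open>c\<close> through
  \<open>s'\<close> and \<open>s\<close>, and pairings with these two are known from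
  \<open>pairing_s\<close>. So the length pairing is diagonal in the two coordinates.\<close>

lemma pairing_diagonal:
  assumes "\<omega> \<in> balanced \<Gamma>" "c \<in> balanced \<Gamma>"
  shows "pairing T \<omega> c = of_int (M'.pull_form \<omega>) * (of_int (M'.pull_form c) * l' / real d) +
    of_int (M.pull_form \<omega>) * (of_int (M.pull_form c) * l / real d)"
proof -
  let ?c = "\<lambda>e. M'.pull_form c * s' e + M.pull_form c * s e"
  interpret C: comm_group "colattice T" by (rule T.comm_group_colattice)
  have bal: "?c \<in> balanced \<Gamma>" "(\<lambda>e. int d * c e) \<in> balanced \<Gamma>"
    using C.m_closed[of "\<lambda>e. M'.pull_form c * s' e" "\<lambda>e. M.pull_form c * s e"] assms(2)
      M'.multiple_s_balanced M.multiple_s_balanced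
    by (auto simp: colattice_mult balanced_def sum_distrib_left[symmetric])
  have "(\<lambda>e. int d * c e) = ?c"
  proof (rule pull_forms_inj[OF bal(2) bal(1)])
    show "M'.pull_form (\<lambda>e. int d * c e) = M'.pull_form ?c"
      by (simp only: M'.pull_form_add pull_form_mult orthogonal) simp
    show "M.pull_form (\<lambda>e. int d * c e) = M.pull_form ?c"
      by (simp only: M.pull_form_add pull_form_mult orthogonal) simp
  qed
  then have "pairing T \<omega> (\<lambda>e. int d * c e) = pairing T \<omega> ?c" by simp
  also have "\<dots> = pairing T \<omega> (\<lambda>e. M'.pull_form c * s' e) + pairing T \<omega> (\<lambda>e. M.pull_form c * s e)"
    using T.pairing_right[of \<omega> "\<lambda>e. M'.pull_form c * s' e" "\<lambda>e. M.pull_form c * s e"] assms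
      M'.multiple_s_balanced M.multiple_s_balanced by (simp add: colattice_mult)
  also have "\<dots> = of_int (M'.pull_form \<omega>) * of_int (M'.pull_form c) * l' + of_int (M.pull_form \<omega>) *
    of_int (M.pull_form c) * l"
    using M'.pairing_s M.pairing_s assms by simp
  also have "pairing T \<omega> (\<lambda>e. int d * c e) = real d * pairing T \<omega> c"
    by (simp add: Jac_def sum_distrib_left algebra_simps)
  finally show ?thesis using d_pos by (simp add: field_simps)
qed

section \<open>The kernel of the isogeny\<close>

definition weights :: "real \<Rightarrow> real \<Rightarrow> (nat \<Rightarrow> int) \<times> (nat \<Rightarrow> int) \<Rightarrow> real" where
  "weights x y = (\<lambda>(b, c). M'.E.scale x b + M.E.scale y c)"

lemma lattice_sum_mult: "(b, c) \<otimes>\<^bsub>lattice \<Sigma>\<^esub> (b', c') = (\<lambda>e. b e + b' e, \<lambda>e. c e + c' e)"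
  by (simp add: torus_sum_def M.E.lattice_mult M'.E.lattice_mult)

lemma additive_weights: "additive_on (lattice \<Sigma>) (weights x y)"
  by (auto simp: additive_on_def lattice_sum_mult weights_def M.E.scale_def M'.E.scale_def
      M.E.coeff_add M'.E.coeff_add algebra_simps)

lemma zero_balanced: "(\<lambda>_. 0) \<in> balanced C"
  by (simp add: balanced_def)

lemma carrier_sum_points:
  assumes "X \<in> carrier (torus_points \<Sigma>)"
  obtains x y where "X = point_class \<Sigma> (weights x y)"
proof -
  obtain h where h: "X = point_class \<Sigma> h" "additive_on (lattice \<Sigma>) h"
    using assms by (auto simp: S.carrier_points)
  have add: "h (\<lambda>e. b e + b' e, \<lambda>e. c e + c' e) = h (b, c) + h (b', c')"
    if "b \<in> balanced E'" "b' \<in> balanced E'" "c \<in> balanced E" "c' \<in> balanced E" for b b' c c'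
  proof -
    have "h ((b, c) \<otimes>\<^bsub>lattice \<Sigma>\<^esub> (b', c')) = h (b, c) + h (b', c')"
      using h(2) that unfolding additive_on_def carrier_sum by blast
    then show ?thesis by (simp add: lattice_sum_mult)
  qed
  have "additive_on (lattice (Jac E')) (\<lambda>b. h (b, \<lambda>_. 0))"
    using add[OF _ _ zero_balanced zero_balanced] by (simp add: additive_on_def M'.E.lattice_mult)
  then have 1: "h (b, \<lambda>_. 0) = M'.E.scale (h (\<sigma>', \<lambda>_. 0)) b" if "b \<in> balanced E'" for b
    using M'.E.additive_eq_scale that by blast
  have "additive_on (lattice (Jac E)) (\<lambda>c. h (\<lambda>_. 0, c))"
    using add[OF zero_balanced zero_balanced] by (simp add: additive_on_def M.E.lattice_mult)
  then have 2: "h (\<lambda>_. 0, c) = M.E.scale (h (\<lambda>_. 0, \<sigma>)) c" if "c \<in> balanced E" for c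
    using M.E.additive_eq_scale that by blast
  have "h (b, c) = weights (h (\<sigma>', \<lambda>_. 0)) (h (\<lambda>_. 0, \<sigma>)) (b, c)" if "b \<in> balanced E'" "c \<in>
    balanced E" for b c
    using add[of b "\<lambda>_. 0" "\<lambda>_. 0" c] that 1 2 by (simp add: zero_balanced weights_def)
  then have "X = point_class \<Sigma> (weights (h (\<sigma>', \<lambda>_. 0)) (h (\<lambda>_. 0, \<sigma>)))"
    unfolding h(1) by (intro point_class_cong) auto
  then show ?thesis by (rule that)
qed

text \<open>Testing against the two generators separates the components: the points of the sum are
  pairs of reals, modulo multiples of \<open>l'\<close> and of \<open>l\<close>.\<close>

lemma weights_eq_one_iff:
  "point_class \<Sigma> (weights x y) = \<one>\<^bsub>torus_points \<Sigma>\<^esub> \<longleftrightarrow> (\<exists>m n::int. x = of_int m * l' \<and> y = of_int n * l)"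
  unfolding S.point_class_eq_one_iff carrier_sum
proof
  assume "\<exists>c\<in>balanced E' \<times> balanced E. \<forall>\<omega>\<in>balanced E' \<times> balanced E. weights x y \<omega> = pairing \<Sigma> \<omega> c"
  then obtain b c where bc: "b \<in> balanced E'" "c \<in> balanced E"
    "\<And>\<omega>' \<omega>. \<omega>' \<in> balanced E' \<Longrightarrow> \<omega> \<in> balanced E \<Longrightarrow> weights x y (\<omega>', \<omega>) = pairing \<Sigma> (\<omega>', \<omega>) (b, c)" by blast
  have eq: "of_int m * x + of_int n * y = of_int m * of_int (M'.E.coeff b) * l' + of_int n *
    of_int (M.E.coeff c) * l" for m n
    using bc(3)[OF M'.E.multiple_balanced[of m] M.E.multiple_balanced[of n]] bc(1,2)
    by (simp add: weights_def pairing_sum M'.E.pairing_Jac M.E.pairing_Jac M'.E.scale_def M.E.scale_def)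
  from eq[of 1 0] eq[of 0 1] show "\<exists>m n::int. x = of_int m * l' \<and> y = of_int n * l" by auto
next
  assume "\<exists>m n::int. x = of_int m * l' \<and> y = of_int n * l"
  then obtain m n :: int where "x = of_int m * l'" "y = of_int n * l" by blast
  then have "\<forall>\<omega>\<in>balanced E' \<times> balanced E. weights x y \<omega> = pairing \<Sigma> \<omega> (\<lambda>e. m * \<sigma>' e, \<lambda>e. n * \<sigma> e)"
    by (auto simp: weights_def pairing_sum M'.E.pairing_Jac M.E.pairing_Jac M'.E.scale_def
      M.E.scale_def)
  then show "\<exists>c\<in>balanced E' \<times> balanced E. \<forall>\<omega>\<in>balanced E' \<times> balanced E. weights x y \<omega> = pairing \<Sigma> \<omega> c"
    by (intro bexI[of _ "(\<lambda>e. m * \<sigma>' e, \<lambda>e. n * \<sigma> e)"]) auto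
qed

text \<open>A point is killed if evaluation at it is a period of some cycle \<open>c\<close>. By
  \<open>pairing_diagonal\<close> such a point has the coordinates of \<open>c\<close> times
  \<open>l' / d\<close> and \<open>l / d\<close>, and \<open>image\<close> says which coordinates
  occur.\<close>

lemma kernel_iff:
  "on_points \<Sigma> T \<Phi> (point_class \<Sigma> (weights x y)) = \<one>\<^bsub>torus_points T\<^esub> \<longleftrightarrow>
    (\<exists>X Y::int. int d dvd X - Y \<and> x = of_int X * l' / real d \<and> y = of_int Y * l / real d)"
proof -
  have on: "on_points \<Sigma> T \<Phi> (point_class \<Sigma> (weights x y)) = point_class T (weights x y \<circ> fst \<Phi>)"
    by (rule on_points_point_class[OF S.integral_torus_axioms T.integral_torus_axioms \<Phi>_morphism])
  have wt: "(weights x y \<circ> fst \<Phi>) \<omega> = of_int (M'.pull_form \<omega>) * x + of_int (M.pull_form \<omega>) * y" for \<omega>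
    by (simp add: \<Phi>_fst weights_def M'.E.scale_def M.E.scale_def)
  show ?thesis
    unfolding on T.point_class_eq_one_iff M'.carrier_Jac wt
  proof
    assume "\<exists>c\<in>balanced \<Gamma>. \<forall>\<omega>\<in>balanced \<Gamma>. of_int (M'.pull_form \<omega>) * x + of_int (M.pull_form \<omega>) * y
      = pairing T \<omega> c"
    then obtain c where c: "c \<in> balanced \<Gamma>"
      "\<And>\<omega>. \<omega> \<in> balanced \<Gamma> \<Longrightarrow> of_int (M'.pull_form \<omega>) * x + of_int (M.pull_form \<omega>) * y = pairing T \<omega>
        c" by blast
    \<comment> \<open>The forms \<open>s'\<close> and \<open>s\<close> each see one coordinate only,
      so evaluating at them isolates \<open>x\<close> and \<open>y\<close>.\<close>
    have "real d * x = real d * (of_int (M'.pull_form c) * l' / real d)"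
      using c(2)[OF M'.s_balanced] pairing_diagonal[OF M'.s_balanced c(1)] by (simp add: orthogonal)
    moreover have "real d * y = real d * (of_int (M.pull_form c) * l / real d)"
      using c(2)[OF M.s_balanced] pairing_diagonal[OF M.s_balanced c(1)] by (simp add: orthogonal)
    ultimately have "x = of_int (M'.pull_form c) * l' / real d" "y = of_int (M.pull_form c) * l /
      real d"
      using d_pos by (simp_all add: nonzero_eq_divide_eq mult.commute)
    moreover have "int d dvd M'.pull_form c - M.pull_form c" using image c(1) by blast
    ultimately show "\<exists>X Y::int. int d dvd X - Y \<and> x = of_int X * l' / real d \<and> y = of_int Y * l /
      real d" by blast
  next
    assume "\<exists>X Y::int. int d dvd X - Y \<and> x = of_int X * l' / real d \<and> y = of_int Y * l / real d"
    then obtain X Y :: int where XY: "int d dvd X - Y" "x = of_int X * l' / real d" "y = of_int Y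
      * l / real d" by blast
    then obtain c where c: "c \<in> balanced \<Gamma>" "M'.pull_form c = X" "M.pull_form c = Y" using image
      by blast
    show "\<exists>c\<in>balanced \<Gamma>. \<forall>\<omega>\<in>balanced \<Gamma>. of_int (M'.pull_form \<omega>) * x + of_int (M.pull_form \<omega>) * y =
      pairing T \<omega> c"
      using c XY by (intro bexI[of _ c]) (simp_all add: pairing_diagonal)
  qed
qed

text \<open>The multiples of (l' / d, l / d), i.e. the graph of multiplication by l / l' on the
  d-torsion.\<close>

definition kernel_pt :: "int \<Rightarrow> ((nat \<Rightarrow> int) \<times> (nat \<Rightarrow> int) \<Rightarrow> real) set" where
  "kernel_pt n = point_class \<Sigma> (weights (of_int n * l' / real d) (of_int n * l / real d))"

lemma kernel_pt_hom: "kernel_pt \<in> hom integer_group (torus_points \<Sigma>)"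
proof (rule homI)
  fix m n :: int
  have "weights (of_int (m + n) * l' / real d) (of_int (m + n) * l / real d) b =
    weights (of_int m * l' / real d) (of_int m * l / real d) b + weights (of_int n * l' / real d)
      (of_int n * l / real d) b" for b
    by (cases b) (simp add: weights_def M.E.scale_def M'.E.scale_def algebra_simps add_divide_distrib)
  then show "kernel_pt (m \<otimes>\<^bsub>integer_group\<^esub> n) = kernel_pt m \<otimes>\<^bsub>torus_points \<Sigma>\<^esub> kernel_pt n"
    by (auto simp: kernel_pt_def S.point_class_mult intro!: point_class_cong)
qed (use additive_weights in \<open>auto simp: kernel_pt_def S.carrier_points\<close>)

lemma scaled_int_eq:
  assumes "0 < (L::real)"
  shows "of_int n * L / real d = of_int m * L \<longleftrightarrow> n = int d * m"
proof -
  have "of_int n * L / real d = of_int m * L \<longleftrightarrow> real_of_int n * L = of_int (int d * m) * L"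
    using d_pos by (simp add: field_simps)
  also have "\<dots> \<longleftrightarrow> n = int d * m" using assms by (simp only: mult_cancel_right of_int_eq_iff) auto
  finally show ?thesis .
qed

lemma kernel_pt_eq_one_iff: "kernel_pt n = \<one>\<^bsub>torus_points \<Sigma>\<^esub> \<longleftrightarrow> int d dvd n"
  unfolding kernel_pt_def weights_eq_one_iff scaled_int_eq[OF M'.E.l_pos] scaled_int_eq[OF M.E.l_pos]
  by (auto simp: dvd_def)

lemma kernel_group_eq:
  "kernel_group \<Sigma> T \<Phi> = (torus_points \<Sigma>)\<lparr>carrier := kernel_pt ` carrier integer_group\<rparr>"
proof -
  have "kernel (torus_points \<Sigma>) (torus_points T) (on_points \<Sigma> T \<Phi>) = range kernel_pt"
  proof (intro equalityI subsetI)
    fix P assume "P \<in> kernel (torus_points \<Sigma>) (torus_points T) (on_points \<Sigma> T \<Phi>)"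
    then have P: "P \<in> carrier (torus_points \<Sigma>)" "on_points \<Sigma> T \<Phi> P = \<one>\<^bsub>torus_points T\<^esub>" by (auto
      simp: kernel_def)
    obtain x y where xy: "P = point_class \<Sigma> (weights x y)" using carrier_sum_points[OF P(1)] .
    obtain X Y :: int where XY: "int d dvd X - Y" "x = of_int X * l' / real d" "y = of_int Y * l /
      real d"
      using P(2) unfolding xy kernel_iff by blast
    \<comment> \<open>Congruent numerators differ by \<open>int d * k\<close>, so the second
      component changes by \<open>k\<close> whole periods and the point is the diagonal one,
      \<open>kernel_pt X\<close>.\<close>
    from XY(1) obtain k where "X - Y = int d * k" by (auto simp: dvd_def)
    then have Y: "Y = X - int d * k" by simp
    interpret G: comm_group "torus_points \<Sigma>" by (rule S.comm_group_points)
    have "point_class \<Sigma> (weights 0 (of_int (-k) * l)) = \<one>\<^bsub>torus_points \<Sigma>\<^esub>"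
      unfolding weights_eq_one_iff by (intro exI[of _ 0] exI[of _ "-k"]) simp
    then have "kernel_pt X = kernel_pt X \<otimes>\<^bsub>torus_points \<Sigma>\<^esub> point_class \<Sigma> (weights 0 (of_int (-k) * l))"
      using kernel_pt_hom by (simp add: hom_def Pi_iff)
    also have "\<dots> = P"
      unfolding kernel_pt_def S.point_class_mult xy XY Y using d_pos
      by (intro point_class_cong) (auto simp: weights_def M.E.scale_def M'.E.scale_def field_simps)
    finally show "P \<in> range kernel_pt" by auto
  next
    fix P assume "P \<in> range kernel_pt"
    then obtain n where n: "P = kernel_pt n" by auto
    have "on_points \<Sigma> T \<Phi> P = \<one>\<^bsub>torus_points T\<^esub>"
      unfolding n kernel_pt_def kernel_iff by (intro exI[of _ n]) simp
    then show "P \<in> kernel (torus_points \<Sigma>) (torus_points T) (on_points \<Sigma> T \<Phi>)"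
      using kernel_pt_hom by (simp add: kernel_def n hom_def Pi_iff)
  qed
  then show ?thesis by (simp add: kernel_group_def)
qed

lemma induces_splitting: "induces_splitting d \<Gamma> E' E \<phi>' \<phi>"
  unfolding induces_splitting_def
proof (intro exI conjI ballI)
  show "pullback_morphism \<Gamma> E' \<phi>' M'.pull" by (rule M'.pullback_morphism_pull)
  show "pullback_morphism \<Gamma> E \<phi> M.pull" by (rule M.pullback_morphism_pull)
  show "isogeny \<Sigma> T \<Phi>" by (rule \<Phi>_isogeny)
  fix X' X assume "X' \<in> carrier (torus_points (Jac E'))" "X \<in> carrier (torus_points (Jac E))"
  then obtain x' x where x: "X' = point_class (Jac E') (M'.E.scale x')" "X = point_class (Jac E)
    (M.E.scale x)"
    by (auto simp: M'.E.carrier_points_scale M.E.carrier_points_scale)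
  have "on_points \<Sigma> T \<Phi> (point_pair (Jac E') (Jac E) X' X) = point_class T ((\<lambda>(b, c). M'.E.scale
    x' b + M.E.scale x c) \<circ> fst \<Phi>)"
    unfolding x point_pair_point_class
    by (rule on_points_point_class[OF S.integral_torus_axioms T.integral_torus_axioms \<Phi>_morphism])
  also have "\<dots> = point_class T (\<lambda>\<omega>. (M'.E.scale x' \<circ> fst M'.pull) \<omega> + (M.E.scale x \<circ> fst M.pull) \<omega>)"
    by (simp add: \<Phi>_def comp_def)
  also have "\<dots> = on_points (Jac E') T M'.pull X' \<otimes>\<^bsub>torus_points T\<^esub> on_points (Jac E) T M.pull X"
    unfolding x on_points_point_class[OF M'.E.integral_torus_Jac M'.integral_torus_Jac M'.pull_morphism]
      on_points_point_class[OF M.E.integral_torus_Jac M'.integral_torus_Jac M.pull_morphism]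
    by (rule T.point_class_mult[symmetric])
  finally show "on_points \<Sigma> T \<Phi> (point_pair (Jac E') (Jac E) X' X) =
    on_points (Jac E') T M'.pull X' \<otimes>\<^bsub>torus_points T\<^esub> on_points (Jac E) T M.pull X" .
next
  have gS: "group (torus_points \<Sigma>)" using S.comm_group_points by (simp add: comm_group_def)
  have gE': "group (torus_points (Jac E'))" "group (torus_points (Jac E))"
    using integral_torus.comm_group_points M'.E.integral_torus_Jac M.E.integral_torus_Jac
    by (auto simp: comm_group_def)
  show "torsion_group (Jac E') d \<cong> kernel_group \<Sigma> T \<Phi>"
    unfolding kernel_group_eq M'.E.torsion_group_eq[OF d_pos]
    by (rule same_kernel_imp_iso[OF group_integer_group gE'(1) gS M'.E.torsion_pt_hom kernel_pt_hom])
      (simp add: kernel_pt_eq_one_iff M'.E.torsion_pt_eq_one_iff[OF d_pos])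
  show "kernel_group \<Sigma> T \<Phi> \<cong> torsion_group (Jac E) d"
    unfolding kernel_group_eq M.E.torsion_group_eq[OF d_pos]
    by (rule same_kernel_imp_iso[OF group_integer_group gS gE'(2) kernel_pt_hom M.E.torsion_pt_hom])
      (simp add: kernel_pt_eq_one_iff M.E.torsion_pt_eq_one_iff[OF d_pos])
qed

end

section \<open>Covers of circles are affine in the uniformizing coordinate\<close>

context curve
begin

text \<open>One-sided versions are needed because at a point of the model the affine pieces on the
  two sides may differ.\<close>

lemma cover_piece_right:
  assumes f: "tropical_cover \<Gamma> \<Delta> f" and e: "e \<in> EE" "0 \<le> x" "x < len \<Gamma> e"
  obtains e' k c x' where "e' \<in> arcs (graph \<Delta>)" "x < x'" "x' \<le> len \<Gamma> e"
    "\<And>y. x \<le> y \<Longrightarrow> y \<le> x' \<Longrightarrow> 0 \<le> c + of_int k * y \<and> c + of_int k * y \<le> len \<Delta> e' \<and> f (pt \<Gamma> e y) = pt \<Delta>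
      e' (c + of_int k * y)"
proof -
  obtain A where A: "vertex_set \<Gamma> A" "\<forall>j\<in>model_edges \<Gamma> A. affine_on_edge \<Gamma> \<Delta> f j"
    using f by (auto simp: tropical_cover_def)
  obtain b b' where m: "(e, b, b') \<in> model_edges \<Gamma> A" "b \<le> x" "x < b'"
    using model_edge_right[OF A(1) e] .
  then have "affine_on_edge \<Gamma> \<Delta> f (e, b, b')" "b' \<le> len \<Gamma> e" using A(2) by (auto simp: model_edges_def)
  then obtain e' and k :: int and c where "e' \<in> arcs (graph \<Delta>)"
    "\<forall>y\<in>{b..b'}. 0 \<le> c + of_int k * y \<and> c + of_int k * y \<le> len \<Delta> e' \<and> f (pt \<Gamma> e y) = pt \<Delta> e' (c +
      of_int k * y)"
    by (auto simp: affine_on_edge_def)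
  then show ?thesis using m \<open>b' \<le> len \<Gamma> e\<close> by (intro that[of e' b' c k]) auto
qed

lemma cover_piece_left:
  assumes f: "tropical_cover \<Gamma> \<Delta> f" and e: "e \<in> EE" "0 < x" "x \<le> len \<Gamma> e"
  obtains e' k c x' where "e' \<in> arcs (graph \<Delta>)" "x' < x" "0 \<le> x'"
    "\<And>y. x' \<le> y \<Longrightarrow> y \<le> x \<Longrightarrow> 0 \<le> c + of_int k * y \<and> c + of_int k * y \<le> len \<Delta> e' \<and> f (pt \<Gamma> e y) = pt \<Delta>
      e' (c + of_int k * y)"
proof -
  obtain A where A: "vertex_set \<Gamma> A" "\<forall>j\<in>model_edges \<Gamma> A. affine_on_edge \<Gamma> \<Delta> f j"
    using f by (auto simp: tropical_cover_def)
  obtain b b' where m: "(e, b, b') \<in> model_edges \<Gamma> A" "b < x" "x \<le> b'"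
    using model_edge_left[OF A(1) e] .
  then have "affine_on_edge \<Gamma> \<Delta> f (e, b, b')" "0 \<le> b" using A(2) by (auto simp: model_edges_def)
  then obtain e' and k :: int and c where "e' \<in> arcs (graph \<Delta>)"
    "\<forall>y\<in>{b..b'}. 0 \<le> c + of_int k * y \<and> c + of_int k * y \<le> len \<Delta> e' \<and> f (pt \<Gamma> e y) = pt \<Delta> e' (c +
      of_int k * y)"
    by (auto simp: affine_on_edge_def)
  then show ?thesis using m \<open>0 \<le> b\<close> by (intro that[of e' b c k]) auto
qed

end

context uniformized
begin

lemma cover_affine_right:
  assumes "curve \<Gamma>" "tropical_cover \<Gamma> E f" "e \<in> arcs (graph \<Gamma>)" "0 \<le> x" "x < len \<Gamma> e"
  obtains k :: int and c x' where "x < x'" "x' \<le> len \<Gamma> e" "\<And>y. x \<le> y \<Longrightarrow> y \<le> x' \<Longrightarrow> f (pt \<Gamma> e y) = \<rho>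
    (c + of_int k * y)"
proof -
  obtain e' k c x' where p: "e' \<in> EE" "x < x'" "x' \<le> len \<Gamma> e"
    "\<And>y. x \<le> y \<Longrightarrow> y \<le> x' \<Longrightarrow> 0 \<le> c + of_int k * y \<and> c + of_int k * y \<le> len E e' \<and> f (pt \<Gamma> e y) = pt E
      e' (c + of_int k * y)"
    using curve.cover_piece_right[OF assms] by metis
  show ?thesis
  proof (rule that[of x' "a e' + of_int (\<sigma> e') * c" "\<sigma> e' * k"])
    fix y assume "x \<le> y" "y \<le> x'"
    with p(4)[OF this] show "f (pt \<Gamma> e y) = \<rho> (a e' + of_int (\<sigma> e') * c + of_int (\<sigma> e' * k) * y)"
      using pt_\<rho>[OF p(1), of "c + of_int k * y"] by (simp add: algebra_simps)
  qed (use p in auto)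
qed

lemma cover_affine_left:
  assumes "curve \<Gamma>" "tropical_cover \<Gamma> E f" "e \<in> arcs (graph \<Gamma>)" "0 < x" "x \<le> len \<Gamma> e"
  obtains k :: int and c x' where "x' < x" "0 \<le> x'" "\<And>y. x' \<le> y \<Longrightarrow> y \<le> x \<Longrightarrow> f (pt \<Gamma> e y) = \<rho> (c +
    of_int k * y)"
proof -
  obtain e' k c x' where p: "e' \<in> EE" "x' < x" "0 \<le> x'"
    "\<And>y. x' \<le> y \<Longrightarrow> y \<le> x \<Longrightarrow> 0 \<le> c + of_int k * y \<and> c + of_int k * y \<le> len E e' \<and> f (pt \<Gamma> e y) = pt E
      e' (c + of_int k * y)"
    using curve.cover_piece_left[OF assms] by metis
  show ?thesis
  proof (rule that[of x' "a e' + of_int (\<sigma> e') * c" "\<sigma> e' * k"])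
    fix y assume "x' \<le> y" "y \<le> x"
    with p(4)[OF this] show "f (pt \<Gamma> e y) = \<rho> (a e' + of_int (\<sigma> e') * c + of_int (\<sigma> e' * k) * y)"
      using pt_\<rho>[OF p(1), of "c + of_int k * y"] by (simp add: algebra_simps)
  qed (use p in auto)
qed

lemma slope_unique_interval:
  assumes "u < v" and eq: "\<And>y. u \<le> y \<Longrightarrow> y \<le> v \<Longrightarrow> \<rho> (c + k * y) = \<rho> (c' + k' * y)"
  shows "k = k'"
proof (rule slope_unique[of "v - u" "c + k * u" k "c' + k' * u"])
  fix \<epsilon> assume "0 \<le> \<epsilon>" "\<epsilon> \<le> v - u"
  then show "\<rho> (c + k * u + k * \<epsilon>) = \<rho> (c' + k' * u + k' * \<epsilon>)"
    using eq[of "u + \<epsilon>"] by (simp add: algebra_simps)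
qed (use assms in simp)

text \<open>Bisection: affine pieces exist on either side of every point, and \<open>agree\<close>
  forbids a change of slope, so adjacent pieces join after correcting the offset by a period. The
  reason for \<open>agree\<close> differs from one application to the next.\<close>

lemma affine_glue:
  fixes g :: "real \<Rightarrow> point"
  assumes "0 \<le> L"
    and right: "\<And>x. 0 \<le> x \<Longrightarrow> x < L \<Longrightarrow> \<exists>x' c (k::int). x < x' \<and> (\<forall>y. x \<le> y \<and> y \<le> x' \<longrightarrow> g y = \<rho> (c +
      of_int k * y))"
    and left: "\<And>x. 0 < x \<Longrightarrow> x \<le> L \<Longrightarrow> \<exists>x' c (k::int). x' < x \<and> (\<forall>y. x' \<le> y \<and> y \<le> x \<longrightarrow> g y = \<rho> (c +
      of_int k * y))"
    and agree: "\<And>x u v c c' (k::int) (k'::int). 0 < x \<Longrightarrow> x < L \<Longrightarrow> u < x \<Longrightarrow> x < v \<Longrightarrow>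
      (\<And>y. u \<le> y \<Longrightarrow> y \<le> x \<Longrightarrow> g y = \<rho> (c + of_int k * y)) \<Longrightarrow>
      (\<And>y. x \<le> y \<Longrightarrow> y \<le> v \<Longrightarrow> g y = \<rho> (c' + of_int k' * y)) \<Longrightarrow> k = k'"
    and g: "\<And>x. 0 \<le> x \<Longrightarrow> x \<le> L \<Longrightarrow> g x \<in> points E"
  obtains c and k :: int where "\<And>x. 0 \<le> x \<Longrightarrow> x \<le> L \<Longrightarrow> g x = \<rho> (c + of_int k * x)"
proof -
  \<comment> \<open>The guard makes \<open>P\<close> vacuous for intervals that leave
    \<open>[0, L]\<close>; the local condition of \<open>Bolzano\<close> ranges over all small
    intervals around a point.\<close>
  define P where "P u v \<longleftrightarrow> (0 \<le> u \<and> v \<le> L \<longrightarrow> (\<exists>c (k::int). \<forall>y. u \<le> y \<and> y \<le> v \<longrightarrow> g y = \<rho> (c + of_int k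
    * y)))" for u v
  have shift: "g y = \<rho> (c + of_int k * y)" if "\<rho> (c + of_int k * x) = \<rho> (c' + of_int k * x)" "g y
    = \<rho> (c' + of_int k * y)"
    for c c' y x and k :: int
    using \<rho>_shift[OF that(1), of "of_int k * y - of_int k * x"] that(2) by simp
  have join: "\<exists>c (k::int). \<forall>y. u \<le> y \<and> y \<le> v \<longrightarrow> g y = \<rho> (c + of_int k * y)"
    if b: "u \<le> b" "b \<le> v" "0 \<le> u" "v \<le> L"
      and 1: "\<And>y. u \<le> y \<Longrightarrow> y \<le> b \<Longrightarrow> g y = \<rho> (c1 + of_int k1 * y)"
      and 2: "\<And>y. b \<le> y \<Longrightarrow> y \<le> v \<Longrightarrow> g y = \<rho> (c2 + of_int k2 * y)" for u b v c1 c2 and k1 k2 :: int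
  proof -
    consider "u = b" | "b = v" | "u < b" "b < v" using b by linarith
    then show ?thesis
    proof cases
      case 1
      then show ?thesis using 2 by auto
    next
      case 2
      then show ?thesis using 1 by auto
    next
      case 3
      then have k: "k1 = k2" using agree[of b u v c1 k1 c2 k2] 1 2 b by auto
      have "\<rho> (c1 + of_int k1 * b) = \<rho> (c2 + of_int k1 * b)" using 1[of b] 2[of b] b k by simp
      then have "g y = \<rho> (c1 + of_int k1 * y)" if "b \<le> y" "y \<le> v" for y
        using shift[of c1 k1 b c2 y] 2[OF that] k by simp
      then have "\<forall>y. u \<le> y \<and> y \<le> v \<longrightarrow> g y = \<rho> (c1 + of_int k1 * y)" using 1 by (meson linorder_le_cases)
      then show ?thesis by blast
    qed
  qed
  have "P 0 L"
  proof (rule Bolzano[OF assms(1)])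
    fix u b v assume P: "P u b" "P b v" "u \<le> b" "b \<le> v"
    show "P u v"
      unfolding P_def
    proof
      assume uv: "0 \<le> u \<and> v \<le> L"
      obtain c1 and k1 :: int where 1: "\<And>y. u \<le> y \<Longrightarrow> y \<le> b \<Longrightarrow> g y = \<rho> (c1 + of_int k1 * y)"
        using P uv unfolding P_def by fastforce
      obtain c2 and k2 :: int where 2: "\<And>y. b \<le> y \<Longrightarrow> y \<le> v \<Longrightarrow> g y = \<rho> (c2 + of_int k2 * y)"
        using P uv unfolding P_def by fastforce
      show "\<exists>c (k::int). \<forall>y. u \<le> y \<and> y \<le> v \<longrightarrow> g y = \<rho> (c + of_int k * y)"
        using join[of u b v c1 k1 c2 k2] P uv 1 2 by blast
    qed
  next
    fix x assume x: "0 \<le> x" "x \<le> L"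
    obtain t where t: "g x = \<rho> t" using \<rho>_surj[OF g[OF x]] by blast
    obtain v c2 and k2 :: int where v: "x < v" "\<And>y. x \<le> y \<Longrightarrow> y \<le> v \<Longrightarrow> y \<le> L \<Longrightarrow> g y = \<rho> (c2 + of_int
      k2 * y)"
    proof (cases "x < L")
      case True
      then show ?thesis using right[OF x(1) True] that by blast
    next
      case False
      \<comment> \<open>At the end of the interval nothing lies further right, so a constant piece
        through the lift \<open>t\<close> serves.\<close>
      then show ?thesis using t x that[of "x + 1" t 0] by fastforce
    qed
    obtain u c1 and k1 :: int where u: "u < x" "\<And>y. u \<le> y \<Longrightarrow> y \<le> x \<Longrightarrow> 0 \<le> y \<Longrightarrow> g y = \<rho> (c1 + of_int
      k1 * y)"
    proof (cases "0 < x")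
      case True
      then show ?thesis using left[OF True x(2)] that by blast
    next
      case False
      then show ?thesis using t x that[of "x - 1" t 0] by fastforce
    qed
    have "P u' v'" if uv: "u' \<le> x \<and> x \<le> v' \<and> v' - u' < min (v - x) (x - u)" for u' v'
      unfolding P_def
    proof
      assume 0: "0 \<le> u' \<and> v' \<le> L"
      show "\<exists>c (k::int). \<forall>y. u' \<le> y \<and> y \<le> v' \<longrightarrow> g y = \<rho> (c + of_int k * y)"
        by (rule join[of u' x v' c1 k1 c2 k2]) (use uv 0 u v in auto)
    qed
    then show "\<exists>d>0. \<forall>u' v'. u' \<le> x \<and> x \<le> v' \<and> v' - u' < d \<longrightarrow> P u' v'"
      using u(1) v(1) by (intro exI[of _ "min (v - x) (x - u)"]) auto
  qed
  then show ?thesis using assms(1) that unfolding P_def by auto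
qed

end

locale circle_pair = A: uniformized E l \<rho> a \<sigma> + B: uniformized E' l' \<rho>' a' \<sigma>'
  for E l \<rho> a \<sigma> E' l' \<rho>' a' \<sigma>' +
  fixes \<psi> :: "point \<Rightarrow> point"
  assumes cover: "tropical_cover E' E \<psi>"
begin

lemma \<psi>_points: "P \<in> points E' \<Longrightarrow> \<psi> P \<in> points E"
  using cover by (auto simp: tropical_cover_def)

lemma one_sided:
  fixes \<tau> :: int
  assumes "\<tau> = 1 \<or> \<tau> = -1" "\<psi> (\<rho>' t) = \<rho> y"
  obtains \<delta> and \<kappa> :: int and d where "0 < \<delta>" "\<And>\<epsilon>. 0 \<le> \<epsilon> \<Longrightarrow> \<epsilon> \<le> \<delta> \<Longrightarrow> \<psi> (\<rho>' (t + of_int \<tau> * \<epsilon>)) = \<rho> (y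
    + of_int \<kappa> * \<epsilon>)"
    "d \<in> directions E' (\<rho>' t)" "\<And>\<epsilon>. 0 \<le> \<epsilon> \<Longrightarrow> \<epsilon> \<le> \<delta> \<Longrightarrow> along E' d \<epsilon> = \<rho>' (t + of_int \<tau> * \<epsilon>)"
    "(\<lambda>(e, x, s). of_int (\<sigma>' e) * s) d = real_of_int \<tau>"
proof -
  obtain e x s where d: "(e, x, s) \<in> directions E' (\<rho>' t)" "of_int (\<sigma>' e) * s = of_int \<tau>"
    using B.direction_exists[OF assms(1)] by metis
  have d': "e \<in> B.EE" "0 \<le> x" "x \<le> len E' e" "s = 1 \<and> x < len E' e \<or> s = -1 \<and> 0 < x" "pt E' e x = \<rho>' t"
    using d by (auto simp: directions_def)
  obtain \<delta>1 where \<delta>1: "\<delta>1 > 0" "\<And>\<epsilon>. 0 \<le> \<epsilon> \<Longrightarrow> \<epsilon> \<le> \<delta>1 \<Longrightarrow> pt E' e (x + s * \<epsilon>) = \<rho>' (t + of_int \<tau> * \<epsilon>)"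
    using B.direction_along[OF d(1)] d(2) by metis
  have "\<exists>\<delta>>0. \<exists>c (k::int). \<forall>\<epsilon>. 0 \<le> \<epsilon> \<and> \<epsilon> \<le> \<delta> \<longrightarrow> \<psi> (pt E' e (x + s * \<epsilon>)) = \<rho> (c + of_int k * \<epsilon>)"
    using d'(4)
  proof
    assume s: "s = 1 \<and> x < len E' e"
    then obtain k :: int and c x' where p: "x < x'" "\<And>y. x \<le> y \<Longrightarrow> y \<le> x' \<Longrightarrow> \<psi> (pt E' e y) = \<rho> (c +
      of_int k * y)"
      using A.cover_affine_right[OF B.curve_axioms cover d'(1,2)] by metis
    then show ?thesis using s
      by (intro exI[of _ "x' - x"] conjI exI[of _ "c + of_int k * x"] exI[of _ k]) (auto simp:
        algebra_simps)
  next
    assume s: "s = -1 \<and> 0 < x"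
    then obtain k :: int and c x' where p: "x' < x" "\<And>y. x' \<le> y \<Longrightarrow> y \<le> x \<Longrightarrow> \<psi> (pt E' e y) = \<rho> (c +
      of_int k * y)"
      using A.cover_affine_left[OF B.curve_axioms cover d'(1) _ d'(3)] by metis
    then show ?thesis using s
      by (intro exI[of _ "x - x'"] conjI exI[of _ "c + of_int k * x"] exI[of _ "-k"]) (auto simp:
        algebra_simps)
  qed
  then obtain \<delta>2 c and k :: int where \<delta>2: "\<delta>2 > 0"
    "\<And>\<epsilon>. 0 \<le> \<epsilon> \<Longrightarrow> \<epsilon> \<le> \<delta>2 \<Longrightarrow> \<psi> (pt E' e (x + s * \<epsilon>)) = \<rho> (c + of_int k * \<epsilon>)" by blast
  have "\<rho> c = \<rho> y" using \<delta>2(2)[of 0] \<delta>2(1) d'(5) assms(2) by simp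
  show ?thesis
  proof (rule that[of "min \<delta>1 \<delta>2" k "(e, x, s)"])
    fix \<epsilon> assume \<epsilon>: "0 \<le> \<epsilon>" "\<epsilon> \<le> min \<delta>1 \<delta>2"
    show "\<psi> (\<rho>' (t + of_int \<tau> * \<epsilon>)) = \<rho> (y + of_int k * \<epsilon>)"
      using \<delta>1(2)[of \<epsilon>] \<delta>2(2)[of \<epsilon>] \<epsilon> A.\<rho>_shift[OF \<open>\<rho> c = \<rho> y\<close>] by simp
    show "along E' (e, x, s) \<epsilon> = \<rho>' (t + of_int \<tau> * \<epsilon>)" using \<delta>1(2)[of \<epsilon>] \<epsilon> by simp
  qed (use \<delta>1 \<delta>2 d in auto)
qed

text \<open>A cover of circles cannot fold. With outgoing slopes \<open>k1\<close> and
  \<open>k2\<close> on the two sides, harmonicity compares their positive parts with their negative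
  parts and forces them to be opposite.\<close>

lemma two_sided:
  obtains \<delta> y and \<kappa> :: int where "0 < \<delta>" "\<And>u. \<bar>u - t\<bar> \<le> \<delta> \<Longrightarrow> \<psi> (\<rho>' u) = \<rho> (y + of_int \<kappa> * (u - t))"
proof -
  obtain y where y: "\<psi> (\<rho>' t) = \<rho> y" using A.\<rho>_surj[OF \<psi>_points[OF B.\<rho>_points]] by blast
  obtain \<delta>1 and k1 :: int and d1 where 1: "0 < \<delta>1" "\<And>\<epsilon>. 0 \<le> \<epsilon> \<Longrightarrow> \<epsilon> \<le> \<delta>1 \<Longrightarrow> \<psi> (\<rho>' (t + \<epsilon>)) = \<rho> (y +
    of_int k1 * \<epsilon>)"
    "d1 \<in> directions E' (\<rho>' t)" "\<And>\<epsilon>. 0 \<le> \<epsilon> \<Longrightarrow> \<epsilon> \<le> \<delta>1 \<Longrightarrow> along E' d1 \<epsilon> = \<rho>' (t + \<epsilon>)"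
    "(\<lambda>(e, x, s). of_int (\<sigma>' e) * s) d1 = (1::real)"
    using one_sided[of 1 t y, unfolded of_int_1 mult_1_left, OF disjI1[OF refl] y] by blast
  obtain \<delta>2 and k2 :: int and d2 where 2: "0 < \<delta>2" "\<And>\<epsilon>. 0 \<le> \<epsilon> \<Longrightarrow> \<epsilon> \<le> \<delta>2 \<Longrightarrow> \<psi> (\<rho>' (t - \<epsilon>)) = \<rho> (y +
    of_int k2 * \<epsilon>)"
    "d2 \<in> directions E' (\<rho>' t)" "\<And>\<epsilon>. 0 \<le> \<epsilon> \<Longrightarrow> \<epsilon> \<le> \<delta>2 \<Longrightarrow> along E' d2 \<epsilon> = \<rho>' (t - \<epsilon>)"
    "(\<lambda>(e, x, s). of_int (\<sigma>' e) * s) d2 = (-1::real)"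
    using one_sided[of "-1" t y, unfolded of_int_minus of_int_1 mult_minus1 add_uminus_conv_diff,
      OF disjI2[OF refl] y]
    by blast
  have ne: "d1 \<noteq> d2" using 1(5) 2(5) by auto
  have dirs: "directions E' (\<rho>' t) = {d1, d2}"
  proof -
    obtain d d' where "directions E' (\<rho>' t) = {d, d'}" by (rule B.directions_pair)
    then show ?thesis using 1(3) 2(3) ne by auto
  qed
  have deg: "dir_deg E' E \<psi> (\<rho>' t) w = nat (o' * k1) + nat (o' * k2)"
    if w: "w \<in> directions E (\<psi> (\<rho>' t))" "(\<lambda>(e, x, s). of_int (\<sigma> e) * s) w = real_of_int o'" for w o'
  proof -
    obtain e x s where w': "w = (e, x, s)" by (cases w)
    have wd: "(e, x, s) \<in> directions E (\<rho> y)" "of_int (\<sigma> e) * s = of_int o'"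
      using w y by (auto simp: w')
    have "dir_slope E' E \<psi> d1 w = nat (o' * k1)"
      unfolding w' by (rule A.dir_slope_affine[OF 1(1) _ wd]) (simp only: 1(2,4))
    moreover have "dir_slope E' E \<psi> d2 w = nat (o' * k2)"
      unfolding w' by (rule A.dir_slope_affine[OF 2(1) _ wd]) (simp only: 2(2,4))
    ultimately show ?thesis using ne by (simp add: dir_deg_def dirs)
  qed
  obtain w w' where w: "directions E (\<psi> (\<rho>' t)) = {w, w'}"
    "(\<lambda>(e, x, s). of_int (\<sigma> e) * s) w = (1::real)" "(\<lambda>(e, x, s). of_int (\<sigma> e) * s) w' = (-1::real)"
    using A.directions_pair[of y] unfolding y by metis
  have "dir_deg E' E \<psi> (\<rho>' t) w = dir_deg E' E \<psi> (\<rho>' t) w'"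
  proof -
    have "harmonic E' E \<psi>" using cover by (simp add: tropical_cover_def)
    then have "\<forall>v\<in>{w, w'}. \<forall>v'\<in>{w, w'}. dir_deg E' E \<psi> (\<rho>' t) v = dir_deg E' E \<psi> (\<rho>' t) v'"
      unfolding harmonic_def w(1)[symmetric] using B.\<rho>_points by (rule bspec)
    then show ?thesis by blast
  qed
  then have "nat k1 + nat k2 = nat (- k1) + nat (- k2)"
    using deg[of w 1] deg[of w' "-1"] w by simp
  then have k: "k2 = - k1" by arith
  show ?thesis
  proof (rule that[of "min \<delta>1 \<delta>2" y k1])
    fix u assume u: "\<bar>u - t\<bar> \<le> min \<delta>1 \<delta>2"
    show "\<psi> (\<rho>' u) = \<rho> (y + of_int k1 * (u - t))"
    proof (cases "t \<le> u")
      case True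
      then show ?thesis using 1(2)[of "u - t"] u by simp
    next
      case False
      then show ?thesis using 2(2)[of "t - u"] u by (simp add: k algebra_simps)
    qed
  qed (use 1 2 in auto)
qed

text \<open>Locally the slope is the same on both sides, so the map is affine over one period of E',
  and closing up gives the relation between \<open>m\<close> and \<open>n\<close>: \<open>m\<close>
  is the dilation and \<open>n\<close> the winding number. Slope 0 would make the map constant,
  against surjectivity.\<close>

lemma affine:
  obtains c and m n :: int where "\<And>t. \<psi> (\<rho>' t) = \<rho> (c + of_int m * t)" "of_int m * l' = of_int n *
    l" "m \<noteq> 0"
proof -
  have loc: "\<exists>u v c (k::int). u < x \<and> x < v \<and> (\<forall>y. u \<le> y \<and> y \<le> v \<longrightarrow> \<psi> (\<rho>' y) = \<rho> (c + of_int k *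
    y))" for x
  proof -
    obtain \<delta> y and \<kappa> :: int where d: "0 < \<delta>" "\<And>u. \<bar>u - x\<bar> \<le> \<delta> \<Longrightarrow> \<psi> (\<rho>' u) = \<rho> (y + of_int \<kappa> * (u - x))"
      using two_sided[of x] by blast
    have "\<psi> (\<rho>' u) = \<rho> (y - of_int \<kappa> * x + of_int \<kappa> * u)" if "x - \<delta> \<le> u" "u \<le> x + \<delta>" for u
      using d(2)[of u] that by (simp add: algebra_simps abs_le_iff)
    then show ?thesis using d(1)
      by (intro exI[of _ "x - \<delta>"] exI[of _ "x + \<delta>"] exI[of _ "y - of_int \<kappa> * x"] exI[of _ \<kappa>]) auto
  qed
  obtain c and m :: int where cm: "\<And>x. 0 \<le> x \<Longrightarrow> x \<le> l' \<Longrightarrow> \<psi> (\<rho>' x) = \<rho> (c + of_int m * x)"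
  proof (rule A.affine_glue[of l' "\<lambda>x. \<psi> (\<rho>' x)"])
    show "0 \<le> l'" using B.l_pos by simp
    show "\<psi> (\<rho>' x) \<in> points E" for x by (intro \<psi>_points B.\<rho>_points)
    show "\<exists>x' c (k::int). x < x' \<and> (\<forall>y. x \<le> y \<and> y \<le> x' \<longrightarrow> \<psi> (\<rho>' y) = \<rho> (c + of_int k * y))" for x
      using loc[of x] by (meson less_imp_le order_trans)
    show "\<exists>x' c (k::int). x' < x \<and> (\<forall>y. x' \<le> y \<and> y \<le> x \<longrightarrow> \<psi> (\<rho>' y) = \<rho> (c + of_int k * y))" for x
      using loc[of x] by (meson less_imp_le order_trans)
    fix x u v c c' and k k' :: int
    assume h: "u < x" "x < v" "\<And>y. u \<le> y \<Longrightarrow> y \<le> x \<Longrightarrow> \<psi> (\<rho>' y) = \<rho> (c + of_int k * y)"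
      "\<And>y. x \<le> y \<Longrightarrow> y \<le> v \<Longrightarrow> \<psi> (\<rho>' y) = \<rho> (c' + of_int k' * y)"
    obtain u0 v0 c0 and k0 :: int where 0: "u0 < x" "x < v0" "\<And>y. u0 \<le> y \<Longrightarrow> y \<le> v0 \<Longrightarrow> \<psi> (\<rho>' y) = \<rho>
      (c0 + of_int k0 * y)"
      using loc[of x] by blast
    have "real_of_int k = of_int k0"
      by (rule A.slope_unique_interval[of "max u u0" x c _ c0]) (use h 0 in \<open>auto simp flip: h(3) 0(3)\<close>)
    moreover have "real_of_int k' = of_int k0"
      by (rule A.slope_unique_interval[of x "min v v0" c' _ c0]) (use h 0 in \<open>auto simp flip: h(4)
        0(3)\<close>)
    ultimately show "k = k'" by simp
  qed (rule that)
  have "\<rho>' l' = \<rho>' 0" using B.\<rho>_add_period[of 0 1] by simp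
  then have "\<rho> (c + of_int m * l') = \<rho> (c + of_int m * 0)" using cm[of 0] cm[of l'] B.l_pos by simp
  then obtain n :: int where n: "of_int m * l' = of_int n * l" by (auto simp: A.\<rho>_eq)
  have all: "\<psi> (\<rho>' t) = \<rho> (c + of_int m * t)" for t
  proof -
    \<comment> \<open>Every \<open>t\<close> is reduced to the fundamental interval;
      \<open>j\<close> periods of E' cost \<open>j * n\<close> periods of E.\<close>
    define j where "j = \<lfloor>t / l'\<rfloor>"
    define t0 where "t0 = t - of_int j * l'"
    have "of_int j \<le> t / l'" "t / l' < of_int j + 1" by (simp_all add: j_def)
    then have t0: "0 \<le> t0" "t0 \<le> l'" using B.l_pos by (simp_all add: t0_def field_simps)
    have "\<rho>' t = \<rho>' t0" using B.\<rho>_add_period[of t0 j] by (simp add: t0_def)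
    then have "\<psi> (\<rho>' t) = \<rho> (c + of_int m * t0)" using cm[OF t0] by simp
    also have "c + of_int m * t0 = c + of_int m * t + of_int (- j * n) * l"
      using n by (simp add: t0_def algebra_simps)
    finally show ?thesis unfolding A.\<rho>_add_period .
  qed
  have "m \<noteq> 0"
  proof
    assume "m = 0"
    then have const: "\<psi> (\<rho>' t) = \<rho> c" for t using all by simp
    have "Q = \<rho> c" if "Q \<in> points E" for Q
    proof -
      have "Q \<in> \<psi> ` points E'" using cover that by (simp add: tropical_cover_def)
      then obtain P where "P \<in> points E'" "Q = \<psi> P" by blast
      then show ?thesis using B.\<rho>_surj[of P] const by auto
    qed
    then have "\<rho> 0 = \<rho> (l / 2)" using A.\<rho>_points by metis
    then show False using A.\<rho>_inj_near[of 0 "l / 2"] A.l_pos by simp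
  qed
  then show ?thesis using all n that by blast
qed

text \<open>The lift is an isometry of the line compatible with the periods. Its inverse has slope
  \<open>m\<close> too and is a map of the kind already known to be a tropical cover.\<close>

lemma isometry_iso:
  assumes \<psi>: "\<And>t. \<psi> (\<rho>' t) = \<rho> (c + of_int m * t)" and m: "m = 1 \<or> m = (-1::int)" and l: "l' = l"
  shows "tropical_iso E' E \<psi>"
proof -
  have mm: "of_int m * (of_int m * (t::real)) = t" for t using m by auto
  have inj: "inj_on \<psi> (points E')"
  proof (rule inj_onI)
    fix P Q assume PQ: "P \<in> points E'" "Q \<in> points E'" "\<psi> P = \<psi> Q"
    then obtain t u where tu: "P = \<rho>' t" "Q = \<rho>' u" using B.\<rho>_surj by metis
    then have "\<rho> (c + of_int m * t) = \<rho> (c + of_int m * u)" using PQ \<psi> by simp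
    then obtain n :: int where "of_int m * t - of_int m * u = of_int n * l" by (auto simp: A.\<rho>_eq)
    then have "t - u = of_int (m * n) * l'" using m l by auto
    then show "P = Q" unfolding tu B.\<rho>_eq by blast
  qed
  have surj: "\<psi> ` points E' = points E" using cover by (simp add: tropical_cover_def)
  define g where "g = inv_into (points E') \<psi>"
  have g: "g (\<rho> t) = \<rho>' (of_int m * (t - c))" for t
  proof -
    have "\<psi> (\<rho>' (of_int m * (t - c))) = \<rho> t" unfolding \<psi> mm by simp
    then show ?thesis unfolding g_def using inv_into_f_f[OF inj B.\<rho>_points] by metis
  qed
  have bal: "(\<lambda>e. m * \<sigma> e) \<in> balanced E" by simp
  obtain w p where M: "circle_map E' l' \<rho>' a' \<sigma>' E g (\<lambda>e. m * \<sigma> e) w p"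
  proof (rule circle_map_intro[OF B.uniformized_axioms A.curve_axioms bal, of g "\<lambda>e. of_int m * (a
    e - c)"])
    fix e x assume "e \<in> arcs (graph E)" "0 \<le> x" "x \<le> len E e"
    then show "g (pt E e x) = \<rho>' (of_int m * (a e - c) + of_int (m * \<sigma> e) * x)"
      by (simp add: A.pt_\<rho> g algebra_simps)
  next
    fix v assume "v \<in> verts (graph E)"
    then obtain t where "Vertex v = \<rho> t" using A.\<rho>_surj[of "Vertex v"] by (auto simp: points_def)
    then show "g (Vertex v) \<in> points E'" by (simp add: g)
  qed
  interpret M: circle_map E' l' \<rho>' a' \<sigma>' E g "\<lambda>e. m * \<sigma> e" w p by (rule M)
  have "g ` points E = points E'"
    unfolding g_def surj[symmetric] by (simp add: inj image_image)
  then have "tropical_cover E E' g" by (rule M.tropical_cover)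
  then show ?thesis unfolding tropical_iso_def g_def[symmetric] using cover inj by blast
qed

end

lemma connected_star:
  assumes "wf_digraph G" and r: "r \<in> verts G"
    and arcs: "\<And>v. v \<in> verts G \<Longrightarrow> v \<noteq> r \<Longrightarrow> \<exists>e\<in>arcs G. tail G e = r \<and> head G e = v"
  shows "Digraph_Component.connected G"
proof -
  let ?H = "with_proj (mk_symmetric G)"
  interpret G: wf_digraph G by fact
  interpret H: pair_wf_digraph "mk_symmetric G" by (rule G.wellformed_mk_symmetric)
  have 1: "r \<rightarrow>\<^sup>*\<^bsub>?H\<^esub> v \<and> v \<rightarrow>\<^sup>*\<^bsub>?H\<^esub> r" if v: "v \<in> verts G" for v
  proof (cases "v = r")
    case True
    then show ?thesis using r by (simp add: H.reachable_refl)
  next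
    case False
    then have "(r, v) \<in> parcs (mk_symmetric G)" "(v, r) \<in> parcs (mk_symmetric G)"
      using arcs[OF v] by (auto simp: parcs_mk_symmetric)
    then show ?thesis by (auto intro!: H.reachable_adjI)
  qed
  show ?thesis
    unfolding connected_def strongly_connected_def
    using r 1 H.reachable_trans by auto blast
qed

section \<open>Optimality\<close>

context circle_map
begin

text \<open>A factor circle E2 comes with dilation \<open>m\<close> and winding number
  \<open>n\<close> over E. All slopes of the map are multiples of \<open>m\<close>, so
  \<open>primitive\<close> makes it a unit. The cycle \<open>\<gamma>\<close> is wrapped once around
  E, and this number is a multiple of \<open>n\<close>, so \<open>n\<close> is a unit as well; then
  E2 and E have the same length.\<close>

lemma optimal:
  assumes surj: "\<phi> ` points \<Gamma> = points E"
    and primitive: "\<And>m. (\<And>e. e \<in> EE \<Longrightarrow> m dvd s e) \<Longrightarrow> m = 1 \<or> m = -1"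
    and cycle: "\<gamma> \<in> balanced \<Gamma>" "(\<Sum>e\<in>EE. \<gamma> e * w e) = 1"
    and unif: "\<And>E'. elliptic_curve E' \<Longrightarrow> \<exists>l \<rho> a \<sigma>. uniformized E' l \<rho> a \<sigma>"
  shows "optimal_cover \<Gamma> E \<phi>"
  unfolding optimal_cover_def
proof (intro conjI allI impI)
  show "tropical_cover \<Gamma> E \<phi>" by (rule tropical_cover[OF surj])
  fix E2 \<phi>2 \<psi>
  assume h: "elliptic_curve E2 \<and> tropical_cover \<Gamma> E2 \<phi>2 \<and> tropical_cover E2 E \<psi> \<and> (\<forall>P\<in>points \<Gamma>. \<phi>
    P = \<psi> (\<phi>2 P))"
  then obtain l2 \<rho>2 a2 \<sigma>2 where U: "uniformized E2 l2 \<rho>2 a2 \<sigma>2" using unif by blast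
  interpret B: uniformized E2 l2 \<rho>2 a2 \<sigma>2 by (rule U)
  interpret P: circle_pair E l \<rho> a \<sigma> E2 l2 \<rho>2 a2 \<sigma>2 \<psi>
    by unfold_locales (use h in blast)
  have c2: "tropical_cover \<Gamma> E2 \<phi>2" using h by blast
  obtain c and m n :: int where \<psi>: "\<And>t. \<psi> (\<rho>2 t) = \<rho> (c + of_int m * t)" and mn: "of_int m * l2 =
    of_int n * l" "m \<noteq> 0"
    using P.affine by blast
  \<comment> \<open>Composed with the affine \<open>\<psi>\<close>, any affine piece of
    \<open>\<phi>2\<close> has to reproduce the slope of \<open>\<phi>\<close>. Since
    \<open>m\<close> is nonzero the slope of the piece is determined, which excludes kinks inside an
    edge.\<close>
  have slope: "m * k = s e" if e: "e \<in> EE" "0 \<le> u" "u < v" "v \<le> len \<Gamma> e"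
    and k: "\<And>y. u \<le> y \<Longrightarrow> y \<le> v \<Longrightarrow> \<phi>2 (pt \<Gamma> e y) = \<rho>2 (c' + of_int k * y)" for e u v c' and k :: int
  proof -
    have "real_of_int (m * k) = of_int (s e)"
    proof (rule E.slope_unique_interval[OF e(3), of "c + of_int m * c'" _ "p (src e)"])
      fix y assume y: "u \<le> y" "y \<le> v"
      then have "pt \<Gamma> e y \<in> points \<Gamma>" using e by (intro pt_in_points) auto
      then have "\<psi> (\<phi>2 (pt \<Gamma> e y)) = \<phi> (pt \<Gamma> e y)" using h by simp
      then show "\<rho> (c + of_int m * c' + of_int (m * k) * y) = \<rho> (p (src e) + of_int (s e) * y)"
        using k[OF y] \<psi> \<phi>_pt[of e y] e y by (simp add: algebra_simps)
    qed
    then show ?thesis by (simp only: of_int_eq_iff)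
  qed
  have edge: "\<exists>q (k::int). m * k = s e \<and> (\<forall>x. 0 \<le> x \<and> x \<le> len \<Gamma> e \<longrightarrow> \<phi>2 (pt \<Gamma> e x) = \<rho>2 (q + of_int
    k * x))"
    if e: "e \<in> EE" for e
  proof -
    obtain q and k :: int where qk: "\<And>x. 0 \<le> x \<Longrightarrow> x \<le> len \<Gamma> e \<Longrightarrow> \<phi>2 (pt \<Gamma> e x) = \<rho>2 (q + of_int k * x)"
    proof (rule B.affine_glue[of "len \<Gamma> e" "\<lambda>x. \<phi>2 (pt \<Gamma> e x)"])
      show "0 \<le> len \<Gamma> e" using len_pos[OF e] by simp
      show "\<phi>2 (pt \<Gamma> e x) \<in> points E2" if "0 \<le> x" "x \<le> len \<Gamma> e" for x
        using c2 pt_in_points[OF e that] by (auto simp: tropical_cover_def)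
      show "\<exists>x' c (k::int). x < x' \<and> (\<forall>y. x \<le> y \<and> y \<le> x' \<longrightarrow> \<phi>2 (pt \<Gamma> e y) = \<rho>2 (c + of_int k * y))"
        if "0 \<le> x" "x < len \<Gamma> e" for x
        by (rule B.cover_affine_right[OF curve_axioms c2 e that]) blast
      show "\<exists>x' c (k::int). x' < x \<and> (\<forall>y. x' \<le> y \<and> y \<le> x \<longrightarrow> \<phi>2 (pt \<Gamma> e y) = \<rho>2 (c + of_int k * y))"
        if "0 < x" "x \<le> len \<Gamma> e" for x
        by (rule B.cover_affine_left[OF curve_axioms c2 e that]) blast
      fix x u v c c' and k k' :: int
      assume a: "0 < x" "x < len \<Gamma> e" "u < x" "x < v" "\<And>y. u \<le> y \<Longrightarrow> y \<le> x \<Longrightarrow> \<phi>2 (pt \<Gamma> e y) = \<rho>2 (c +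
        of_int k * y)"
        "\<And>y. x \<le> y \<Longrightarrow> y \<le> v \<Longrightarrow> \<phi>2 (pt \<Gamma> e y) = \<rho>2 (c' + of_int k' * y)"
      have "m * k = s e" by (rule slope[OF e, of "max 0 u" x c]) (use a in auto)
      moreover have "m * k' = s e" by (rule slope[OF e, of x "min v (len \<Gamma> e)" c']) (use a in auto)
      ultimately show "k = k'" using mn(2) by (metis mult_left_cancel)
    qed (rule that)
    have "m * k = s e" by (rule slope[OF e, of 0 "len \<Gamma> e" q]) (use qk len_pos[OF e] in auto)
    then show ?thesis using qk by blast
  qed
  then obtain q and k :: "nat \<Rightarrow> int" where qk: "\<And>e. e \<in> EE \<Longrightarrow> m * k e = s e"
    "\<And>e x. e \<in> EE \<Longrightarrow> 0 \<le> x \<Longrightarrow> x \<le> len \<Gamma> e \<Longrightarrow> \<phi>2 (pt \<Gamma> e x) = \<rho>2 (q e + of_int (k e) * x)"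
    by metis
  define r where "r e = (if e \<in> EE then k e else 0)" for e
  have mr: "m * r e = s e" for e
    using qk(1)[of e] s_balanced by (auto simp: r_def balanced_def)
  have r_bal: "r \<in> balanced \<Gamma>"
  proof -
    have "m * (\<Sum>e | e \<in> EE \<and> tgt e = v. r e) = m * (\<Sum>e | e \<in> EE \<and> src e = v. r e)" if "v \<in> VV" for v
      using balancedD[OF s_balanced that] by (simp add: sum_distrib_left mr)
    then show ?thesis using mn(2) by (auto simp: balanced_def r_def)
  qed
  obtain w2 p2 where M: "circle_map E2 l2 \<rho>2 a2 \<sigma>2 \<Gamma> \<phi>2 r w2 p2"
  proof (rule circle_map_intro[OF U curve_axioms r_bal, of \<phi>2 q])
    show "\<phi>2 (Vertex v) \<in> points E2" if "v \<in> verts (graph \<Gamma>)" for v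
      using c2 that by (auto simp: tropical_cover_def points_def)
  qed (simp_all add: r_def qk)
  interpret M: circle_map E2 l2 \<rho>2 a2 \<sigma>2 \<Gamma> \<phi>2 r w2 p2 by (rule M)
  have len2: "(\<Sum>e\<in>EE. of_int (\<gamma> e) * (of_int (r e) * len \<Gamma> e)) = l2 * of_int (\<Sum>e\<in>EE. \<gamma> e * w2 e)"
  proof -
    have "(\<Sum>e\<in>EE. of_int (\<gamma> e) * (of_int (r e) * len \<Gamma> e)) =
      (\<Sum>e\<in>EE. of_int (\<gamma> e) * (p2 (tgt e) - p2 (src e)) + l2 * of_int (\<gamma> e * w2 e))"
      by (intro sum.cong refl) (simp only: M.winding, simp add: algebra_simps)
    then show ?thesis
      using balanced_sum_coboundary[OF cycle(1), of p2] by (simp add: sum.distrib sum_distrib_left)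
  qed
  \<comment> \<open>The signed length of the image of \<open>\<gamma>\<close> computed twice: in E
    it is \<open>l\<close>, and through E2 it is \<open>m\<close> times a multiple of
    \<open>l2\<close>, hence \<open>n * l\<close> times an integer.\<close>
  have "(\<Sum>e\<in>EE. of_int (\<gamma> e) * (of_int (s e) * len \<Gamma> e)) =
    (\<Sum>e\<in>EE. of_int (\<gamma> e) * (p (tgt e) - p (src e)) + l * of_int (\<gamma> e * w e))"
    by (intro sum.cong refl) (simp only: winding, simp add: algebra_simps)
  also have "\<dots> = l * of_int (\<Sum>e\<in>EE. \<gamma> e * w e)"
    using balanced_sum_coboundary[OF cycle(1), of p] by (simp add: sum.distrib sum_distrib_left)
  finally have "l = (\<Sum>e\<in>EE. of_int (\<gamma> e) * (of_int (s e) * len \<Gamma> e))" using cycle(2) by simp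
  also have "\<dots> = of_int m * (\<Sum>e\<in>EE. of_int (\<gamma> e) * (of_int (r e) * len \<Gamma> e))"
    unfolding mr[symmetric] by (simp add: sum_distrib_left algebra_simps)
  also have "\<dots> = (of_int m * l2) * of_int (\<Sum>e\<in>EE. \<gamma> e * w2 e)" unfolding len2 by (simp only: mult.assoc)
  also have "\<dots> = l * of_int (n * (\<Sum>e\<in>EE. \<gamma> e * w2 e))" unfolding mn(1) by simp
  finally have "l * of_int 1 = l * of_int (n * (\<Sum>e\<in>EE. \<gamma> e * w2 e))" by simp
  then have "n * (\<Sum>e\<in>EE. \<gamma> e * w2 e) = 1" using E.l_pos by (metis mult_cancel_left of_int_eq_iff
    less_irrefl)
  then have n: "n = 1 \<or> n = -1" by (auto simp: zmult_eq_1_iff)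
  have m: "m = 1 \<or> m = -1" using primitive mr by (metis dvd_triv_left)
  have "\<bar>of_int m * l2\<bar> = \<bar>of_int n * l\<bar>" using mn(1) by simp
  then have "l2 = l" using n m E.l_pos B.l_pos by (auto simp: abs_mult)
  then show "tropical_iso E2 E \<psi>" using P.isometry_iso[OF \<psi> m] by simp
qed

end

section \<open>Elliptic curves are uniformizable\<close>

text \<open>Reduction of \<open>t\<close> modulo \<open>l\<close> to the half-open interval from 0
  to \<open>l\<close>.\<close>

definition circle_pt :: "real \<Rightarrow> real \<Rightarrow> point" where
  "circle_pt l t = pt (circle l) 0 (t - of_int \<lfloor>t / l\<rfloor> * l)"

lemma circle_simps [simp]:
  "verts (graph (circle l)) = {0}" "arcs (graph (circle l)) = {0}"
  "tail (graph (circle l)) = (\<lambda>_. 0)" "head (graph (circle l)) = (\<lambda>_. 0)" "len (circle l) = (\<lambda>_. l)"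
  by (simp_all add: circle_def)

lemma curve_circle: "0 < l \<Longrightarrow> curve (circle l)"
proof
  assume l: "0 < l"
  have wf: "wf_digraph (graph (circle l))" by unfold_locales simp_all
  then show "tropical_curve (circle l)"
    using l connected_star[OF wf, of 0]
    by (auto simp: tropical_curve_def fin_digraph_def fin_digraph_axioms_def)
qed

lemma uniformized_circle:
  assumes l: "0 < l"
  shows "uniformized (circle l) l (circle_pt l) (\<lambda>_. 0) (\<lambda>e. if e = 0 then 1 else 0)"
proof -
  interpret curve "circle l" by (rule curve_circle[OF l])
  have r: "0 \<le> t - of_int \<lfloor>t / l\<rfloor> * l \<and> t - of_int \<lfloor>t / l\<rfloor> * l < l" for t
  proof -
    have "of_int \<lfloor>t / l\<rfloor> \<le> t / l" "t / l < of_int \<lfloor>t / l\<rfloor> + 1" by simp_all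
    then have "of_int \<lfloor>t / l\<rfloor> * l \<le> t" "t < (of_int \<lfloor>t / l\<rfloor> + 1) * l"
      using l by (simp_all only: pos_le_divide_eq pos_divide_less_eq)
    then show ?thesis by (simp add: algebra_simps)
  qed
  have eq: "circle_pt l t = circle_pt l t' \<longleftrightarrow> (\<exists>n::int. t - t' = of_int n * l)" for t t'
  proof
    assume "circle_pt l t = circle_pt l t'"
    then have "t - of_int \<lfloor>t / l\<rfloor> * l = t' - of_int \<lfloor>t' / l\<rfloor> * l"
      using r[of t] r[of t'] by (auto simp: circle_pt_def pt_def split: if_splits)
    then have "t - t' = of_int (\<lfloor>t / l\<rfloor> - \<lfloor>t' / l\<rfloor>) * l" by (simp add: algebra_simps)
    then show "\<exists>n::int. t - t' = of_int n * l" by blast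
  next
    assume "\<exists>n::int. t - t' = of_int n * l"
    then obtain n :: int where n: "t = t' + of_int n * l" by (metis add.commute diff_add_cancel)
    have "t / l = t' / l + of_int n" using l by (simp add: n field_simps)
    then have "\<lfloor>t / l\<rfloor> = \<lfloor>t' / l\<rfloor> + n" by simp
    then have "t - of_int \<lfloor>t / l\<rfloor> * l = t' - of_int \<lfloor>t' / l\<rfloor> * l" by (simp add: n algebra_simps)
    then show "circle_pt l t = circle_pt l t'" by (simp add: circle_pt_def)
  qed
  have small: "circle_pt l x = pt (circle l) 0 x" if "0 \<le> x" "x \<le> l" for x
  proof (cases "x = l")
    case True
    then show ?thesis using l by (simp add: circle_pt_def pt_def)
  next
    case False
    then have "0 \<le> x / l" "x / l < 1" using that l by auto
    then have "\<lfloor>x / l\<rfloor> = 0" by (simp add: floor_eq_iff)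
    then show ?thesis by (simp add: circle_pt_def)
  qed
  show ?thesis
  proof unfold_locales
    show "circle_pt l t \<in> points (circle l)" for t
      unfolding circle_pt_def by (rule pt_in_points) (use r[of t] in auto)
    show "\<exists>t. P = circle_pt l t" if "P \<in> points (circle l)" for P
      using that
    proof (cases rule: points_cases)
      case (1 v)
      then show ?thesis using small[of 0] l by (intro exI[of _ 0]) simp
    next
      case (2 e x)
      then show ?thesis using small[of x] by (intro exI[of _ x]) (simp add: pt_inner)
    qed
  qed (use l eq small in \<open>auto split: if_splits\<close>)
qed

text \<open>The isomorphism \<open>h\<close> transports the parametrization of the standard circle.
  What has to be shown is that its inverse \<open>g\<close> is affine with slope 1 or -1 on whole
  edges of E; neither is part of the notion of isomorphism.\<close>

lemma elliptic_curve_uniformized: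
  assumes "elliptic_curve E"
  obtains l \<rho> a \<sigma> where "elliptic E l \<rho> a \<sigma>"
proof -
  obtain l h where l: "0 < l" and iso: "tropical_iso (circle l) E h" and tE: "tropical_curve E"
    and gen: "has_genus E 1"
    using assms by (auto simp: elliptic_curve_def)
  interpret C: uniformized "circle l" l "circle_pt l" "\<lambda>_. 0" "\<lambda>e. if e = 0 then 1 else 0"
    by (rule uniformized_circle[OF l])
  interpret E: curve E by unfold_locales (rule tE)
  define g where "g = inv_into (points (circle l)) h"
  have hc: "tropical_cover (circle l) E h" and inj: "inj_on h (points (circle l))" and gc:
    "tropical_cover E (circle l) g"
    using iso by (auto simp: tropical_iso_def g_def)
  have surj: "h ` points (circle l) = points E" using hc by (simp add: tropical_cover_def)
  have hg: "h (g Q) = Q" "g Q \<in> points (circle l)" if "Q \<in> points E" for Q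
    using that unfolding g_def surj[symmetric] by (auto simp: f_inv_into_f inv_into_into)
  \<comment> \<open>The integral slopes of \<open>g\<close> and \<open>h\<close> along corresponding
    pieces multiply to 1, so both are units.\<close>
  have unit: "k = 1 \<or> k = -1"
    if e: "e \<in> E.EE" "0 \<le> u" "u < v" "v \<le> len E e"
      and gk: "\<And>y. u \<le> y \<Longrightarrow> y \<le> v \<Longrightarrow> g (pt E e y) = circle_pt l (c + of_int k * y)" for e u v c and
        k :: int
  proof -
    have in_pts: "pt E e y \<in> points E" if "u \<le> y" "y \<le> v" for y using that e by (intro
      E.pt_in_points) auto
    have "k \<noteq> 0"
    proof
      assume "k = 0"
      \<comment> \<open>Two points strictly inside the piece, where coordinates can be compared; its
        ends may be vertices.\<close>
      define y1 y2 where "y1 = (2 * u + v) / 3" and "y2 = (u + v) / 2"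
      have y: "u < y1" "y1 < y2" "y2 < v" using e by (auto simp: y1_def y2_def)
      have "g (pt E e y1) = g (pt E e y2)" using gk[of y1] gk[of y2] y \<open>k = 0\<close> by simp
      then have "h (g (pt E e y1)) = h (g (pt E e y2))" by (rule arg_cong)
      moreover have "h (g (pt E e y1)) = pt E e y1" "h (g (pt E e y2)) = pt E e y2"
        using y by (auto intro!: hg(1) in_pts)
      ultimately have "pt E e y1 = pt E e y2" by (simp only:)
      moreover have "pt E e y1 = Inner e y1" "pt E e y2 = Inner e y2" using e y by (auto intro!:
        E.pt_inner)
      ultimately show False using y by simp
    qed
    define \<tau> where "\<tau> = sgn k"
    have \<tau>: "\<tau> = 1 \<or> \<tau> = -1" using \<open>k \<noteq> 0\<close> by (auto simp: \<tau>_def sgn_if)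
    have \<tau>k: "real_of_int \<tau> * (of_int \<bar>k\<bar> * z) = of_int k * z" for z
      by (auto simp: \<tau>_def sgn_if)
    define t0 where "t0 = c + of_int k * u"
    obtain e0 x0 s0 where d: "(e0, x0, s0) \<in> directions (circle l) (circle_pt l t0)"
      "of_int (if e0 = 0 then 1 else 0) * s0 = real_of_int \<tau>"
      using C.direction_exists[OF \<tau>, of t0] by metis
    have d': "e0 \<in> C.EE" "0 \<le> x0" "x0 \<le> len (circle l) e0" "s0 = 1 \<and> x0 < len (circle l) e0 \<or> s0 =
      -1 \<and> 0 < x0"
      using d by (auto simp: directions_def)
    obtain \<delta>1 where \<delta>1: "\<delta>1 > 0" "\<And>\<epsilon>. 0 \<le> \<epsilon> \<Longrightarrow> \<epsilon> \<le> \<delta>1 \<Longrightarrow> pt (circle l) e0 (x0 + s0 * \<epsilon>) = circle_pt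
      l (t0 + of_int \<tau> * \<epsilon>)"
      using C.direction_along[OF d(1)] d(2) by metis
    have "\<exists>\<delta>>0. \<exists>e' c (k::int). \<forall>\<epsilon>. 0 \<le> \<epsilon> \<and> \<epsilon> \<le> \<delta> \<longrightarrow> h (pt (circle l) e0 (x0 + s0 * \<epsilon>)) = pt E e'
      (c + of_int k * \<epsilon>)"
      using d'(4)
    proof
      assume s: "s0 = 1 \<and> x0 < len (circle l) e0"
      obtain e' k c x' where p: "x0 < x'" "\<And>y. x0 \<le> y \<Longrightarrow> y \<le> x' \<Longrightarrow> h (pt (circle l) e0 y) = pt E e'
        (c + of_int k * y)"
        using C.cover_piece_right[OF hc d'(1,2)] s by metis
      then show ?thesis using s
        by (intro exI[of _ "x' - x0"] conjI exI[of _ e'] exI[of _ "c + of_int k * x0"] exI[of _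
          k]) (auto simp: algebra_simps)
    next
      assume s: "s0 = -1 \<and> 0 < x0"
      obtain e' k c x' where p: "x' < x0" "\<And>y. x' \<le> y \<Longrightarrow> y \<le> x0 \<Longrightarrow> h (pt (circle l) e0 y) = pt E e'
        (c + of_int k * y)"
        using C.cover_piece_left[OF hc d'(1) _ d'(3)] s by metis
      then show ?thesis using s
        by (intro exI[of _ "x0 - x'"] conjI exI[of _ e'] exI[of _ "c + of_int k * x0"] exI[of _
          "-k"]) (auto simp: algebra_simps)
    qed
    then obtain \<delta>2 e' c2 and k2 :: int where \<delta>2: "\<delta>2 > 0"
      "\<And>\<epsilon>. 0 \<le> \<epsilon> \<Longrightarrow> \<epsilon> \<le> \<delta>2 \<Longrightarrow> h (pt (circle l) e0 (x0 + s0 * \<epsilon>)) = pt E e' (c2 + of_int k2 * \<epsilon>)" by blast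
    define K where "K = real_of_int \<bar>k\<bar>"
    have K: "K > 0" using \<open>k \<noteq> 0\<close> by (simp add: K_def)
    define M where "M = min \<delta>1 \<delta>2 / K"
    have M: "0 < M" using \<delta>1(1) \<delta>2(1) K by (simp add: M_def)
    define B where "B = min ((v - u) / 2) M"
    have B: "0 < B" "B < v - u" "B \<le> M" using e M by (auto simp: B_def min_def)
    \<comment> \<open>Follow \<open>g\<close> and then \<open>h\<close> from the point at coordinate
      \<open>u\<close>. Only positive \<open>\<epsilon>\<close> are used, because at
      \<open>u\<close> itself there may be a vertex and the coordinate would be lost.\<close>
    have val: "c2 + of_int k2 * (K * \<epsilon>) = u + \<epsilon>" if \<epsilon>: "0 < \<epsilon>" "\<epsilon> \<le> B" for \<epsilon>
    proof -
      have "K * \<epsilon> \<le> K * M" using \<epsilon> B(3) K by (intro mult_left_mono) auto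
      then have "K * \<epsilon> \<le> min \<delta>1 \<delta>2" using K by (simp add: M_def)
      then have Ke: "0 \<le> K * \<epsilon>" "K * \<epsilon> \<le> \<delta>1" "K * \<epsilon> \<le> \<delta>2" using K \<epsilon> by simp_all
      have "g (pt E e (u + \<epsilon>)) = circle_pt l (c + of_int k * (u + \<epsilon>))" using \<epsilon> B by (intro gk) auto
      also have "c + of_int k * (u + \<epsilon>) = t0 + of_int \<tau> * (K * \<epsilon>)"
        unfolding K_def \<tau>k by (simp add: t0_def algebra_simps)
      also have "circle_pt l \<dots> = pt (circle l) e0 (x0 + s0 * (K * \<epsilon>))" using \<delta>1(2) Ke by simp
      finally have "h (g (pt E e (u + \<epsilon>))) = pt E e' (c2 + of_int k2 * (K * \<epsilon>))" using \<delta>2(2) Ke by simp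
      moreover have "h (g (pt E e (u + \<epsilon>))) = Inner e (u + \<epsilon>)"
        using hg(1)[OF in_pts[of "u + \<epsilon>"]] \<epsilon> B e E.pt_inner[of "u + \<epsilon>" e] by simp
      ultimately have "pt E e' (c2 + of_int k2 * (K * \<epsilon>)) = Inner e (u + \<epsilon>)" by simp
      then show ?thesis by (auto simp: pt_def split: if_splits)
    qed
    \<comment> \<open>Two values of \<open>\<epsilon>\<close> eliminate the offset \<open>c2\<close>
      and leave the product of the slopes.\<close>
    have "of_int k2 * (K * (B / 2)) = of_int k2 * (K * B) / 2" by simp
    then have "of_int k2 * (K * B) = B"
      using val[of B] val[of "B / 2"] B(1) by linarith
    then have "(of_int k2 * K) * B = 1 * B" by (simp only: mult.assoc mult_1_left)
    then have "of_int k2 * K = 1" using B(1) by (metis mult_right_cancel less_irrefl)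
    then have "real_of_int (k2 * \<bar>k\<bar>) = of_int 1" by (simp add: K_def)
    then have "k2 * \<bar>k\<bar> = 1" by (simp only: of_int_eq_iff)
    then show ?thesis by (auto simp: zmult_eq_1_iff)
  qed
  have edge: "\<exists>c (k::int). (k = 1 \<or> k = -1) \<and> (\<forall>x. 0 \<le> x \<and> x \<le> len E e \<longrightarrow> g (pt E e x) = circle_pt
    l (c + of_int k * x))"
    if e: "e \<in> E.EE" for e
  proof -
    obtain c and k :: int where ck: "\<And>x. 0 \<le> x \<Longrightarrow> x \<le> len E e \<Longrightarrow> g (pt E e x) = circle_pt l (c +
      of_int k * x)"
    proof (rule C.affine_glue[of "len E e" "\<lambda>x. g (pt E e x)"])
      show "0 \<le> len E e" using E.len_pos[OF e] by simp
      show "g (pt E e x) \<in> points (circle l)" if "0 \<le> x" "x \<le> len E e" for x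
        using hg E.pt_in_points[OF e that] by blast
      show "\<exists>x' c (k::int). x < x' \<and> (\<forall>y. x \<le> y \<and> y \<le> x' \<longrightarrow> g (pt E e y) = circle_pt l (c + of_int
        k * y))"
        if "0 \<le> x" "x < len E e" for x
        by (rule C.cover_affine_right[OF E.curve_axioms gc e that]) blast
      show "\<exists>x' c (k::int). x' < x \<and> (\<forall>y. x' \<le> y \<and> y \<le> x \<longrightarrow> g (pt E e y) = circle_pt l (c + of_int
        k * y))"
        if "0 < x" "x \<le> len E e" for x
        by (rule C.cover_affine_left[OF E.curve_axioms gc e that]) blast
      fix x u v c c' and k k' :: int
      assume a: "0 < x" "x < len E e" "u < x" "x < v" "\<And>y. u \<le> y \<Longrightarrow> y \<le> x \<Longrightarrow> g (pt E e y) =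
        circle_pt l (c + of_int k * y)"
        "\<And>y. x \<le> y \<Longrightarrow> y \<le> v \<Longrightarrow> g (pt E e y) = circle_pt l (c' + of_int k' * y)"
      have k: "k = 1 \<or> k = -1" by (rule unit[OF e, of "max 0 u" x c]) (use a in auto)
      have k': "k' = 1 \<or> k' = -1" by (rule unit[OF e, of x "min v (len E e)" c']) (use a in auto)
      \<comment> \<open>Opposite unit slopes would fold the edge at \<open>x\<close>: the points at
        \<open>x - \<epsilon>\<close> and \<open>x + \<epsilon>\<close> would have the same image,
        against injectivity.\<close>
      show "k = k'"
      proof (rule ccontr)
        assume "k \<noteq> k'"
        then have kk: "k' = - k" using k k' by auto
        define \<epsilon> where "\<epsilon> = min (min (x - max 0 u) (min v (len E e) - x) / 2) 1"
        have eps: "0 < \<epsilon>" "0 < x - \<epsilon>" "u \<le> x - \<epsilon>" "x + \<epsilon> \<le> v" "x + \<epsilon> < len E e"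
          using a(1-4) by (auto simp: \<epsilon>_def min_def max_def field_simps)
        have "circle_pt l (c + of_int k * x) = circle_pt l (c' + of_int k' * x)" using a(3-4)
          a(5)[of x] a(6)[of x] by simp
        from C.\<rho>_shift[OF this, of "- of_int k * \<epsilon>"]
        have "circle_pt l (c + of_int k * (x - \<epsilon>)) = circle_pt l (c' + of_int k' * (x + \<epsilon>))"
          by (simp add: kk algebra_simps)
        then have "g (pt E e (x - \<epsilon>)) = g (pt E e (x + \<epsilon>))" using a(5)[of "x - \<epsilon>"] a(6)[of "x +
          \<epsilon>"] eps by simp
        moreover have "pt E e (x - \<epsilon>) \<in> points E" "pt E e (x + \<epsilon>) \<in> points E"
          using eps a(1,2) by (auto intro!: E.pt_in_points[OF e])
        ultimately have "pt E e (x - \<epsilon>) = pt E e (x + \<epsilon>)" using hg(1) by metis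
        moreover have "pt E e (x - \<epsilon>) = Inner e (x - \<epsilon>)" "pt E e (x + \<epsilon>) = Inner e (x + \<epsilon>)"
          using eps a(1,2) by (auto intro!: E.pt_inner)
        ultimately show False using eps(1) by simp
      qed
    qed (rule that)
    have "k = 1 \<or> k = -1" by (rule unit[OF e, of 0 "len E e" c]) (use ck E.len_pos[OF e] in auto)
    then show ?thesis using ck by blast
  qed
  then obtain c and k :: "nat \<Rightarrow> int" where ck: "\<And>e. e \<in> E.EE \<Longrightarrow> k e = 1 \<or> k e = -1"
    "\<And>e x. e \<in> E.EE \<Longrightarrow> 0 \<le> x \<Longrightarrow> x \<le> len E e \<Longrightarrow> g (pt E e x) = circle_pt l (c e + of_int (k e) * x)"
    by metis
  have "elliptic E l (\<lambda>t. h (circle_pt l t)) c (\<lambda>e. if e \<in> E.EE then k e else 0)"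
  proof unfold_locales
    show "h (circle_pt l t) \<in> points E" for t using surj C.\<rho>_points by blast
    show "\<exists>t. P = h (circle_pt l t)" if "P \<in> points E" for P
    proof -
      have "P \<in> h ` points (circle l)" using that by (simp only: surj)
      then obtain Q where Q: "P = h Q" "Q \<in> points (circle l)" by (rule imageE)
      from C.\<rho>_surj[OF Q(2)] obtain t where "Q = circle_pt l t" ..
      then show ?thesis using Q(1) by (intro exI[of _ t]) simp
    qed
    show "h (circle_pt l t) = h (circle_pt l t') \<longleftrightarrow> (\<exists>n::int. t - t' = of_int n * l)" for t t'
      using inj_on_eq_iff[OF inj C.\<rho>_points C.\<rho>_points] C.\<rho>_eq by simp
    show "pt E e x = h (circle_pt l (c e + of_int (if e \<in> E.EE then k e else 0) * x))"
      if "e \<in> E.EE" "0 \<le> x" "x \<le> len E e" for e x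
      using ck(2)[OF that] hg(1)[OF E.pt_in_points[OF that]] that by simp
  qed (use l gen ck(1) in auto)
  then show ?thesis by (rule that)
qed

section \<open>Theta graphs and bouquets of two circles\<close>

definition map_of_data :: "metric_graph \<Rightarrow> (real \<Rightarrow> point) \<Rightarrow> (nat \<Rightarrow> int) \<Rightarrow> (nat \<Rightarrow> real) \<Rightarrow> point \<Rightarrow>
  point" where
  "map_of_data \<Gamma> \<rho> s p P =
     (case P of Vertex v \<Rightarrow> \<rho> (p v) | Inner e x \<Rightarrow> \<rho> (p (tail (graph \<Gamma>) e) + of_int (s e) * x))"

text \<open>The winding relation is what makes the value at the head agree with the continuation
  along the edge.\<close>

lemma circle_map_of_data:
  assumes "uniformized E l \<rho> a \<sigma>" "curve \<Gamma>" "s \<in> balanced \<Gamma>"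
    and winding: "\<And>e. e \<in> arcs (graph \<Gamma>) \<Longrightarrow>
      of_int (s e) * len \<Gamma> e = p (head (graph \<Gamma>) e) - p (tail (graph \<Gamma>) e) + of_int (w e) * l"
  shows "circle_map E l \<rho> a \<sigma> \<Gamma> (map_of_data \<Gamma> \<rho> s p) s w p"
proof -
  interpret E: uniformized E l \<rho> a \<sigma> by fact
  interpret curve \<Gamma> by fact
  show ?thesis
  proof unfold_locales
    fix e x assume e: "e \<in> EE" "0 \<le> x" "x \<le> len \<Gamma> e"
    have "p (src e) + of_int (s e) * len \<Gamma> e = p (tgt e) + of_int (w e) * l" using winding[OF
      e(1)] by simp
    then show "map_of_data \<Gamma> \<rho> s p (pt \<Gamma> e x) = \<rho> (p (src e) + of_int (s e) * x)"
      by (simp add: map_of_data_def pt_def)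
  qed (use assms in \<open>simp_all add: map_of_data_def\<close>)
qed

text \<open>Reduces the theorem to integers on a graph: slopes, windings and lifts with the stated
  orthogonality, and one slope of absolute value 1 for each map.\<close>

lemma splitting_exists:
  assumes E': "elliptic E' l' \<rho>' a' \<sigma>'" and E: "elliptic E l \<rho> a \<sigma>" and \<Gamma>: "curve \<Gamma>" "has_genus \<Gamma>
    2" and d: "0 < d"
    and bal: "s' \<in> balanced \<Gamma>" "s \<in> balanced \<Gamma>"
    and winding: "\<And>e. e \<in> arcs (graph \<Gamma>) \<Longrightarrow>
        of_int (s' e) * len \<Gamma> e = p' (head (graph \<Gamma>) e) - p' (tail (graph \<Gamma>) e) + of_int (w' e) * l'"
      "\<And>e. e \<in> arcs (graph \<Gamma>) \<Longrightarrow>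
        of_int (s e) * len \<Gamma> e = p (head (graph \<Gamma>) e) - p (tail (graph \<Gamma>) e) + of_int (w e) * l"
    and orth: "(\<Sum>e\<in>arcs (graph \<Gamma>). s' e * w' e) = int d" "(\<Sum>e\<in>arcs (graph \<Gamma>). s e * w e) = int d"
      "(\<Sum>e\<in>arcs (graph \<Gamma>). s e * w' e) = 0" "(\<Sum>e\<in>arcs (graph \<Gamma>). s' e * w e) = 0"
    and separating: "\<And>\<omega>. \<omega> \<in> balanced \<Gamma> \<Longrightarrow> (\<Sum>e\<in>arcs (graph \<Gamma>). \<omega> e * w' e) = 0 \<Longrightarrow>
      (\<Sum>e\<in>arcs (graph \<Gamma>). \<omega> e * w e) = 0 \<Longrightarrow> \<omega> = (\<lambda>_. 0)"
    and image: "\<And>x y. (\<exists>\<omega>\<in>balanced \<Gamma>. (\<Sum>e\<in>arcs (graph \<Gamma>). \<omega> e * w' e) = x \<and>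
      (\<Sum>e\<in>arcs (graph \<Gamma>). \<omega> e * w e) = y) \<longleftrightarrow> int d dvd x - y"
    and primitive: "\<exists>e\<in>arcs (graph \<Gamma>). \<bar>s' e\<bar> = 1" "\<exists>e\<in>arcs (graph \<Gamma>). \<bar>s e\<bar> = 1"
  shows "\<exists>\<Gamma> \<phi>' \<phi>. tropical_curve \<Gamma> \<and> has_genus \<Gamma> 2 \<and>
        optimal_cover \<Gamma> E' \<phi>' \<and> has_degree \<Gamma> E' \<phi>' d \<and>
        optimal_cover \<Gamma> E \<phi> \<and> has_degree \<Gamma> E \<phi> d \<and>
        induces_splitting d \<Gamma> E' E \<phi>' \<phi>"
proof -
  interpret E': elliptic E' l' \<rho>' a' \<sigma>' by fact
  interpret E: elliptic E l \<rho> a \<sigma> by fact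
  interpret curve \<Gamma> by fact
  define \<phi>' where "\<phi>' = map_of_data \<Gamma> \<rho>' s' p'"
  define \<phi> where "\<phi> = map_of_data \<Gamma> \<rho> s p"
  interpret M': circle_map E' l' \<rho>' a' \<sigma>' \<Gamma> \<phi>' s' w' p'
    unfolding \<phi>'_def by (rule circle_map_of_data) (use E'.uniformized_axioms \<Gamma> bal winding in auto)
  interpret M: circle_map E l \<rho> a \<sigma> \<Gamma> \<phi> s w p
    unfolding \<phi>_def by (rule circle_map_of_data) (use E.uniformized_axioms \<Gamma> bal winding in auto)
  interpret M': elliptic_map E' l' \<rho>' a' \<sigma>' \<Gamma> \<phi>' s' w' p' by unfold_locales
  interpret M: elliptic_map E l \<rho> a \<sigma> \<Gamma> \<phi> s w p by unfold_locales
  have deg: "M'.degree = int d" "M.degree = int d"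
    using orth by (simp_all add: M'.degree_def M.degree_def)
  \<comment> \<open>The pair (1, 1) always lies in the lattice; one cycle thus serves the optimality
    of both covers.\<close>
  obtain \<gamma> where \<gamma>: "\<gamma> \<in> balanced \<Gamma>" "(\<Sum>e\<in>EE. \<gamma> e * w' e) = 1" "(\<Sum>e\<in>EE. \<gamma> e * w e) = 1"
    using image[of 1 1] by auto
  have unif: "\<exists>l \<rho> a \<sigma>. uniformized C l \<rho> a \<sigma>" if "elliptic_curve C" for C
    using elliptic_curve_uniformized[OF that] by (metis elliptic.axioms(1))
  have prim: "m = 1 \<or> m = -1" if f: "\<exists>e\<in>EE. \<bar>f e\<bar> = 1" "\<And>e. e \<in> EE \<Longrightarrow> m dvd f e" for m :: int and f
    :: "nat \<Rightarrow> int"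
  proof -
    obtain e where "e \<in> EE" "\<bar>f e\<bar> = 1" using f(1) by blast
    then have "m dvd 1" using f(2)[of e] by (metis dvd_abs_iff)
    then show ?thesis by (simp add: abs_eq_iff' zdvd1_eq)
  qed
  have "optimal_cover \<Gamma> E' \<phi>'"
    using \<gamma> unif prim[OF primitive(1)] M'.surj_of_degree deg d by (intro M'.optimal[of \<gamma>]) auto
  moreover have "optimal_cover \<Gamma> E \<phi>"
    using \<gamma> unif prim[OF primitive(2)] M.surj_of_degree deg d by (intro M.optimal[of \<gamma>]) auto
  moreover have "has_degree \<Gamma> E' \<phi>' d" "has_degree \<Gamma> E \<phi> d"
    using deg M'.has_degree M.has_degree by auto
  moreover have "induces_splitting d \<Gamma> E' E \<phi>' \<phi>"
  proof -
    interpret splitting_pair E' l' \<rho>' a' \<sigma>' \<Gamma> \<phi>' s' w' p' E l \<rho> a \<sigma> \<phi> s w p d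
      by unfold_locales
        (use d orth separating image in \<open>simp_all add: M'.pull_form_def M.pull_form_def\<close>)
    show ?thesis by (rule induces_splitting)
  qed
  ultimately show ?thesis using \<Gamma>(2) tropical by blast
qed

section \<open>The two shapes of graphs and their cycles\<close>

lemma has_genus_2:
  fixes F :: "int \<Rightarrow> int \<Rightarrow> nat \<Rightarrow> int"
  assumes "curve \<Gamma>" and F: "\<And>x y. F x y \<in> balanced \<Gamma>"
    and add: "\<And>x y x' y'. F (x + x') (y + y') = (\<lambda>e. F x y e + F x' y' e)"
    and inj: "\<And>x y x' y'. F x y = F x' y' \<Longrightarrow> x = x' \<and> y = y'"
    and surj: "\<And>c. c \<in> balanced \<Gamma> \<Longrightarrow> \<exists>x y. c = F x y"
  shows "has_genus \<Gamma> 2"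
proof -
  let ?L = Poly_Mapping.lookup
  have "(\<lambda>f. F (?L f 0) (?L f 1)) \<in> iso (free_Abelian_group {..<2::nat}) (H1 \<Gamma>)"
    unfolding iso_def
  proof (intro CollectI conjI homI)
    show "bij_betw (\<lambda>f. F (?L f 0) (?L f 1)) (carrier (free_Abelian_group {..<2::nat})) (carrier
      (H1 \<Gamma>))"
      unfolding bij_betw_def
    proof
      show "inj_on (\<lambda>f. F (?L f 0) (?L f 1)) (carrier (free_Abelian_group {..<2::nat}))"
      proof (rule inj_onI)
        fix f g :: "nat \<Rightarrow>\<^sub>0 int"
        assume k: "f \<in> carrier (free_Abelian_group {..<2})" "g \<in> carrier (free_Abelian_group {..<2})"
          and "F (?L f 0) (?L f 1) = F (?L g 0) (?L g 1)"
        then have eq: "?L f 0 = ?L g 0" "?L f 1 = ?L g 1" using inj by blast+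
        have "?L f i = ?L g i" for i
        proof -
          consider "i = 0" | "i = 1" | "i \<notin> {..<2}" by fastforce
          then show ?thesis
          proof cases
            case 3
            then have "i \<notin> Poly_Mapping.keys f" "i \<notin> Poly_Mapping.keys g" using k by auto
            then show ?thesis by (simp add: in_keys_iff)
          qed (use eq in auto)
        qed
        then show "f = g" by (rule poly_mapping_eqI)
      qed
      show "(\<lambda>f. F (?L f 0) (?L f 1)) ` carrier (free_Abelian_group {..<2::nat}) = carrier (H1 \<Gamma>)"
      proof (intro equalityI subsetI)
        fix c assume "c \<in> carrier (H1 \<Gamma>)"
        then have "c \<in> balanced \<Gamma>" by (simp add: H1_def)
        then obtain x y where c: "c = F x y" using surj by blast
        define u0 u1 where "u0 = frag_of (0::nat)" and "u1 = frag_of (1::nat)"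
        have lk: "?L u0 i = (if i = 0 then 1 else 0)" "?L u1 i = (if i = 1 then 1 else 0)" for i
          unfolding u0_def u1_def by (auto simp: lookup_single lookup_one when_def)
        let ?f = "frag_cmul x u0 + frag_cmul y u1"
        have "?L ?f 0 = x" "?L ?f 1 = y" by (simp_all add: lookup_add lk)
        moreover have "Poly_Mapping.keys ?f \<subseteq> {..<2}"
          by (auto simp: in_keys_iff lookup_add lk split: if_splits)
        ultimately show "c \<in> (\<lambda>f. F (?L f 0) (?L f 1)) ` carrier (free_Abelian_group {..<2::nat})"
          unfolding c by (intro image_eqI[of _ _ ?f]) auto
      qed (use F in \<open>auto simp: H1_def\<close>)
    qed
  qed (use F add in \<open>auto simp: H1_def lookup_add\<close>)
  then have "free_Abelian_group {..<2::nat} \<cong> H1 \<Gamma>" by (auto simp: is_iso_def)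
  then show ?thesis
    unfolding has_genus_def by (rule group.iso_sym[OF group_free_Abelian_group])
qed

text \<open>Edges 0 and 1 lead from vertex 0 to vertex 1 and edge 2 leads back, so that a balanced
  form is a triple x, y, x + y without signs.\<close>

definition theta :: "(nat \<Rightarrow> real) \<Rightarrow> metric_graph" where
  "theta L = \<lparr>graph = \<lparr>verts = {0, 1}, arcs = {0, 1, 2}, tail = (\<lambda>e. if e = 2 then 1 else 0),
     head = (\<lambda>e. if e = 2 then 0 else 1)\<rparr>, len = L\<rparr>"

definition bouquet :: "(nat \<Rightarrow> real) \<Rightarrow> metric_graph" where
  "bouquet L = \<lparr>graph = \<lparr>verts = {0}, arcs = {0, 1}, tail = (\<lambda>e. 0), head = (\<lambda>e. 0)\<rparr>, len = L\<rparr>"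

lemma theta_simps [simp]:
  "verts (graph (theta L)) = {0, 1}" "arcs (graph (theta L)) = {0, 1, 2}"
  "tail (graph (theta L)) = (\<lambda>e. if e = 2 then 1 else 0)"
  "head (graph (theta L)) = (\<lambda>e. if e = 2 then 0 else 1)" "len (theta L) = L"
  by (simp_all add: theta_def)

lemma bouquet_simps [simp]:
  "verts (graph (bouquet L)) = {0}" "arcs (graph (bouquet L)) = {0, 1}"
  "tail (graph (bouquet L)) = (\<lambda>e. 0)" "head (graph (bouquet L)) = (\<lambda>e. 0)" "len (bouquet L) = L"
  by (simp_all add: bouquet_def)

lemma curve_theta: "0 < L 0 \<Longrightarrow> 0 < L 1 \<Longrightarrow> 0 < L 2 \<Longrightarrow> curve (theta L)"
proof
  assume L: "0 < L 0" "0 < L 1" "0 < L 2"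
  have wf: "wf_digraph (graph (theta L))" by unfold_locales auto
  have "Digraph_Component.connected (graph (theta L))"
    by (rule connected_star[OF wf, of 0]) auto
  then show "tropical_curve (theta L)"
    using L wf by (auto simp: tropical_curve_def fin_digraph_def fin_digraph_axioms_def)
qed

lemma curve_bouquet: "0 < L 0 \<Longrightarrow> 0 < L 1 \<Longrightarrow> curve (bouquet L)"
proof
  assume L: "0 < L 0" "0 < L 1"
  have wf: "wf_digraph (graph (bouquet L))" by unfold_locales auto
  have "Digraph_Component.connected (graph (bouquet L))"
    by (rule connected_star[OF wf, of 0]) auto
  then show "tropical_curve (bouquet L)"
    using L wf by (auto simp: tropical_curve_def fin_digraph_def fin_digraph_axioms_def)
qed

lemma balanced_theta:
  "c \<in> balanced (theta L) \<longleftrightarrow> (\<forall>e. e \<notin> {0, 1, 2} \<longrightarrow> c e = 0) \<and> c 2 = c 0 + c 1"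
proof -
  have "{e. (e = 0 \<or> e = Suc 0 \<or> e = 2) \<and> (if e = 2 then 0 else 1) = (0::nat)} = {2}"
    "{e. (e = 0 \<or> e = Suc 0 \<or> e = 2) \<and> (if e = 2 then 1 else 0) = (0::nat)} = {0, 1}"
    "{e. (e = 0 \<or> e = Suc 0 \<or> e = 2) \<and> (if e = 2 then 0 else 1) = Suc 0} = {0, 1}"
    "{e. (e = 0 \<or> e = Suc 0 \<or> e = 2) \<and> (if e = 2 then 1 else 0) = Suc 0} = {2::nat}"
    by (auto split: if_splits)
  then have "c \<in> balanced (theta L) \<longleftrightarrow>
    (\<forall>e. e \<notin> {0, 1, 2} \<longrightarrow> c e = 0) \<and> c 2 = c 0 + c 1 \<and> c 0 + c 1 = c 2"
    by (simp add: balanced_def)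
  then show ?thesis by metis
qed

lemma balanced_bouquet: "c \<in> balanced (bouquet L) \<longleftrightarrow> (\<forall>e. e \<notin> {0, 1} \<longrightarrow> c e = 0)"
  by (auto simp: balanced_def)

definition triple :: "'a \<Rightarrow> 'a \<Rightarrow> 'a \<Rightarrow> nat \<Rightarrow> 'a::zero" where
  "triple x y z e = (if e = 0 then x else if e = 1 then y else if e = 2 then z else 0)"

lemma triple_simps [simp]:
  "triple x y z 0 = x" "triple x y z (Suc 0) = y" "triple x y z 2 = z" "2 < e \<Longrightarrow> triple x y z e = 0"
  by (simp_all add: triple_def)

lemma eq_triple: "(\<forall>e. e \<notin> {0, 1, 2} \<longrightarrow> c e = 0) \<Longrightarrow> c = triple (c 0) (c 1) (c 2)"
  by (auto simp: triple_def fun_eq_iff)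

lemma triple_outside: "e \<notin> {0, 1, 2} \<Longrightarrow> triple x y z e = 0"
  by (simp add: triple_def)

lemma triple_in_balanced [simp]:
  "triple x y (x + y) \<in> balanced (theta L)" "triple x y 0 \<in> balanced (bouquet L)"
  by (auto simp: balanced_theta balanced_bouquet triple_def)

lemma balanced_theta_triple: "c \<in> balanced (theta L) \<longleftrightarrow> (\<exists>x y. c = triple x y (x + y))"
proof
  assume c: "c \<in> balanced (theta L)"
  then have "c = triple (c 0) (c 1) (c 2)" by (intro eq_triple) (simp add: balanced_theta)
  moreover have "c 2 = c 0 + c 1" using c by (simp add: balanced_theta)
  ultimately show "\<exists>x y. c = triple x y (x + y)" by metis
qed auto

lemma balanced_bouquet_triple: "c \<in> balanced (bouquet L) \<longleftrightarrow> (\<exists>x y. c = triple x y 0)"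
proof
  assume c: "c \<in> balanced (bouquet L)"
  then have "c = triple (c 0) (c 1) (c 2)" by (intro eq_triple) (auto simp: balanced_bouquet)
  moreover have "c 2 = 0" using c by (simp add: balanced_bouquet)
  ultimately show "\<exists>x y. c = triple x y 0" by metis
qed auto

lemma triple_add: "triple (x + x') (y + y') (z + z') = (\<lambda>e. triple x y z e + triple x' y' z' e)"
  for x y z :: "'a::monoid_add"
  by (simp add: triple_def fun_eq_iff)

lemma triple_eqD: "triple x y z = triple x' y' z' \<Longrightarrow> x = x' \<and> y = y'"
  by (metis triple_simps(1,2))

lemma has_genus_theta:
  assumes "curve (theta L)"
  shows "has_genus (theta L) 2"
proof (rule has_genus_2[OF assms, of "\<lambda>x y. triple x y (x + y)"])
  show "triple (x + x') (y + y') (x + x' + (y + y')) = (\<lambda>e. triple x y (x + y) e + triple x' y'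
    (x' + y') e)"
    for x y x' y' :: int
    unfolding triple_add[symmetric] by (simp add: algebra_simps)
  show "x = x' \<and> y = y'" if "triple x y (x + y) = triple x' y' (x' + y')" for x y x' y' :: int
    using that by (rule triple_eqD)
  show "\<exists>x y. c = triple x y (x + y)" if "c \<in> balanced (theta L)" for c
    using that by (rule balanced_theta_triple[THEN iffD1])
qed simp

lemma has_genus_bouquet:
  assumes "curve (bouquet L)"
  shows "has_genus (bouquet L) 2"
proof (rule has_genus_2[OF assms, of "\<lambda>x y. triple x y 0"])
  show "triple (x + x') (y + y') 0 = (\<lambda>e. triple x y 0 e + triple x' y' 0 e)" for x y x' y' :: int
    unfolding triple_add[symmetric] by simp
  show "x = x' \<and> y = y'" if "triple x y 0 = triple x' y' 0" for x y x' y' :: int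
    using that by (rule triple_eqD)
  show "\<exists>x y. c = triple x y 0" if "c \<in> balanced (bouquet L)" for c
    using that by (rule balanced_bouquet_triple[THEN iffD1])
qed simp

text \<open>The vectors (1, 1) and (k, k - d) form a basis for every k: the difference of the
  coordinates is d n, and m adjusts the rest.\<close>

lemma lattice_image:
  fixes d k :: int
  shows "(\<exists>m n. m + k * n = x \<and> m + (k - d) * n = y) \<longleftrightarrow> d dvd x - y"
proof
  assume "\<exists>m n. m + k * n = x \<and> m + (k - d) * n = y"
  then obtain m n where "m + k * n = x" "m + (k - d) * n = y" by blast
  then have "x - y = d * n" by (auto simp: algebra_simps)
  then show "d dvd x - y" by simp
next
  assume "d dvd x - y"
  then obtain n where "x - y = d * n" by (auto simp: dvd_def)
  then show "\<exists>m n. m + k * n = x \<and> m + (k - d) * n = y"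
    by (intro exI[of _ "x - k * n"] exI[of _ n]) (simp add: algebra_simps)
qed

lemma lattice_separating:
  fixes d k m n :: int
  assumes "d \<noteq> 0" "m + k * n = 0" "m + (k - d) * n = 0"
  shows "m = 0 \<and> n = 0"
proof -
  have "d * n = 0" using assms(2,3) by (simp add: algebra_simps)
  then show ?thesis using assms(1,2) by simp
qed

lemma bex_parametrized:
  assumes "\<And>c. c \<in> S \<longleftrightarrow> (\<exists>x y. c = f x y)"
  shows "(\<exists>c\<in>S. P c) \<longleftrightarrow> (\<exists>x y. P (f x y))"
  unfolding Bex_def assms by blast

text \<open>The cycle of edges 0 and 2 has coordinates (1, 1), that of edges 1 and 2 has coordinates
  (k, k - d). The equations in \<open>len\<close> are the winding relations of edges 2 and 1 for the
  two maps.\<close>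

lemma splitting_theta:
  assumes E': "elliptic E' l' \<rho>' a' \<sigma>'" and E: "elliptic E l \<rho> a \<sigma>" and d: "0 < d"
    and L: "0 < L0" "0 < L1" "0 < L2"
    and len: "(of_int (int d - k)) * L0 + (of_int (int d - k) + 1) * L2 = l'"
      "of_int k * L0 + (of_int k - 1) * L2 = l"
      "L1 = of_int (int d - k) * L0 + (of_int k - 1) * l'"
      "- L1 = of_int k * L0 + (of_int (k - int d) - 1) * l"
  shows "\<exists>\<Gamma> \<phi>' \<phi>. tropical_curve \<Gamma> \<and> has_genus \<Gamma> 2 \<and>
        optimal_cover \<Gamma> E' \<phi>' \<and> has_degree \<Gamma> E' \<phi>' d \<and>
        optimal_cover \<Gamma> E \<phi> \<and> has_degree \<Gamma> E \<phi> d \<and>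
        induces_splitting d \<Gamma> E' E \<phi>' \<phi>"
proof -
  let ?G = "theta (triple L0 L1 L2)"
  have c: "curve ?G" using L by (intro curve_theta) simp_all
  \<comment> \<open>The windings are normalized to 0 on the spanning tree, edge 0. The slopes are
    the balanced forms with coordinates (d, 0) and (0, d); edge 1 has slope 1 or -1, which gives
    primitivity.\<close>
  let ?s' = "triple (int d - k) 1 (int d - k + 1)" and ?w' = "triple 0 (k - 1) 1"
  let ?s = "triple k (- 1) (k + - 1)" and ?w = "triple 0 (k - int d - 1) 1"
  \<comment> \<open>The lift of vertex 1 is reached along edge 0.\<close>
  let ?p' = "\<lambda>v. if v = 0 then 0 else of_int (int d - k) * L0" and ?p = "\<lambda>v. if v = 0 then 0 else
    of_int k * L0"
  have W: "(\<Sum>e\<in>arcs (graph ?G). triple x y (x + y) e * ?w' e) = x + k * y"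
    "(\<Sum>e\<in>arcs (graph ?G). triple x y (x + y) e * ?w e) = x + (k - int d) * y" for x y
    by (simp_all add: algebra_simps)
  show ?thesis
  proof (rule splitting_exists[OF E' E c has_genus_theta[OF c] d, of ?s' ?s ?p' ?w' ?p ?w])
    show "?s' \<in> balanced ?G" "?s \<in> balanced ?G" by (simp_all only: triple_in_balanced)
    fix e assume "e \<in> arcs (graph ?G)"
    then consider "e = 0" | "e = 1" | "e = 2" by auto
    then show "of_int (?s' e) * len ?G e = ?p' (head (graph ?G) e) - ?p' (tail (graph ?G) e) +
      of_int (?w' e) * l'"
      using len(1,3) by cases (simp_all add: algebra_simps)
    from \<open>e \<in> arcs (graph ?G)\<close> consider "e = 0" | "e = 1" | "e = 2" by auto
    then show "of_int (?s e) * len ?G e = ?p (head (graph ?G) e) - ?p (tail (graph ?G) e) + of_int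
      (?w e) * l"
      using len(2,4) by cases (simp_all add: algebra_simps)
  next
    show "(\<Sum>e\<in>arcs (graph ?G). ?s' e * ?w' e) = int d" "(\<Sum>e\<in>arcs (graph ?G). ?s e * ?w e) = int d"
      "(\<Sum>e\<in>arcs (graph ?G). ?s e * ?w' e) = 0" "(\<Sum>e\<in>arcs (graph ?G). ?s' e * ?w e) = 0"
      unfolding W by simp_all
    show "\<omega> = (\<lambda>_. 0)" if h: "\<omega> \<in> balanced ?G" "(\<Sum>e\<in>arcs (graph ?G). \<omega> e * ?w' e) = 0"
      "(\<Sum>e\<in>arcs (graph ?G). \<omega> e * ?w e) = 0" for \<omega>
    proof -
      obtain x y where \<omega>: "\<omega> = triple x y (x + y)" using h(1) balanced_theta_triple by blast
      have "x = 0 \<and> y = 0"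
        using h(2,3) d unfolding \<omega> W by (intro lattice_separating[of "int d" x k y]) auto
      then show ?thesis unfolding \<omega> by (simp add: triple_def fun_eq_iff)
    qed
    show "(\<exists>\<omega>\<in>balanced ?G. (\<Sum>e\<in>arcs (graph ?G). \<omega> e * ?w' e) = x \<and> (\<Sum>e\<in>arcs (graph ?G). \<omega> e * ?w
      e) = y) \<longleftrightarrow>
      int d dvd x - y" for x y
    proof -
      have "(\<exists>\<omega>\<in>balanced ?G. (\<Sum>e\<in>arcs (graph ?G). \<omega> e * ?w' e) = x \<and> (\<Sum>e\<in>arcs (graph ?G). \<omega> e * ?w
        e) = y) \<longleftrightarrow>
        (\<exists>m n. (\<Sum>e\<in>arcs (graph ?G). triple m n (m + n) e * ?w' e) = x \<and> (\<Sum>e\<in>arcs (graph ?G).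
          triple m n (m + n) e * ?w e) = y)"
        by (rule bex_parametrized) (rule balanced_theta_triple)
      then show ?thesis unfolding W lattice_image .
    qed
    show "\<exists>e\<in>arcs (graph ?G). \<bar>?s' e\<bar> = 1" "\<exists>e\<in>arcs (graph ?G). \<bar>?s e\<bar> = 1"
      by (intro bexI[of _ 1]; simp)+
  qed
qed

text \<open>With one vertex lifted to 0, the winding relation says that each loop closes up after a
  whole number of turns; the windings of the two loops are their coordinates.\<close>

lemma splitting_bouquet:
  assumes E': "elliptic E' l' \<rho>' a' \<sigma>'" and E: "elliptic E l \<rho> a \<sigma>" and d: "0 < d"
    and L: "0 < L0" "0 < L1"
    and len: "of_int s0' * L0 = of_int w0' * l'" "of_int s1' * L1 = of_int w1' * l'"
      "of_int s0 * L0 = of_int w0 * l" "of_int s1 * L1 = of_int w1 * l"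
    and orth: "s0' * w0' + s1' * w1' = int d" "s0 * w0 + s1 * w1 = int d"
      "s0 * w0' + s1 * w1' = 0" "s0' * w0 + s1' * w1 = 0"
    and image: "\<And>x y. (\<exists>m n. m * w0' + n * w1' = x \<and> m * w0 + n * w1 = y) \<longleftrightarrow> int d dvd x - y"
    and separating: "\<And>m n. m * w0' + n * w1' = 0 \<Longrightarrow> m * w0 + n * w1 = 0 \<Longrightarrow> m = 0 \<and> n = 0"
    and primitive: "\<bar>s0'\<bar> = 1 \<or> \<bar>s1'\<bar> = 1" "\<bar>s0\<bar> = 1 \<or> \<bar>s1\<bar> = 1"
  shows "\<exists>\<Gamma> \<phi>' \<phi>. tropical_curve \<Gamma> \<and> has_genus \<Gamma> 2 \<and>
        optimal_cover \<Gamma> E' \<phi>' \<and> has_degree \<Gamma> E' \<phi>' d \<and>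
        optimal_cover \<Gamma> E \<phi> \<and> has_degree \<Gamma> E \<phi> d \<and>
        induces_splitting d \<Gamma> E' E \<phi>' \<phi>"
proof -
  let ?G = "bouquet (triple L0 L1 0)"
  have c: "curve ?G" using L by (intro curve_bouquet) simp_all
  let ?s' = "triple s0' s1' 0" and ?w' = "triple w0' w1' 0" and ?s = "triple s0 s1 0" and ?w =
    "triple w0 w1 0"
  have W: "(\<Sum>e\<in>arcs (graph ?G). triple x y 0 e * triple u v 0 e) = x * u + y * v" for x y u v :: int
    by simp
  show ?thesis
  proof (rule splitting_exists[OF E' E c has_genus_bouquet[OF c] d, of ?s' ?s "\<lambda>_. 0" ?w' "\<lambda>_. 0" ?w])
    show "?s' \<in> balanced ?G" "?s \<in> balanced ?G" by simp_all
    fix e assume "e \<in> arcs (graph ?G)"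
    then have "e = 0 \<or> e = 1" by auto
    then show "of_int (?s' e) * len ?G e = 0 - 0 + of_int (?w' e) * l'"
      "of_int (?s e) * len ?G e = 0 - 0 + of_int (?w e) * l"
      using len by auto
  next
    show "(\<Sum>e\<in>arcs (graph ?G). ?s' e * ?w' e) = int d" "(\<Sum>e\<in>arcs (graph ?G). ?s e * ?w e) = int d"
      "(\<Sum>e\<in>arcs (graph ?G). ?s e * ?w' e) = 0" "(\<Sum>e\<in>arcs (graph ?G). ?s' e * ?w e) = 0"
      unfolding W by (fact orth)+
    show "\<omega> = (\<lambda>_. 0)" if h: "\<omega> \<in> balanced ?G" "(\<Sum>e\<in>arcs (graph ?G). \<omega> e * ?w' e) = 0"
      "(\<Sum>e\<in>arcs (graph ?G). \<omega> e * ?w e) = 0" for \<omega>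
    proof -
      obtain x y where \<omega>: "\<omega> = triple x y 0" using h(1) balanced_bouquet_triple by blast
      have "x = 0 \<and> y = 0" using h(2,3) unfolding \<omega> W by (rule separating)
      then show ?thesis unfolding \<omega> by (simp add: triple_def fun_eq_iff)
    qed
    show "(\<exists>\<omega>\<in>balanced ?G. (\<Sum>e\<in>arcs (graph ?G). \<omega> e * ?w' e) = x \<and> (\<Sum>e\<in>arcs (graph ?G). \<omega> e * ?w
      e) = y) \<longleftrightarrow>
      int d dvd x - y" for x y
    proof -
      have "(\<exists>\<omega>\<in>balanced ?G. (\<Sum>e\<in>arcs (graph ?G). \<omega> e * ?w' e) = x \<and> (\<Sum>e\<in>arcs (graph ?G). \<omega> e * ?w
        e) = y) \<longleftrightarrow>
        (\<exists>m n. (\<Sum>e\<in>arcs (graph ?G). triple m n 0 e * ?w' e) = x \<and> (\<Sum>e\<in>arcs (graph ?G). triple m n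
          0 e * ?w e) = y)"
        by (rule bex_parametrized) (rule balanced_bouquet_triple)
      then show ?thesis unfolding W image .
    qed
    have arc: "0 \<in> arcs (graph ?G)" "1 \<in> arcs (graph ?G)" by simp_all
    have val: "?s' 0 = s0'" "?s' 1 = s1'" "?s 0 = s0" "?s 1 = s1" by simp_all
    show "\<exists>e\<in>arcs (graph ?G). \<bar>?s' e\<bar> = 1" "\<exists>e\<in>arcs (graph ?G). \<bar>?s e\<bar> = 1"
      using primitive arc val by metis+
  qed
qed

text \<open>The lattice \<open>{(x, y). d dvd x - y}\<close> with the form \<open>(l' x\<^sup>2 + l y\<^sup>2) / d\<close> is reduced by the basis
  \<open>(1, 1)\<close>, \<open>(k, k - d)\<close>, where \<open>k = \<lceil>l d / (l' + l)\<rceil>\<close>: then \<open>0 \<le> B < A\<close> and \<open>B \<le> C\<close> for the Gram matrix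
  with entries \<open>A\<close>, \<open>B\<close>, \<open>C\<close>, so that \<open>A - B\<close>, \<open>C - B\<close>, \<open>B\<close> are edge lengths.\<close>

lemma elliptic_splitting:
  assumes E': "elliptic E' l' \<rho>' a' \<sigma>'" and E: "elliptic E l \<rho> a \<sigma>" and d: "0 < d"
  shows "\<exists>\<Gamma> \<phi>' \<phi>. tropical_curve \<Gamma> \<and> has_genus \<Gamma> 2 \<and>
        optimal_cover \<Gamma> E' \<phi>' \<and> has_degree \<Gamma> E' \<phi>' d \<and>
        optimal_cover \<Gamma> E \<phi> \<and> has_degree \<Gamma> E \<phi> d \<and>
        induces_splitting d \<Gamma> E' E \<phi>' \<phi>"
proof (cases "d = 1")
  \<comment> \<open>Here k would be 1 and C = B, so one edge of the theta graph would have length 0.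
    The lattice consists of all integer pairs, and the bouquet of the two given circles works, each
    cover contracting the other loop.\<close>
  case True
  have l: "0 < l'" "0 < l"
    using elliptic.axioms(1)[OF E'] elliptic.axioms(1)[OF E] by (auto dest: uniformized.l_pos)
  show ?thesis
    by (rule splitting_bouquet[OF E' E d, of l' l 1 1 0 0 0 0 1 1])
      (use True l in \<open>simp_all\<close>)
next
  case False
  have l: "0 < l'" "0 < l"
    using elliptic.axioms(1)[OF E'] elliptic.axioms(1)[OF E] by (auto dest: uniformized.l_pos)
  define D where "D = real d"
  have D: "2 \<le> D" using d False by (simp add: D_def)
  \<comment> \<open>The least integer for which the Gram entry B, proportional to
    \<open>K * (l' + l) - l * D\<close>, is nonnegative. Minimality gives B < A.\<close>
  define k where "k = \<lceil>l * D / (l' + l)\<rceil>"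
  define K where "K = real_of_int k"
  have "l * D / (l' + l) \<le> K" "K < l * D / (l' + l) + 1" unfolding K_def k_def by linarith+
  then have kb: "l * D \<le> K * (l' + l)" "K * (l' + l) < l * D + (l' + l)"
    using l by (simp_all add: pos_divide_le_eq pos_less_divide_eq field_simps)
  have "0 < l * D / (l' + l)" using l D by simp
  then have k1: "1 \<le> K" unfolding K_def k_def by (simp add: one_le_ceiling)
  have "l * D / (l' + l) \<le> D" using l D by (simp add: pos_divide_le_eq)
  then have kd: "K \<le> D" unfolding K_def k_def D_def by (metis ceiling_le_iff of_int_le_iff
    of_int_of_nat_eq)
  \<comment> \<open>In terms of the Gram matrix: A - B, then C - B, then B.\<close>
  define L0 where "L0 = ((l' + l) + l * D - K * (l' + l)) / D"
  define L1 where "L1 = (l' * (K * (K - 1)) + l * ((D - K) * (D - K + 1))) / D"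
  define L2 where "L2 = (K * (l' + l) - l * D) / D"
  have L0: "0 < L0" using kb(2) D by (simp add: L0_def)
  have L1: "0 < L1"
  proof -
    have "0 \<le> l' * (K * (K - 1))" "0 \<le> l * ((D - K) * (D - K + 1))" using l k1 kd by simp_all
    \<comment> \<open>The second summand vanishes only for \<open>K = D\<close>, and then the first
      is positive because \<open>D\<close> is at least 2.\<close>
    moreover have "0 < l' * (K * (K - 1)) \<or> 0 < l * ((D - K) * (D - K + 1))"
    proof (cases "K < D")
      case True
      then show ?thesis using l by simp
    next
      case False
      then show ?thesis using l D by simp
    qed
    ultimately show ?thesis using D by (auto simp: L1_def intro!: divide_pos_pos)
  qed
  have dk: "real_of_int (int d - k) = D - K" "real_of_int (k - int d) = K - D" "real_of_int k = K"
    by (simp_all add: D_def K_def)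
  have D0: "D \<noteq> 0" using D by simp
  show ?thesis
  proof (cases "L2 = 0")
    case False
    moreover have "0 \<le> L2" using kb(1) D by (simp add: L2_def)
    ultimately have L2: "0 < L2" by simp
    show ?thesis
    proof (rule splitting_theta[OF E' E d L0 L1 L2, of k]; unfold dk)
      show "(D - K) * L0 + (D - K + 1) * L2 = l'" "K * L0 + (K - 1) * L2 = l"
        "L1 = (D - K) * L0 + (K - 1) * l'" "- L1 = K * L0 + (K - D - 1) * l"
        using D0 by (simp_all add: L0_def L1_def L2_def field_simps)
    qed
  next
    \<comment> \<open>B = 0: the basis is orthogonal, edge 2 of the theta graph shrinks to a point,
      and a bouquet with loops of lengths A and C remains. Slopes and loop coordinates are those of
      the theta graph.\<close>
    case True
    then have Kl: "K * (l' + l) = l * D" using D0 by (simp add: L2_def)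
    have L0': "L0 = (l' + l) / D" using Kl by (simp add: L0_def)
    have L1': "L1 = K * l'"
    proof -
      have kl': "l * (D - K) = K * l'" using Kl by (simp add: algebra_simps)
      have "L1 * D = l' * (K * (K - 1)) + (l * (D - K)) * (D - K + 1)" using D0 by (simp add: L1_def)
      also have "\<dots> = K * l' * D" unfolding kl' by (simp add: algebra_simps)
      finally show ?thesis using D0 by simp
    qed
    show ?thesis
    proof (rule splitting_bouquet[OF E' E d L0 L1, of "int d - k" 1 1 k k 1 "- 1" "k - int d"];
      (unfold dk)?)
      show "(D - K) * L0 = of_int 1 * l'" "of_int 1 * L1 = K * l'" "K * L0 = of_int 1 * l" "of_int
        (- 1) * L1 = (K - D) * l"
        using Kl D0 by (simp_all add: L0' L1' field_simps)
      show "(\<exists>m n. m * 1 + n * k = x \<and> m * 1 + n * (k - int d) = y) \<longleftrightarrow> int d dvd x - y" for x y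
        using lattice_image[of k x "int d" y] by (simp add: mult.commute)
      show "m = 0 \<and> n = 0" if "m * 1 + n * k = 0" "m * 1 + n * (k - int d) = 0" for m n
        using lattice_separating[of "int d" m k n] that d by (simp add: mult.commute)
    qed (simp_all add: algebra_simps)
  qed
qed

theorem theorem1p6:
  fixes TE' TE :: metric_graph and d :: nat
    and \<alpha> :: "((nat \<Rightarrow> int) \<Rightarrow> real) set \<Rightarrow> ((nat \<Rightarrow> int) \<Rightarrow> real) set"
    and G :: "((nat \<Rightarrow> int) \<times> (nat \<Rightarrow> int) \<Rightarrow> real) set set"
  assumes "elliptic_curve TE'" and "elliptic_curve TE" and "0 < d"
    and "\<alpha> \<in> iso (torsion_group (Jac TE') d) (torsion_group (Jac TE) d)"
    and "G = (\<lambda>x. point_pair (Jac TE') (Jac TE) x (\<alpha> x)) ` carrier (torsion_group (Jac TE') d)"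
  shows
    "(\<exists>\<Gamma> \<phi>' \<phi>. tropical_curve \<Gamma> \<and> has_genus \<Gamma> 2 \<and>
        optimal_cover \<Gamma> TE' \<phi>' \<and> has_degree \<Gamma> TE' \<phi>' d \<and>
        optimal_cover \<Gamma> TE \<phi> \<and> has_degree \<Gamma> TE \<phi> d \<and>
        induces_splitting d \<Gamma> TE' TE \<phi>' \<phi>) \<or>
     (\<exists>(\<Gamma> :: real \<Rightarrow> metric_graph) \<phi>' \<phi>. \<forall>t\<ge>0. tropical_curve (\<Gamma> t) \<and> has_genus (\<Gamma> t) 2 \<and>
        optimal_cover (\<Gamma> t) TE' (\<phi>' t) \<and> has_degree (\<Gamma> t) TE' (\<phi>' t) d \<and>
        optimal_cover (\<Gamma> t) TE (\<phi> t) \<and> has_degree (\<Gamma> t) TE (\<phi> t) d \<and>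
        induces_splitting d (\<Gamma> t) TE' TE (\<phi>' t) (\<phi> t))"
proof -
  obtain l' \<rho>' a' \<sigma>' where E': "elliptic TE' l' \<rho>' a' \<sigma>'"
    using elliptic_curve_uniformized[OF assms(1)] .
  obtain l \<rho> a \<sigma> where E: "elliptic TE l \<rho> a \<sigma>"
    using elliptic_curve_uniformized[OF assms(2)] .
  \<comment> \<open>The reduced basis always produces one curve, which is the first
    alternative.\<close>
  show ?thesis
    by (rule disjI1) (rule elliptic_splitting[OF E' E assms(3)])
qed

end
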